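(* Let $w$ be a weight vector and grade $S=\mathbb{K}[x_1,\dots,x_n]$ by $\deg(x_i)=w_i$. Let $m\in S$ be a monomial with $d=\deg(m)$ and let $I=\overline{m}$ be the principal $w$-stable ideal generated by $m$. Then the graded Poincar\'e series of $I$ is $$P_I^S(t,u)=\sum_{a=d}^{d+\max(w)-1}\ \sum_{b=1}^{n} C_{w,m}(a,b)\cdot u\,t^a\prod_{k=1}^{b-1}(1+u\,t^{w_k}),$$ where $\max(w)=\max_i w_i=w_1$.
   Context: Let $\mathbb{K}$ be a field, $S=\mathbb{K}[x_1,\dots,x_n]$, $R=\mathbb{K}[y_1,\dots,y_n]$. A weight vector is $w=(w_1,\dots,w_n)$ of positive integers with $w_1\ge w_2\ge\dots\ge w_n$. All degrees in $S$ are weighted: $\deg(x_i)=w_i$. Let $\psi:S\to R$ be the $\mathbb{K}$-algebra homomorphism with $\psi(x_i)=y_i^{w_i}$. A Borel move on a monomial $m\in R$ sends $m$ to $m\cdot\frac{y_{i_1}}{y_{j_1}}\cdots\frac{y_{i_s}}{y_{j_s}}$, where $i_t<j_t$ for all $t$ and $y_{j_1}\cdots y_{j_s}$ divides $m$. A monomial ideal of $R$ is strongly stable if it is closed under Borel moves on its monomials. $Borel(\mu)$ is the smallest strongly stable ideal of $R$ containing the monomial $\mu$. For a monomial $m\in S$, $\overline{m}:=\psi^{-1}(Borel(\psi(m)))$. For a monomial $\mu=y_{i_1}\cdots y_{i_r}$ with $i_1\le\dots\le i_r$ and an integer $e\ge 0$, $trunc_e(\mu)=y_{i_1}\cdots y_{i_e}$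 if $e\le r$, and $trunc_e(\mu)=\mu$ if $e>r$. For a monomial $\mu$, $\max(\mu)$ is the largest index of a variable dividing $\mu$, with $\max(1)=1$. The weighted Catalan diagram $C_{w,m}$, with $d=\deg(m)$, is the array of nonnegative integers $C_{w,m}(a,b)$, $0\le a\le d+w_1-1$, $1\le b\le n$, defined by $C_{w,m}(0,1)=1$ and, for all other $(a,b)$, $C_{w,m}(a,b)=\sum_{k=1}^b C_{w,m}(a-w_b,k)$ if $0\le a-w_b<d$ and $\max(trunc_{a-w_b+1}(\psi(m)))\ge b$, and $C_{w,m}(a,b)=0$ otherwise. The graded Poincar\'e series is the generating function of graded Betti numbers in the convention where minimal generators of $I$ are in homological position $1$: $P_I^S(t,u)=\sum_{i\ge1}\sum_j b_{i,j}(I)\,u^it^j$ with $b_{i,j}(I)=\dim_{\mathbb{K}}\mathrm{Tor}^S_{i-1}(I,\mathbb{K})_j$ (for a proper ideal this equals $\dim_{\mathbb{K}}\mathrm{Tor}^S_i(S/I,\mathbb{K})_j$ for $i\ge 1$). *)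

theory Defs
  imports
    "HOL-Algebra.Ideal"
    "HOL-Library.Poly_Mapping"
    "HOL-Library.Function_Algebras"
    "HOL-Computational_Algebra.Formal_Power_Series"
begin

section \<open>Polynomials in the variables with indices 1, ..., n\<close>

text \<open>
  A monomial is identified with its exponent vector. Both \<open>S\<close> and \<open>R\<close> are rendered by
  \<open>mpoly_ring n\<close>; they differ only in the grading.
\<close>

type_synonym monomial = "nat \<Rightarrow>\<^sub>0 nat"
type_synonym 'k mpoly = "monomial \<Rightarrow>\<^sub>0 'k"

definition monomials :: "nat \<Rightarrow> monomial set" where
  "monomials n = {t. Poly_Mapping.keys t \<subseteq> {1..n}}"

definition polys :: "nat \<Rightarrow> ('k::field) mpoly set" where
  "polys n = {p. Poly_Mapping.keys p \<subseteq> monomials n}"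

definition mpoly_ring :: "nat \<Rightarrow> ('k::field) mpoly ring" where
  "mpoly_ring n = \<lparr>carrier = polys n, monoid.mult = (*), one = 1, zero = 0, add = (+)\<rparr>"

lemma cring_mpoly_ring: "cring (mpoly_ring n :: ('k::field) mpoly ring)"
proof -
  have mult_closed: "p * q \<in> polys n" if "p \<in> polys n" "q \<in> polys n" for p q :: "'k mpoly"
  proof -
    have "Poly_Mapping.keys (a + b) \<subseteq> {1..n}"
      if "a \<in> Poly_Mapping.keys p" "b \<in> Poly_Mapping.keys q" for a b
      using that \<open>p \<in> polys n\<close> \<open>q \<in> polys n\<close> Poly_Mapping.keys_add[of a b]
      by (fastforce simp: polys_def monomials_def)
    then show ?thesis
      using keys_mult[of p q] by (fastforce simp: polys_def monomials_def)
  qed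
  have add_closed: "p + q \<in> polys n" if "p \<in> polys n" "q \<in> polys n" for p q :: "'k mpoly"
    using that Poly_Mapping.keys_add[of p q] by (auto simp: polys_def)
  have "- p \<in> polys n" if "p \<in> polys n" for p :: "'k mpoly"
    using that by (simp add: polys_def)
  then have "\<exists>y\<in>polys n. y + p = 0" if "p \<in> polys n" for p :: "'k mpoly"
    using that by (intro bexI[of _ "- p"]) auto
  moreover have "(0 :: 'k mpoly) \<in> polys n" "(1 :: 'k mpoly) \<in> polys n"
    by (auto simp: polys_def monomials_def)
  ultimately show ?thesis
    by (intro cringI abelian_groupI comm_monoidI)
      (auto simp: mpoly_ring_def algebra_simps intro: mult_closed add_closed)
qed

definition mpol :: "monomial \<Rightarrow> ('k::field) mpoly" where
  "mpol t = Poly_Mapping.single t 1"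

definition Const :: "'k \<Rightarrow> ('k::field) mpoly" where
  "Const c = Poly_Mapping.single 0 c"

definition Var :: "nat \<Rightarrow> ('k::field) mpoly" where
  "Var i = mpol (Poly_Mapping.single i 1)"

definition weight_vector :: "nat \<Rightarrow> (nat \<Rightarrow> nat) \<Rightarrow> bool" where
  "weight_vector n w \<longleftrightarrow>
     n \<ge> 1 \<and> (\<forall>i\<in>{1..n}. 0 < w i) \<and> (\<forall>i\<in>{1..n}. \<forall>j\<in>{1..n}. i \<le> j \<longrightarrow> w j \<le> w i)"

definition wdeg :: "(nat \<Rightarrow> nat) \<Rightarrow> monomial \<Rightarrow> nat" where
  "wdeg w t = (\<Sum>i\<in>Poly_Mapping.keys t. w i * Poly_Mapping.lookup t i)"


section \<open>Strongly stable ideals and principal w-stable ideals\<close>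

definition monomial_ideal :: "nat \<Rightarrow> ('k::field) mpoly set \<Rightarrow> bool" where
  "monomial_ideal n J \<longleftrightarrow> (\<exists>M\<subseteq>monomials n. J = Idl\<^bsub>mpoly_ring n\<^esub> (mpol ` M))"

text \<open>
  The list \<open>ps\<close> collects the pairs \<open>(i\<^sub>t, j\<^sub>t)\<close> of the move, and \<open>\<nu>\<close> is the quotient of \<open>\<mu>\<close> by
  the product of the variables with indices \<open>j\<^sub>t\<close>.
\<close>

definition borel_move :: "nat \<Rightarrow> monomial \<Rightarrow> monomial \<Rightarrow> bool" where
  "borel_move n \<mu> \<mu>' \<longleftrightarrow>
     (\<exists>ps \<nu>. (\<forall>(i, j)\<in>set ps. 1 \<le> i \<and> i < j \<and> j \<le> n) \<and>
        \<mu> = \<nu> + (\<Sum>(i, j)\<leftarrow>ps. Poly_Mapping.single j 1) \<and>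
        \<mu>' = \<nu> + (\<Sum>(i, j)\<leftarrow>ps. Poly_Mapping.single i 1))"

definition strongly_stable :: "nat \<Rightarrow> ('k::field) mpoly set \<Rightarrow> bool" where
  "strongly_stable n J \<longleftrightarrow> monomial_ideal n J \<and>
     (\<forall>\<mu> \<mu>'. mpol \<mu> \<in> J \<and> borel_move n \<mu> \<mu>' \<longrightarrow> mpol \<mu>' \<in> J)"

definition Borel :: "nat \<Rightarrow> ('k::field) mpoly \<Rightarrow> 'k mpoly set" where
  "Borel n f = \<Inter>{J. strongly_stable n J \<and> f \<in> J}"

text \<open>The algebra homomorphism \<open>\<psi>\<close>, as substitution of \<open>y\<^sub>i ^ w\<^sub>i\<close> for \<open>x\<^sub>i\<close>.\<close>

definition psi :: "(nat \<Rightarrow> nat) \<Rightarrow> ('k::field) mpoly \<Rightarrow> 'k mpoly" where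
  "psi w p = (\<Sum>t\<in>Poly_Mapping.keys p. Const (Poly_Mapping.lookup p t) * (\<Prod>i\<in>Poly_Mapping.keys t. (Var i ^ w i) ^ Poly_Mapping.lookup t i))"

definition principal_stable :: "nat \<Rightarrow> (nat \<Rightarrow> nat) \<Rightarrow> monomial \<Rightarrow> ('k::field) mpoly set" where
  "principal_stable n w m = {p \<in> polys n. psi w p \<in> Borel n (psi w (mpol m))}"

text \<open>The exponent vector of \<open>\<psi>(m)\<close>, see \<open>psi_mon\<close> below.\<close>

definition psi_exp :: "(nat \<Rightarrow> nat) \<Rightarrow> monomial \<Rightarrow> monomial" where
  "psi_exp w m = (\<Sum>i\<in>Poly_Mapping.keys m. Poly_Mapping.single i (w i * Poly_Mapping.lookup m i))"

lemma Var_power: "(Var i :: ('k::field) mpoly) ^ e = mpol (Poly_Mapping.single i e)"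
  by (induction e) (simp_all add: Var_def mpol_def mult_single single_add[symmetric])

lemma psi_mon: "psi w (mpol m :: ('k::field) mpoly) = mpol (psi_exp w m)"
proof -
  have prod_mon: "(\<Prod>i\<in>A. mpol (g i) :: 'k mpoly) = mpol (\<Sum>i\<in>A. g i)" if "finite A"
    for A :: "nat set" and g
    using that by (induction A) (simp_all add: mpol_def mult_single)
  have "psi w (mpol m :: 'k mpoly) = (\<Prod>i\<in>Poly_Mapping.keys m. (Var i ^ w i) ^ Poly_Mapping.lookup m i)"
    by (simp add: psi_def mpol_def Const_def)
  also have "\<dots> = (\<Prod>i\<in>Poly_Mapping.keys m. mpol (Poly_Mapping.single i (w i * Poly_Mapping.lookup m i)))"
    by (simp only: power_mult[symmetric]) (simp only: Var_power)
  finally show ?thesis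
    by (simp add: prod_mon psi_exp_def)
qed


section \<open>The weighted Catalan diagram\<close>

text \<open>The indices \<open>i\<^sub>1 \<le> ... \<le> i\<^sub>r\<close> of the factorization of \<open>\<mu>\<close> into variables.\<close>

definition var_list :: "monomial \<Rightarrow> nat list" where
  "var_list \<mu> = concat (map (\<lambda>i. replicate (Poly_Mapping.lookup \<mu> i) i) (sorted_list_of_set (Poly_Mapping.keys \<mu>)))"

definition trunc :: "nat \<Rightarrow> monomial \<Rightarrow> monomial" where
  "trunc e \<mu> = (\<Sum>i\<leftarrow>take e (var_list \<mu>). Poly_Mapping.single i 1)"

definition max_var :: "monomial \<Rightarrow> nat" where
  "max_var \<mu> = (if \<mu> = 0 then 1 else Max (Poly_Mapping.keys \<mu>))"

text \<open>
  The diagram is only meaningful for \<open>1 \<le> b \<le> n\<close>. The guard \<open>0 < w b\<close>, which holds there for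
  every weight vector, makes the recursion terminate for arbitrary arguments.
\<close>

function catalan :: "(nat \<Rightarrow> nat) \<Rightarrow> monomial \<Rightarrow> nat \<Rightarrow> nat \<Rightarrow> nat" where
  "catalan w m a b =
     (if a = 0 \<and> b = 1 then 1
      else if 0 < w b \<and> w b \<le> a \<and> a - w b < wdeg w m
              \<and> b \<le> max_var (trunc (a - w b + 1) (psi_exp w m))
      then (\<Sum>k=1..b. catalan w m (a - w b) k)
      else 0)"
  by pat_completeness auto
termination
  by (relation "Wellfounded.measure (\<lambda>(w, m, a, b). a)") auto

declare catalan.simps [simp del]


section \<open>Graded free resolutions, Tor and graded Betti numbers\<close>

definition mat_map ::
    "nat \<Rightarrow> nat \<Rightarrow> (nat \<Rightarrow> nat \<Rightarrow> 'a) \<Rightarrow> (nat \<Rightarrow> 'a) \<Rightarrow> nat \<Rightarrow> 'a::comm_semiring_1" where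
  "mat_map r s A v = (\<lambda>l. if l < s then \<Sum>k<r. A l k * v k else 0)"

definition free_module :: "nat \<Rightarrow> nat \<Rightarrow> (nat \<Rightarrow> ('k::field) mpoly) set" where
  "free_module n r = {v. (\<forall>k<r. v k \<in> polys n) \<and> (\<forall>k\<ge>r. v k = 0)}"

text \<open>
  A complex \<open>\<dots> \<rightarrow> F\<^sub>1 \<rightarrow> F\<^sub>0\<close> of finitely generated graded free modules with an augmentation from
  \<open>F\<^sub>0\<close> to the ring, in coordinates: \<open>F\<^sub>i\<close> has basis elements \<open>e\<^sub>k\<close> with \<open>k < rk F i\<close>, where \<open>e\<^sub>k\<close>
  has degree \<open>bdeg F i k\<close>; the matrix \<open>dmat F i\<close> gives the differential from \<open>F\<^sub>i\<^sub>+\<^sub>1\<close> to \<open>F\<^sub>i\<close> (first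
  argument: row), and \<open>aug F k\<close> is the image of the basis element \<open>e\<^sub>k\<close> of \<open>F\<^sub>0\<close>.
\<close>

record 'p aug_complex =
  rk :: "nat \<Rightarrow> nat"
  bdeg :: "nat \<Rightarrow> nat \<Rightarrow> nat"
  dmat :: "nat \<Rightarrow> nat \<Rightarrow> nat \<Rightarrow> 'p"
  aug :: "nat \<Rightarrow> 'p"

definition diff_map :: "('k::field) mpoly aug_complex \<Rightarrow> nat \<Rightarrow> (nat \<Rightarrow> 'k mpoly) \<Rightarrow> nat \<Rightarrow> 'k mpoly" where
  "diff_map F i = mat_map (rk F (Suc i)) (rk F i) (dmat F i)"

definition aug_map :: "('k::field) mpoly aug_complex \<Rightarrow> (nat \<Rightarrow> 'k mpoly) \<Rightarrow> 'k mpoly" where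
  "aug_map F v = (\<Sum>k<rk F 0. aug F k * v k)"

definition graded_free_resolution ::
    "nat \<Rightarrow> (nat \<Rightarrow> nat) \<Rightarrow> ('k::field) mpoly set \<Rightarrow> 'k mpoly aug_complex \<Rightarrow> bool" where
  "graded_free_resolution n w I F \<longleftrightarrow>
     (\<forall>k<rk F 0. aug F k \<in> polys n \<and> (\<forall>t\<in>Poly_Mapping.keys (aug F k). wdeg w t = bdeg F 0 k)) \<and>
     (\<forall>i. \<forall>l<rk F i. \<forall>k<rk F (Suc i). dmat F i l k \<in> polys n \<and>
        (\<forall>t\<in>Poly_Mapping.keys (dmat F i l k). wdeg w t + bdeg F i l = bdeg F (Suc i) k)) \<and>
     aug_map F ` free_module n (rk F 0) = I \<and>
     diff_map F 0 ` free_module n (rk F 1) = {v \<in> free_module n (rk F 0). aug_map F v = 0} \<and>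
     (\<forall>i. diff_map F (Suc i) ` free_module n (rk F (Suc (Suc i))) =
        {v \<in> free_module n (rk F (Suc i)). diff_map F i v = 0})"

text \<open>
  Tensoring with the residue field \<open>K = S / (x\<^sub>1, \<dots>, x\<^sub>n)\<close> replaces \<open>F\<^sub>i\<close> by the vector space with
  the same basis and every matrix entry by its constant coefficient. The set \<open>fibre F i j\<close> is the
  degree \<open>j\<close> component of the tensor product of \<open>F\<^sub>i\<close> and \<open>K\<close>.
\<close>

definition fibre :: "('k::field) mpoly aug_complex \<Rightarrow> nat \<Rightarrow> nat \<Rightarrow> (nat \<Rightarrow> 'k) set" where
  "fibre F i j = {v. \<forall>k. v k \<noteq> 0 \<longrightarrow> k < rk F i \<and> bdeg F i k = j}"

definition fibre_diff :: "('k::field) mpoly aug_complex \<Rightarrow> nat \<Rightarrow> (nat \<Rightarrow> 'k) \<Rightarrow> nat \<Rightarrow> 'k" where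
  "fibre_diff F i = mat_map (rk F (Suc i)) (rk F i) (\<lambda>l k. Poly_Mapping.lookup (dmat F i l k) 0)"

definition fibre_cycles :: "('k::field) mpoly aug_complex \<Rightarrow> nat \<Rightarrow> nat \<Rightarrow> (nat \<Rightarrow> 'k) set" where
  "fibre_cycles F i j =
     (case i of 0 \<Rightarrow> fibre F 0 j | Suc i' \<Rightarrow> {v \<in> fibre F i j. fibre_diff F i' v = 0})"

definition fibre_boundaries :: "('k::field) mpoly aug_complex \<Rightarrow> nat \<Rightarrow> nat \<Rightarrow> (nat \<Rightarrow> 'k) set" where
  "fibre_boundaries F i j = fibre_diff F i ` fibre F (Suc i) j"

global_interpretation coord: vector_space "\<lambda>(c::'k::field) (v :: nat \<Rightarrow> 'k) k. c * v k"
  by unfold_locales (auto simp: fun_eq_iff algebra_simps)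

text \<open>
  The spaces involved are finite-dimensional, and the boundaries form a subspace of the cycles, so
  the difference below is the dimension of the homology space.
\<close>

definition homology_dim :: "('k::field) mpoly aug_complex \<Rightarrow> nat \<Rightarrow> nat \<Rightarrow> nat" where
  "homology_dim F i j = coord.dim (fibre_cycles F i j) - coord.dim (fibre_boundaries F i j)"

text \<open>The dimension of the degree \<open>j\<close> component of \<open>Tor\<^sub>i(I, K)\<close> for an ideal \<open>I\<close> of \<open>S\<close>, computed from a
  graded free resolution of \<open>I\<close>; the choice of the resolution is immaterial.\<close>

definition tor_dim :: "nat \<Rightarrow> (nat \<Rightarrow> nat) \<Rightarrow> ('k::field) mpoly set \<Rightarrow> nat \<Rightarrow> nat \<Rightarrow> nat" where
  "tor_dim n w I = homology_dim (SOME F. graded_free_resolution n w I F)"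

text \<open>The index shift puts the minimal generators of \<open>I\<close> in homological position 1.\<close>

definition betti :: "nat \<Rightarrow> (nat \<Rightarrow> nat) \<Rightarrow> ('k::field) mpoly set \<Rightarrow> nat \<Rightarrow> nat \<Rightarrow> nat" where
  "betti n w I i j = (if i = 0 then 0 else tor_dim n w I (i - 1) j)"

text \<open>The Poincare series is a power series in \<open>u\<close> whose coefficients are power series in \<open>t\<close>.\<close>

definition poincare_series :: "nat \<Rightarrow> (nat \<Rightarrow> nat) \<Rightarrow> ('k::field) mpoly set \<Rightarrow> int fps fps" where
  "poincare_series n w I = Abs_fps (\<lambda>i. Abs_fps (\<lambda>j. int (betti n w I i j)))"

definition u_var :: "int fps fps" where
  "u_var = fps_X"

definition t_var :: "int fps fps" where
  "t_var = fps_const fps_X"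

end

theory Submission
  imports Defs "HOL-Library.Product_Lexorder"
begin

text \<open>
  A monomial \<open>t\<close> lies in \<open>I\<close> iff its weighted partial degrees dominate those of \<open>m\<close>. Hence the minimal
  generators are the \<open>u \<in> I\<close> for which removing the last variable leads below degree \<open>d\<close>, and the
  diagram counts them by degree and last variable. Ordered by total degree and then by the sum
  of the variable indices, the generators have linear quotients: the colon ideal at \<open>u\<close> is generated
  by the variables before the last variable of \<open>u\<close>. Iterated mapping cones with Koszul complexes
  therefore yield a resolution with the Eliahou--Kervaire basis (pairs of a generator \<open>u\<close> and a set of
  variables before its last one), which is minimal because the total degrees of the generators do
  not decrease. The differentials are multigraded, so they are determined by scalars and exactness
  is checked in each multidegree as linear algebra. Since \<open>tor_dim\<close> refers to an arbitrary
  resolution, the comparison theorem is needed to transfer the ranks of the minimal one.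
\<close>

section \<open>Multigraded resolutions and mapping cones\<close>

text \<open>The membership criterion comes from the description of principal Borel ideals: a
  monomial lies in \<open>Borel(\<mu>)\<close> iff, for every c, it has at least as many factors of
  index at most c as \<open>\<mu>\<close> has. Since \<open>\<psi>\<close> multiplies the exponent
  of each variable by its weight, these counts become weighted partial degrees. The decreasing
  weights make the last variable of a monomial its lightest one, so that its removal decides
  minimality, and they turn domination in unweighted counts into domination in weighted degrees. The
  order uses the unweighted total degree because a unit entry would join two labels of equal
  multidegree whose variable sets differ by one in size; an order by number of factors rules this
  out at once. The quotient is resolved rather than the ideal, so that colon ideals and cones fit
  together uniformly. Entries into \<open>e0\<close> are exempt from minimality because for
  \<open>m = 0\<close> the generator 1 maps to \<open>e0\<close> with a unit coefficient. The
  diagram also has entries in degrees below d; they count monomials that satisfy the domination only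
  as far as their own degree permits.\<close>

definition mdvd :: "monomial \<Rightarrow> monomial \<Rightarrow> bool" where
  "mdvd s t \<longleftrightarrow> (\<forall>i. Poly_Mapping.lookup s i \<le> Poly_Mapping.lookup t i)"

lemma mdvd_refl [simp]: "mdvd s s"
  by (simp add: mdvd_def)

lemma mdvd_trans: "mdvd r s \<Longrightarrow> mdvd s t \<Longrightarrow> mdvd r t"
  unfolding mdvd_def using le_trans by blast

lemma mdvd_zero [simp]: "mdvd 0 t"
  by (simp add: mdvd_def)

lemma mdvd_add_left [simp]: "mdvd s (t + s)" "mdvd s (s + t)"
  by (auto simp: mdvd_def lookup_add)

lemma mdvd_add_cancel [simp]: "mdvd (s + g) (t + g) \<longleftrightarrow> mdvd s t"
  by (auto simp: mdvd_def lookup_add)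

lemma mdvd_minus_add: "mdvd s t \<Longrightarrow> t - s + s = t"
  by (intro poly_mapping_eqI) (auto simp: mdvd_def lookup_add lookup_minus)

lemma mdvd_iff_add: "mdvd s t \<longleftrightarrow> (\<exists>r. t = r + s)"
  by (metis mdvd_minus_add mdvd_add_left(1))

definition strand :: "'a set \<Rightarrow> ('a \<Rightarrow> monomial) \<Rightarrow> monomial \<Rightarrow> 'a set" where
  "strand E mdg \<alpha> = {k \<in> E. mdvd (mdg k) \<alpha>}"

definition supp :: "('a \<Rightarrow> 'k::zero) \<Rightarrow> 'a set" where
  "supp v = {k. v k \<noteq> 0}"

text \<open>The row \<open>M k\<close> is the image of the basis element \<open>k\<close>, so
  \<open>lin A M v\<close> is the image of \<open>v\<close>, and \<open>lin A M (N k)\<close> is a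
  row of the composite of \<open>N\<close> followed by \<open>M\<close>.\<close>

definition lin :: "'b set \<Rightarrow> ('b \<Rightarrow> 'a \<Rightarrow> 'k) \<Rightarrow> ('b \<Rightarrow> 'k) \<Rightarrow> 'a \<Rightarrow> 'k::comm_ring_1" where
  "lin A M v = (\<lambda>l. \<Sum>k\<in>A. v k * M k l)"

text \<open>
  A multigraded free resolution of the quotient by the monomial ideal with monomials \<open>J\<close>, given
  by scalars: the basis element \<open>k\<close> has multidegree \<open>mdg k\<close> and homological degree \<open>hdg k\<close>, its image
  under the differential has coefficient \<open>D k l\<close> times a monomial at \<open>l\<close>, and \<open>e0\<close> generates the
  ring itself. Exactness is imposed in every multidegree \<open>\<alpha>\<close>, where only the basis elements with
  \<open>mdg k\<close> dividing \<open>\<alpha>\<close> contribute. Minimality is included, except for entries into \<open>e0\<close>.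
\<close>

definition strand_res ::
    "'a set \<Rightarrow> ('a \<Rightarrow> nat) \<Rightarrow> ('a \<Rightarrow> monomial) \<Rightarrow> 'a \<Rightarrow> ('a \<Rightarrow> 'a \<Rightarrow> 'k::field) \<Rightarrow> monomial set \<Rightarrow> bool" where
  "strand_res E hdg mdg e0 D J \<longleftrightarrow>
     finite E \<and> e0 \<in> E \<and> mdg e0 = 0 \<and> (\<forall>k\<in>E. hdg k = 0 \<longleftrightarrow> k = e0) \<and>
     (\<forall>k\<in>E. \<forall>l. D k l \<noteq> 0 \<longrightarrow>
        l \<in> E \<and> mdvd (mdg l) (mdg k) \<and> hdg k = Suc (hdg l) \<and> (l \<noteq> e0 \<longrightarrow> mdg l \<noteq> mdg k)) \<and>
     (\<forall>k\<in>E. lin E D (D k) = (\<lambda>_. 0)) \<and>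
     (\<forall>\<alpha>\<in>J. \<forall>v. supp v \<subseteq> strand E mdg \<alpha> \<longrightarrow> lin E D v = (\<lambda>_. 0) \<longrightarrow>
        (\<exists>u. supp u \<subseteq> strand E mdg \<alpha> \<and> lin E D u = v)) \<and>
     (\<forall>\<alpha>. \<alpha> \<notin> J \<longrightarrow> strand E mdg \<alpha> = {e0})"

lemma lin_lin: "lin A M (lin B N v) = lin B (\<lambda>k. lin A M (N k)) v"
  unfolding lin_def
  by (auto simp: fun_eq_iff sum_distrib_left sum_distrib_right mult.assoc intro: sum.swap)

lemma lin_cong: "(\<And>k. k \<in> A \<Longrightarrow> v k \<noteq> 0 \<Longrightarrow> M k = N k) \<Longrightarrow> lin A M v = lin A N v"
  unfolding lin_def by (intro ext sum.cong) (auto, metis mult_zero_left)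

lemma lin_cong_vec: "(\<And>k. k \<in> A \<Longrightarrow> v k = u k) \<Longrightarrow> lin A M v = lin A M u"
  unfolding lin_def by (intro ext sum.cong) auto

lemma lin_zero [simp]: "lin A M (\<lambda>_. 0) = (\<lambda>_. 0)" "lin A (\<lambda>_ _. 0) v = (\<lambda>_. 0)"
  by (auto simp: lin_def)

lemma lin_add: "lin A M (\<lambda>k. u k + v k) = (\<lambda>l. lin A M u l + lin A M v l)"
  by (simp add: lin_def distrib_right sum.distrib)

lemma lin_diff: "lin A M (\<lambda>k. u k - v k) = (\<lambda>l. lin A M u l - lin A M v l)"
  by (simp add: lin_def left_diff_distrib sum_subtractf)

lemma lin_minus: "lin A M (\<lambda>k. - v k) = (\<lambda>l. - lin A M v l)"
  by (simp add: lin_def sum_negf)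

lemma lin_unit: "finite A \<Longrightarrow> a \<in> A \<Longrightarrow> lin A M (\<lambda>k. if k = a then c else 0) = (\<lambda>l. c * M a l)"
  unfolding lin_def by (intro ext) (simp add: if_distrib[of "\<lambda>x. x * _"] sum.delta cong: if_cong)

lemma lin_nonzeroD: "lin A M v l \<noteq> 0 \<Longrightarrow> \<exists>k\<in>A. v k \<noteq> 0 \<and> M k l \<noteq> 0"
  unfolding lin_def by (metis (mono_tags, lifting) mult_not_zero sum.not_neutral_contains_not_neutral)

text \<open>The differential lowers \<open>hdg\<close> by exactly one, so the other components of a
  preimage contribute nothing in degree \<open>N\<close>; discarding them makes lifts
  homogeneous.\<close>

lemma lin_hd_component:
  assumes "lin E D u = r"
    and "\<And>k l. k \<in> E \<Longrightarrow> D k l \<noteq> 0 \<Longrightarrow> hdg k = Suc (hdg l)"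
    and "\<And>l. r l \<noteq> 0 \<Longrightarrow> hdg l = N"
  shows "lin E D (\<lambda>k. if hdg k = Suc N then u k else 0) = r"
proof
  fix l
  show "lin E D (\<lambda>k. if hdg k = Suc N then u k else 0) l = r l"
  proof (cases "hdg l = N")
    case True
    have "lin E D (\<lambda>k. if hdg k = Suc N then u k else 0) l = lin E D u l"
      unfolding lin_def
    proof (intro sum.cong refl)
      fix k assume "k \<in> E"
      then have "D k l = 0" if "hdg k \<noteq> Suc N" using assms(2) that True by blast
      then show "(if hdg k = Suc N then u k else 0) * D k l = u k * D k l" by auto
    qed
    then show ?thesis using assms(1) by simp
  next
    case False
    have "lin E D (\<lambda>k. if hdg k = Suc N then u k else 0) l = 0"
      unfolding lin_def
    proof (intro sum.neutral ballI)
      fix k assume "k \<in> E"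
      then have "D k l = 0" if "hdg k = Suc N" using assms(2)[of k l] that False by auto
      then show "(if hdg k = Suc N then u k else 0) * D k l = 0" by auto
    qed
    then show ?thesis using assms(3) False by auto
  qed
qed

text \<open>The last three facts are consequences of the clauses: \<open>e0\<close> has nothing
  below it in homological degree, a degree outside \<open>J\<close> has only \<open>e0\<close> in
  its strand, and the square of the differential vanishes by linearity.\<close>

lemma strand_resD:
  assumes "strand_res E hdg mdg e0 D J"
  shows "finite E" "e0 \<in> E" "mdg e0 = 0" "\<And>k. k \<in> E \<Longrightarrow> hdg k = 0 \<longleftrightarrow> k = e0"
    "\<And>k l. k \<in> E \<Longrightarrow> D k l \<noteq> 0 \<Longrightarrow> l \<in> E"
    "\<And>k l. k \<in> E \<Longrightarrow> D k l \<noteq> 0 \<Longrightarrow> mdvd (mdg l) (mdg k)"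
    "\<And>k l. k \<in> E \<Longrightarrow> D k l \<noteq> 0 \<Longrightarrow> hdg k = Suc (hdg l)"
    "\<And>k l. k \<in> E \<Longrightarrow> D k l \<noteq> 0 \<Longrightarrow> l \<noteq> e0 \<Longrightarrow> mdg l \<noteq> mdg k"
    "\<And>k. k \<in> E \<Longrightarrow> lin E D (D k) = (\<lambda>_. 0)"
    "\<And>\<alpha> v. \<alpha> \<in> J \<Longrightarrow> supp v \<subseteq> strand E mdg \<alpha> \<Longrightarrow> lin E D v = (\<lambda>_. 0) \<Longrightarrow>
        \<exists>u. supp u \<subseteq> strand E mdg \<alpha> \<and> lin E D u = v"
    "\<And>\<alpha>. \<alpha> \<notin> J \<Longrightarrow> strand E mdg \<alpha> = {e0}"
    "D e0 = (\<lambda>_. 0)"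
    "\<And>k. k \<in> E \<Longrightarrow> k \<noteq> e0 \<Longrightarrow> mdg k \<in> J"
    "\<And>v. lin E D (lin E D v) = (\<lambda>_. 0)"
proof -
  note a = assms[unfolded strand_res_def]
  note c = a[THEN conjunct1]
    a[THEN conjunct2, THEN conjunct1]
    a[THEN conjunct2, THEN conjunct2, THEN conjunct1]
    a[THEN conjunct2, THEN conjunct2, THEN conjunct2, THEN conjunct1]
    a[THEN conjunct2, THEN conjunct2, THEN conjunct2, THEN conjunct2, THEN conjunct1]
    a[THEN conjunct2, THEN conjunct2, THEN conjunct2, THEN conjunct2, THEN conjunct2, THEN conjunct1]
    a[THEN conjunct2, THEN conjunct2, THEN conjunct2, THEN conjunct2, THEN conjunct2, THEN conjunct2, THEN conjunct1]
    a[THEN conjunct2, THEN conjunct2, THEN conjunct2, THEN conjunct2, THEN conjunct2, THEN conjunct2, THEN conjunct2]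
  show "finite E" "e0 \<in> E" "mdg e0 = 0" using c(1,2,3) by auto
  show "\<And>k. k \<in> E \<Longrightarrow> hdg k = 0 \<longleftrightarrow> k = e0" using c(4) by (rule bspec)
  show "\<And>k l. k \<in> E \<Longrightarrow> D k l \<noteq> 0 \<Longrightarrow> l \<in> E"
    "\<And>k l. k \<in> E \<Longrightarrow> D k l \<noteq> 0 \<Longrightarrow> mdvd (mdg l) (mdg k)"
    "\<And>k l. k \<in> E \<Longrightarrow> D k l \<noteq> 0 \<Longrightarrow> hdg k = Suc (hdg l)"
    "\<And>k l. k \<in> E \<Longrightarrow> D k l \<noteq> 0 \<Longrightarrow> l \<noteq> e0 \<Longrightarrow> mdg l \<noteq> mdg k"
    using c(5) by blast+
  show dd: "\<And>k. k \<in> E \<Longrightarrow> lin E D (D k) = (\<lambda>_. 0)" using c(6) by blast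
  show "\<And>\<alpha> v. \<alpha> \<in> J \<Longrightarrow> supp v \<subseteq> strand E mdg \<alpha> \<Longrightarrow> lin E D v = (\<lambda>_. 0) \<Longrightarrow>
        \<exists>u. supp u \<subseteq> strand E mdg \<alpha> \<and> lin E D u = v" using c(7) by blast
  show st: "\<And>\<alpha>. \<alpha> \<notin> J \<Longrightarrow> strand E mdg \<alpha> = {e0}" using c(8) by blast
  show "D e0 = (\<lambda>_. 0)"
    using c(2,4,5) by (metis nat.distinct(1))
  show "mdg k \<in> J" if "k \<in> E" "k \<noteq> e0" for k
  proof (rule ccontr)
    assume "mdg k \<notin> J"
    then have "strand E mdg (mdg k) = {e0}" by (rule st)
    moreover have "k \<in> strand E mdg (mdg k)" using that by (simp add: strand_def)
    ultimately show False using that by blast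
  qed
  show "lin E D (lin E D v) = (\<lambda>_. 0)" for v
  proof -
    have "lin E D (lin E D v) = lin E (\<lambda>k. \<lambda>_. 0) v"
      unfolding lin_lin by (rule lin_cong) (use dd in simp)
    then show ?thesis by simp
  qed
qed

text \<open>Multiplication by the monomial \<open>g\<close>, from the quotient by \<open>J'\<close>
  to the quotient by \<open>J\<close>, is lifted to the resolutions; hence the shift by
  \<open>g\<close> in all degrees of \<open>E'\<close>. Going up in homological degree, the image of
  a boundary is a cycle of \<open>E\<close> in a degree of \<open>J\<close>, where \<open>E\<close>
  is exact.\<close>

lemma strand_res_comparison:
  assumes F: "strand_res E hdg mdg e0 (D :: 'a \<Rightarrow> 'a \<Rightarrow> 'k::field) J"
    and K: "strand_res E' hdg' mdg' e0' D' J'"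
    and J': "\<And>\<alpha>. \<alpha> \<in> J' \<Longrightarrow> \<alpha> + g \<in> J"
  shows "\<exists>\<phi>. \<phi> e0' = (\<lambda>l. if l = e0 then 1 else 0) \<and>
    (\<forall>k\<in>E'. supp (\<phi> k) \<subseteq> {l \<in> strand E mdg (mdg' k + g). hdg l = hdg' k} \<and>
       lin E D (\<phi> k) = lin E' \<phi> (D' k))"
proof -
  note F' = strand_resD[OF F] and K' = strand_resD[OF K]
  define good where "good \<phi> k \<longleftrightarrow> supp (\<phi> k) \<subseteq> {l \<in> strand E mdg (mdg' k + g). hdg l = hdg' k} \<and>
       lin E D (\<phi> k) = lin E' \<phi> (D' k)" for \<phi> k
  have "\<exists>\<phi>. \<phi> e0' = (\<lambda>l. if l = e0 then 1 else 0) \<and> (\<forall>k\<in>E'. hdg' k \<le> N \<longrightarrow> good \<phi> k)" for N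
  proof (induction N)
    case 0
    have "hdg e0 = hdg' e0'" using F'(4)[OF F'(2)] K'(4)[OF K'(2)] by simp
    then have "good (\<lambda>_ l. if l = e0 then 1 else 0) e0'"
      using F'(1,2,3,4,12) K'(2,3,4,12)
      by (auto simp: good_def supp_def strand_def lin_unit split: if_splits)
    then show ?case using K'(4) by (intro exI[of _ "\<lambda>_ l. if l = e0 then 1 else 0"]) auto
  next
    case (Suc N)
    then obtain \<phi> where \<phi>: "\<phi> e0' = (\<lambda>l. if l = e0 then 1 else 0)"
      "\<And>k. k \<in> E' \<Longrightarrow> hdg' k \<le> N \<Longrightarrow> good \<phi> k" by blast
    have ex: "\<exists>u. supp u \<subseteq> {l \<in> strand E mdg (mdg' k + g). hdg l = hdg' k} \<and> lin E D u = lin E' \<phi> (D' k)"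
      if k: "k \<in> E'" "hdg' k = Suc N" for k
    proof -
      define r where "r = lin E' \<phi> (D' k)"
      have D'k: "k2 \<in> E'" "hdg' k2 = N" "mdvd (mdg' k2) (mdg' k)" if "D' k k2 \<noteq> 0" for k2
        using K'(5,6,7)[OF k(1) that] k(2) by auto
      have supp_r: "hdg l = N \<and> l \<in> strand E mdg (mdg' k + g)" if nz: "r l \<noteq> 0" for l
      proof -
        obtain k2 where k2: "k2 \<in> E'" "D' k k2 \<noteq> 0" "\<phi> k2 l \<noteq> 0"
          using lin_nonzeroD[OF nz[unfolded r_def]] by blast
        have "good \<phi> k2" using D'k[OF k2(2)] k2(1) \<phi>(2) by simp
        then have "hdg l = N" "l \<in> E" "mdvd (mdg l) (mdg' k2 + g)"
          using k2 D'k[OF k2(2)] by (auto simp: good_def supp_def strand_def)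
        then show ?thesis
          using D'k(3)[OF k2(2)] by (auto simp: strand_def intro: mdvd_trans)
      qed
      have "lin E D r = lin E' (\<lambda>k2. lin E' \<phi> (D' k2)) (D' k)"
        unfolding r_def lin_lin
        by (intro lin_cong) (use D'k \<phi>(2) in \<open>auto simp: good_def\<close>)
      also have "\<dots> = (\<lambda>_. 0)"
        unfolding lin_lin[symmetric] using K'(9)[OF k(1)] by simp
      finally have cyc: "lin E D r = (\<lambda>_. 0)" .
      \<comment> \<open>\<open>k\<close> has positive homological degree, so it is not
        \<open>e0'\<close> and its degree lies in \<open>J'\<close>; this makes exactness of
        \<open>E\<close> available in degree \<open>mdg' k + g\<close>.\<close>
      have "mdg' k \<in> J'" using K'(4,13) k by force
      then obtain u where u: "supp u \<subseteq> strand E mdg (mdg' k + g)" "lin E D u = r"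
        using F'(10)[OF J', of "mdg' k" r] supp_r cyc by (auto simp: supp_def)
      have "lin E D (\<lambda>k. if hdg k = Suc N then u k else 0) = r"
        using lin_hd_component[OF u(2), of hdg N] F'(7) supp_r by blast
      then show ?thesis
        using u(1) k(2) unfolding r_def
        by (intro exI[of _ "\<lambda>k. if hdg k = Suc N then u k else 0"]) (auto simp: supp_def)
    qed
    then obtain U where U: "\<And>k. k \<in> E' \<Longrightarrow> hdg' k = Suc N \<Longrightarrow>
      supp (U k) \<subseteq> {l \<in> strand E mdg (mdg' k + g). hdg l = hdg' k} \<and> lin E D (U k) = lin E' \<phi> (D' k)"
      by metis
    define \<phi>' where "\<phi>' k = (if hdg' k = Suc N then U k else \<phi> k)" for k
    have eq: "lin E' \<phi>' (D' k) = lin E' \<phi> (D' k)" if "k \<in> E'" "hdg' k \<le> Suc N" for k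
      by (intro lin_cong) (use K'(7)[OF that(1)] that(2) in \<open>auto simp: \<phi>'_def\<close>)
    have "good \<phi>' k" if "k \<in> E'" "hdg' k \<le> Suc N" for k
      using U[of k] \<phi>(2)[of k] that eq[OF that] by (auto simp: good_def \<phi>'_def)
    moreover have "\<phi>' e0' = \<phi> e0'" using K'(4)[OF K'(2)] by (simp add: \<phi>'_def)
    ultimately show ?case using \<phi>(1) by metis
  qed
  from this[of "Max (hdg' ` E')"] show ?thesis
    using K'(1) by (auto simp: good_def)
qed

text \<open>Mapping cone of multiplication by \<open>g\<close>, from the quotient by the colon ideal
  of \<open>J\<close> by \<open>g\<close> to the quotient by \<open>J\<close>.
  \<open>\<iota>\<close> embeds the labels of the shifted complex, and \<open>minimal\<close> says
  that the comparison map has no unit entries except into \<open>e0\<close>.\<close>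

theorem strand_res_cone:
  assumes F: "strand_res E hdg mdg e0 (D :: 'a \<Rightarrow> 'a \<Rightarrow> 'k::field) J"
    and K: "strand_res E' hdg' mdg' e0' (D' :: 'b \<Rightarrow> 'b \<Rightarrow> 'k) {\<alpha>. \<alpha> + g \<in> J}"
    and g: "g \<notin> J"
    and inj: "inj_on \<iota> E'" and disj: "\<iota> ` E' \<inter> E = {}"
    and hdg: "\<And>k. k \<in> E' \<Longrightarrow> hdg (\<iota> k) = Suc (hdg' k)"
    and mdg: "\<And>k. k \<in> E' \<Longrightarrow> mdg (\<iota> k) = mdg' k + g"
    and minimal: "\<And>k l. k \<in> E' \<Longrightarrow> l \<in> E \<Longrightarrow> l \<noteq> e0 \<Longrightarrow> hdg l = hdg' k \<Longrightarrow> mdg l \<noteq> mdg' k + g"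
  shows "\<exists>D''. strand_res (E \<union> \<iota> ` E') hdg mdg e0 (D'' :: 'a \<Rightarrow> 'a \<Rightarrow> 'k) (J \<union> {\<alpha>. mdvd g \<alpha>})"
proof -
  note F' = strand_resD[OF F] and K' = strand_resD[OF K]
  obtain \<phi> where \<phi>0: "\<phi> e0' = (\<lambda>l. if l = e0 then 1 else 0)"
    and \<phi>s: "\<And>k l. k \<in> E' \<Longrightarrow> \<phi> k l \<noteq> 0 \<Longrightarrow> l \<in> E \<and> mdvd (mdg l) (mdg' k + g) \<and> hdg l = hdg' k"
    and \<phi>d: "\<And>k. k \<in> E' \<Longrightarrow> lin E D (\<phi> k) = lin E' \<phi> (D' k)"
    using strand_res_comparison[OF F K, of g] by (auto simp: supp_def strand_def subset_iff)
  define \<kappa> where "\<kappa> = the_inv_into E' \<iota>"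
  have \<kappa> [simp]: "\<kappa> (\<iota> k) = k" if "k \<in> E'" for k
    using the_inv_into_f_f[OF inj that] by (simp add: \<kappa>_def)
  have \<iota>E [simp]: "\<iota> k \<notin> E" if "k \<in> E'" for k using disj that by auto
  \<comment> \<open>The sign on the shifted differential makes the mixed terms in the square of
    \<open>D''\<close> cancel.\<close>
  define D'' where "D'' x = (if x \<in> E then D x else
     (\<lambda>l. if l \<in> E then \<phi> (\<kappa> x) l else if l \<in> \<iota> ` E' then - D' (\<kappa> x) (\<kappa> l) else 0))" for x
  let ?E = "E \<union> \<iota> ` E'"
  have split: "(\<Sum>x\<in>?E. h x) = (\<Sum>x\<in>E. h x) + (\<Sum>k\<in>E'. h (\<iota> k))" for h :: "'a \<Rightarrow> 'k"
    using disj F'(1) K'(1) by (subst sum.union_disjoint) (auto simp: sum.reindex[OF inj])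
  have linE: "lin ?E D'' v l = lin E D v l + lin E' \<phi> (\<lambda>k. v (\<iota> k)) l" if "l \<in> E" for v l
    using that unfolding lin_def split by (auto simp: D''_def intro!: arg_cong2[of _ _ _ _ "(+)"] sum.cong)
  have linI: "lin ?E D'' v (\<iota> l) = - lin E' D' (\<lambda>k. v (\<iota> k)) l" if "l \<in> E'" for v l
  proof -
    have "D x (\<iota> l) = 0" if "x \<in> E" for x using F'(5)[OF that] \<iota>E[OF \<open>l \<in> E'\<close>] by blast
    then show ?thesis
      using that unfolding lin_def split by (simp add: D''_def sum_negf[symmetric])
  qed
  have linO: "lin ?E D'' v l = 0" if "l \<notin> ?E" for v l
  proof -
    have "D x l = 0" if "x \<in> E" for x using F'(5)[OF that] \<open>l \<notin> ?E\<close> by blast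
    then show ?thesis
      using that unfolding lin_def split by (auto simp: D''_def)
  qed
  have D0: "D x (\<iota> l) = 0" if "x \<in> E" "l \<in> E'" for x l using F'(5)[OF that(1)] \<iota>E[OF that(2)] by blast
  have g0: "g \<noteq> 0" if "e0' \<noteq> k" "k \<in> E'" "mdg' k = 0" for k
    using K'(13)[of k] that g by auto
  have D''D: "l \<in> ?E \<and> mdvd (mdg l) (mdg k) \<and> hdg k = Suc (hdg l) \<and> (l \<noteq> e0 \<longrightarrow> mdg l \<noteq> mdg k)"
    if k: "k \<in> ?E" and nz: "D'' k l \<noteq> 0" for k l
  proof (cases "k \<in> E")
    case True
    then show ?thesis using F'(5,6,7,8)[of k l] nz by (auto simp: D''_def)
  next
    case False
    then obtain k' where k': "k = \<iota> k'" "k' \<in> E'" using k by auto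
    show ?thesis
    proof (cases "l \<in> E")
      case True
      then have "\<phi> k' l \<noteq> 0" using nz False k' by (simp add: D''_def)
      then show ?thesis using \<phi>s[OF k'(2)] minimal[OF k'(2) True] hdg[OF k'(2)] mdg[OF k'(2)] k' True by auto
    next
      case F: False
      then have "l \<in> \<iota> ` E'" "D' k' (\<kappa> l) \<noteq> 0" using nz False k' by (auto simp: D''_def split: if_splits)
      then obtain l' where l': "l = \<iota> l'" "l' \<in> E'" "D' k' l' \<noteq> 0" by auto
      note * = K'(5,6,7,8)[OF k'(2) l'(3)]
      have "mdg' l' \<noteq> mdg' k'"
      \<comment> \<open>The unit \<open>e0'\<close> is exempt from minimality in its own complex,
        but in the cone it is an ordinary generator of degree \<open>g\<close>. A unit entry into it
        would put \<open>g\<close> into \<open>J\<close>.\<close>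
      proof (cases "l' = e0'")
        case True
        then have "k' \<noteq> e0'" using *(3) by auto
        then have "mdg' k' + g \<in> J" using K'(13) k'(2) by auto
        then show ?thesis using g K'(3) True by auto
      qed (use * in auto)
      then show ?thesis using * hdg mdg k' l' by auto
    qed
  qed
  have dd: "lin ?E D'' (D'' k) = (\<lambda>_. 0)" if k: "k \<in> ?E" for k
  proof
    fix l
    consider "k \<in> E" "l \<in> E" | l' where "k \<in> E" "l = \<iota> l'" "l' \<in> E'" | k' where "k = \<iota> k'" "k' \<in> E'" "l \<in> E"
      | k' l' where "k = \<iota> k'" "k' \<in> E'" "l = \<iota> l'" "l' \<in> E'" | "l \<notin> ?E" using k by blast
    then show "lin ?E D'' (D'' k) l = 0"
    proof cases
      case 1
      have "lin E' \<phi> (\<lambda>x. D k (\<iota> x)) = lin E' \<phi> (\<lambda>_. 0)"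
        by (rule lin_cong_vec) (use 1 D0 in auto)
      then show ?thesis using 1 F'(9)[of k] by (simp add: linE) (simp add: D''_def)
    next
      case 2
      have "lin E' D' (\<lambda>x. D k (\<iota> x)) = lin E' D' (\<lambda>_. 0)"
        by (rule lin_cong_vec) (use 2 D0 in auto)
      then show ?thesis using 2 by (simp add: linI) (simp add: D''_def)
    next
      case 3
      have "lin E D (D'' k) = lin E D (\<phi> k')"
        by (rule lin_cong_vec) (use 3 in \<open>auto simp: D''_def\<close>)
      moreover have "lin E' \<phi> (\<lambda>x. D'' k (\<iota> x)) = lin E' \<phi> (\<lambda>x. - D' k' x)"
        by (rule lin_cong_vec) (use 3 in \<open>auto simp: D''_def\<close>)
      ultimately show ?thesis using 3 \<phi>d[of k'] by (simp add: linE) (simp add: lin_minus)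
    next
      case 4
      have "lin E' D' (\<lambda>x. D'' k (\<iota> x)) = lin E' D' (\<lambda>x. - D' k' x)"
        by (rule lin_cong_vec) (use 4 in \<open>auto simp: D''_def\<close>)
      then show ?thesis using 4 K'(9)[of k'] by (simp add: linI) (simp add: lin_minus)
    qed (use linO in auto)
  qed
  have strandE: "strand ?E mdg \<alpha> = strand E mdg \<alpha> \<union> \<iota> ` {k \<in> E'. mdvd (mdg' k + g) \<alpha>}" for \<alpha>
    using mdg by (auto simp: strand_def)
  have exact: "\<exists>u. supp u \<subseteq> strand ?E mdg \<alpha> \<and> lin ?E D'' u = v"
    if \<alpha>: "\<alpha> \<in> J \<union> {\<alpha>. mdvd g \<alpha>}" and v: "supp v \<subseteq> strand ?E mdg \<alpha>" "lin ?E D'' v = (\<lambda>_. 0)" for \<alpha> v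
  \<comment> \<open>In a degree of \<open>J\<close> both halves are exact (the shifted one may be
    empty there) and a preimage is built from the two. Outside \<open>J\<close> each half has only
    its unit, and the cone joins the two units by the coefficient 1.\<close>
  proof (cases "\<alpha> \<in> J")
    case J: True
    define v' where "v' k = (if k \<in> E' then v (\<iota> k) else 0)" for k
    have v'_supp: "k \<in> E' \<and> mdvd (mdg' k + g) \<alpha>" if "v' k \<noteq> 0" for k
    proof -
      have k: "k \<in> E'" "v (\<iota> k) \<noteq> 0" using that by (auto simp: v'_def split: if_splits)
      then have "\<iota> k \<in> strand ?E mdg \<alpha>" using v(1) by (auto simp: supp_def)
      then show ?thesis using k mdg by (auto simp: strand_def)
    qed
    have v'_lin: "lin E' D' v' = (\<lambda>_. 0)"
    proof
      fix l
      show "lin E' D' v' l = 0"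
      proof (cases "l \<in> E'")
        case True
        have "lin E' D' v' = lin E' D' (\<lambda>k. v (\<iota> k))" by (rule lin_cong_vec) (simp add: v'_def)
        then show ?thesis using linI[OF True, of v] v(2) by simp
      next
        case False
        then show ?thesis using lin_nonzeroD[of E' D' v' l] K'(5) by blast
      qed
    qed
    have "\<exists>u'. (\<forall>k. u' k \<noteq> 0 \<longrightarrow> k \<in> E' \<and> mdvd (mdg' k + g) \<alpha>) \<and> lin E' D' u' = v'"
    proof (cases "mdvd g \<alpha>")
      case True
      then have a: "\<alpha> - g + g = \<alpha>" by (rule mdvd_minus_add)
      have iff: "mdvd (mdg' k + g) \<alpha> \<longleftrightarrow> mdvd (mdg' k) (\<alpha> - g)" for k
        by (subst a[symmetric]) (rule mdvd_add_cancel)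
      have "supp v' \<subseteq> strand E' mdg' (\<alpha> - g)"
        using v'_supp iff by (auto simp: supp_def strand_def)
      then obtain u' where "supp u' \<subseteq> strand E' mdg' (\<alpha> - g)" "lin E' D' u' = v'"
        using K'(10)[of "\<alpha> - g" v'] a J v'_lin by auto
      then show ?thesis using iff by (auto simp: supp_def strand_def)
    next
      case False
      have "v' k = 0" for k
        using v'_supp[of k] mdvd_trans[OF mdvd_add_left(1)] False by blast
      then show ?thesis by (intro exI[of _ "\<lambda>_. 0"]) auto
    qed
    then obtain u' where u': "\<And>k. u' k \<noteq> 0 \<Longrightarrow> k \<in> E' \<and> mdvd (mdg' k + g) \<alpha>" "lin E' D' u' = v'" by blast
    \<comment> \<open>The sign compensates the one in \<open>D''\<close>: the boundary of
      \<open>t\<close> has the same component on the shifted half as \<open>v\<close>, so the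
      difference \<open>z\<close> is a cycle of \<open>E\<close> alone.\<close>
    define t where "t x = (if x \<in> \<iota> ` E' then - u' (\<kappa> x) else 0)" for x
    define z where "z x = v x - lin ?E D'' t x" for x
    have t_supp: "supp t \<subseteq> strand ?E mdg \<alpha>"
      unfolding strandE using u'(1) by (auto simp: t_def supp_def)
    have lin_supp: "supp (lin ?E D'' s) \<subseteq> strand ?E mdg \<alpha>" if "supp s \<subseteq> strand ?E mdg \<alpha>" for s
    proof
      fix l assume "l \<in> supp (lin ?E D'' s)"
      then obtain k where "k \<in> ?E" "s k \<noteq> 0" "D'' k l \<noteq> 0"
        using lin_nonzeroD[of ?E D'' s l] by (auto simp: supp_def)
      then show "l \<in> strand ?E mdg \<alpha>"
        using D''D[of k l] that mdvd_trans by (fastforce simp: supp_def strand_def)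
    qed
    have z_supp': "supp z \<subseteq> strand ?E mdg \<alpha>"
    proof
      fix x assume "x \<in> supp z"
      then have "x \<in> supp v \<or> x \<in> supp (lin ?E D'' t)" by (auto simp: z_def supp_def)
      then show "x \<in> strand ?E mdg \<alpha>" using v(1) lin_supp[OF t_supp] by blast
    qed
    have z_I: "z (\<iota> k) = 0" if "k \<in> E'" for k
    proof -
      have "lin ?E D'' t (\<iota> k) = - lin E' D' (\<lambda>k. t (\<iota> k)) k" using linI[OF that] .
      also have "lin E' D' (\<lambda>k. t (\<iota> k)) = lin E' D' (\<lambda>k. - u' k)"
        by (rule lin_cong_vec) (simp add: t_def)
      finally show ?thesis using u'(2) that by (simp add: z_def lin_minus v'_def)
    qed
    have z_supp: "supp z \<subseteq> strand E mdg \<alpha>"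
      using z_supp' z_I unfolding strandE by (auto simp: supp_def)
    have lin_lin0: "lin ?E D'' (lin ?E D'' t) = (\<lambda>_. 0)"
    proof -
      have "lin ?E D'' (lin ?E D'' t) = lin ?E (\<lambda>_ _. 0) t"
        unfolding lin_lin by (rule lin_cong) (use dd in auto)
      then show ?thesis by simp
    qed
    have z_lin: "lin ?E D'' z = (\<lambda>_. 0)"
      unfolding z_def lin_diff v(2) lin_lin0 by simp
    have linEq: "lin ?E D'' s = lin E D s" if "supp s \<subseteq> E" for s
    proof
      fix l
      have I0: "s (\<iota> k) = 0" if "k \<in> E'" for k using \<open>supp s \<subseteq> E\<close> \<iota>E[OF that] by (auto simp: supp_def)
      have "lin E' D' (\<lambda>k. s (\<iota> k)) = lin E' D' (\<lambda>k. 0)" "lin E' \<phi> (\<lambda>k. s (\<iota> k)) = lin E' \<phi> (\<lambda>k. 0)"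
        by (rule lin_cong_vec, use I0 in simp)+
      moreover have "lin E D s l = 0" if "l \<notin> E" using lin_nonzeroD[of E D s l] F'(5) that by blast
      ultimately show "lin ?E D'' s l = lin E D s l"
        by (cases "l \<in> ?E") (auto simp: linE linI linO)
    qed
    have SE: "strand E mdg \<alpha> \<subseteq> E" by (auto simp: strand_def)
    obtain u where u: "supp u \<subseteq> strand E mdg \<alpha>" "lin E D u = z"
      using F'(10)[OF J z_supp] z_lin linEq z_supp SE by auto
    have "lin ?E D'' (\<lambda>x. u x + t x) = v"
      unfolding lin_add using linEq[of u] u SE by (auto simp: z_def)
    moreover have "supp (\<lambda>x. u x + t x) \<subseteq> strand ?E mdg \<alpha>"
    proof
      fix x assume "x \<in> supp (\<lambda>x. u x + t x)"
      then have "x \<in> supp u \<or> x \<in> supp t" by (auto simp: supp_def)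
      then show "x \<in> strand ?E mdg \<alpha>" using u(1) t_supp unfolding strandE by blast
    qed
    ultimately show ?thesis by blast
  next
    case nJ: False
    then have ga: "mdvd g \<alpha>" using \<alpha> by auto
    then have a: "\<alpha> - g + g = \<alpha>" by (rule mdvd_minus_add)
    have iff: "mdvd (mdg' k + g) \<alpha> \<longleftrightarrow> mdvd (mdg' k) (\<alpha> - g)" for k
      by (subst a[symmetric]) (rule mdvd_add_cancel)
    have "strand E' mdg' (\<alpha> - g) = {e0'}" using K'(11) a nJ by auto
    then have "{k \<in> E'. mdvd (mdg' k + g) \<alpha>} = {e0'}" by (simp add: iff strand_def)
    then have S: "strand ?E mdg \<alpha> = {e0, \<iota> e0'}" using F'(11)[OF nJ] unfolding strandE by auto
    have unit: "lin ?E D'' (\<lambda>x. if x = \<iota> e0' then c else 0) = (\<lambda>l. if l = e0 then c else 0)" for c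
    proof -
      have "lin ?E D'' (\<lambda>x. if x = \<iota> e0' then c else 0) = (\<lambda>l. c * D'' (\<iota> e0') l)"
        using F'(1) K'(1,2) by (intro lin_unit) auto
      also have "\<dots> = (\<lambda>l. if l = e0 then c else 0)"
        using K'(2,12) F'(2) \<phi>0 by (auto simp: D''_def fun_eq_iff)
      finally show ?thesis .
    qed
    have D0'': "lin ?E D'' (\<lambda>x. if x = e0 then c else 0) = (\<lambda>_. 0)" for c
    proof -
      have "lin ?E D'' (\<lambda>x. if x = e0 then c else 0) = (\<lambda>l. c * D'' e0 l)"
        using F'(1,2) K'(1) by (intro lin_unit) auto
      then show ?thesis using F'(2,12) by (simp add: D''_def)
    qed
    have ne: "\<iota> e0' \<noteq> e0" using F'(2) K'(2) by force
    have vx: "v = (\<lambda>x. (if x = e0 then v e0 else 0) + (if x = \<iota> e0' then v (\<iota> e0') else 0))"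
      using v(1) ne unfolding S by (auto simp: supp_def fun_eq_iff)
    have "lin ?E D'' v e0 = v (\<iota> e0')"
      by (subst vx) (simp add: lin_add unit D0'')
    then have "v (\<iota> e0') = 0" using v(2) by simp
    then have vx0: "v x = (if x = e0 then v e0 else 0)" for x
      using v(1) unfolding S by (cases "x = \<iota> e0'") (auto simp: supp_def)
    have "v = (\<lambda>x. if x = e0 then v e0 else 0)" by (rule ext) (rule vx0)
    then show ?thesis
      using unit[of "v e0"] unfolding S
      by (intro exI[of _ "\<lambda>x. if x = \<iota> e0' then v e0 else 0"]) (auto simp: supp_def)
  qed
  have 1: "\<forall>\<alpha>. \<alpha> \<notin> J \<union> {\<alpha>. mdvd g \<alpha>} \<longrightarrow> strand ?E mdg \<alpha> = {e0}"
  proof (intro allI impI)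
    fix \<alpha> assume \<alpha>: "\<alpha> \<notin> J \<union> {\<alpha>. mdvd g \<alpha>}"
    have "\<not> mdvd (mdg' k + g) \<alpha>" for k
    proof
      assume "mdvd (mdg' k + g) \<alpha>"
      from mdvd_trans[OF mdvd_add_left(1) this] show False using \<alpha> by simp
    qed
    then show "strand ?E mdg \<alpha> = {e0}"
      using F'(11)[of \<alpha>] \<alpha> unfolding strandE by simp
  qed
  have 2: "\<forall>k\<in>?E. hdg k = 0 \<longleftrightarrow> k = e0"
  proof
    fix k assume "k \<in> ?E"
    then consider "k \<in> E" | k' where "k' \<in> E'" "k = \<iota> k'" by blast
    then show "hdg k = 0 \<longleftrightarrow> k = e0"
    proof cases
      case 2
      then have "k \<noteq> e0" using F'(2) \<iota>E by auto
      then show ?thesis using hdg 2 by simp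
    qed (rule F'(4))
  qed
  have 3: "\<forall>k\<in>?E. \<forall>l. D'' k l \<noteq> 0 \<longrightarrow>
      l \<in> ?E \<and> mdvd (mdg l) (mdg k) \<and> hdg k = Suc (hdg l) \<and> (l \<noteq> e0 \<longrightarrow> mdg l \<noteq> mdg k)"
    using D''D by blast
  have 4: "\<forall>k\<in>?E. lin ?E D'' (D'' k) = (\<lambda>_. 0)"
    by (intro ballI dd)
  have 5: "\<forall>\<alpha>\<in>J \<union> {\<alpha>. mdvd g \<alpha>}. \<forall>v. supp v \<subseteq> strand ?E mdg \<alpha> \<longrightarrow> lin ?E D'' v = (\<lambda>_. 0) \<longrightarrow>
        (\<exists>u. supp u \<subseteq> strand ?E mdg \<alpha> \<and> lin ?E D'' u = v)"
    by (intro ballI allI impI exact)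
  have 6: "finite ?E" "e0 \<in> ?E" using F'(1,2) K'(1) by auto
  show ?thesis
    unfolding strand_res_def by (rule exI[of _ D'']) (insert 1 2 3 4 5 6 F'(3), intro conjI)
qed

section \<open>Koszul complexes and linear quotients\<close>

lemma wdeg_eq_sum: "finite A \<Longrightarrow> Poly_Mapping.keys t \<subseteq> A \<Longrightarrow> wdeg w t = (\<Sum>i\<in>A. w i * Poly_Mapping.lookup t i)"
  unfolding wdeg_def by (intro sum.mono_neutral_left) (auto simp: in_keys_iff)

lemma wdeg_add: "wdeg w (s + t) = wdeg w s + wdeg w t"
proof -
  let ?A = "Poly_Mapping.keys s \<union> Poly_Mapping.keys t"
  show ?thesis
    using Poly_Mapping.keys_add[of s t]
    by (simp add: wdeg_eq_sum[of ?A] lookup_add algebra_simps sum.distrib)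
qed

lemma wdeg_zero [simp]: "wdeg w 0 = 0"
  by (simp add: wdeg_def)

lemma wdeg_single: "wdeg w (Poly_Mapping.single i c) = w i * c"
  by (simp add: wdeg_def)

lemma wdeg_sum: "wdeg w (\<Sum>i\<in>A. f i) = (\<Sum>i\<in>A. wdeg w (f i))"
  by (induction A rule: infinite_finite_induct) (auto simp: wdeg_add)

definition tdeg :: "monomial \<Rightarrow> nat" where
  "tdeg = wdeg (\<lambda>_. 1)"

lemma tdeg_add: "tdeg (s + t) = tdeg s + tdeg t"
  by (simp add: tdeg_def wdeg_add)

lemma tdeg_zero [simp]: "tdeg 0 = 0"
  by (simp add: tdeg_def)

lemma tdeg_single [simp]: "tdeg (Poly_Mapping.single i c) = c"
  by (simp add: tdeg_def wdeg_single)

lemma tdeg_eq_zero [simp]: "tdeg t = 0 \<longleftrightarrow> t = 0"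
  by (auto simp: tdeg_def wdeg_def in_keys_iff poly_mapping_eq_iff fun_eq_iff)

text \<open>The multidegree of the Koszul basis element that belongs to the set
  \<open>\<sigma>\<close>.\<close>

definition xmon :: "nat set \<Rightarrow> monomial" where
  "xmon \<sigma> = (\<Sum>i\<in>\<sigma>. Poly_Mapping.single i 1)"

lemma lookup_xmon: "finite \<sigma> \<Longrightarrow> Poly_Mapping.lookup (xmon \<sigma>) i = (if i \<in> \<sigma> then 1 else 0)"
  by (simp add: xmon_def lookup_sum lookup_single when_def)

lemma keys_xmon: "finite \<sigma> \<Longrightarrow> Poly_Mapping.keys (xmon \<sigma>) = \<sigma>"
  by (auto simp: in_keys_iff lookup_xmon split: if_splits)

lemma wdeg_xmon: "wdeg w (xmon \<sigma>) = (\<Sum>i\<in>\<sigma>. w i)"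
  by (simp add: xmon_def wdeg_sum wdeg_single)

lemma tdeg_xmon: "tdeg (xmon \<sigma>) = card \<sigma>"
  by (simp add: tdeg_def wdeg_xmon)

lemma mdvd_single: "mdvd (Poly_Mapping.single c 1) \<alpha> \<longleftrightarrow> c \<in> Poly_Mapping.keys \<alpha>"
  by (auto simp: mdvd_def lookup_single when_def in_keys_iff Suc_le_eq)

text \<open>The Koszul complex, built by one cone per variable: a new variable \<open>c\<close> is a
  nonzerodivisor modulo the variables in \<open>V\<close>, so the colon ideal is the old ideal and
  the same complex serves for both halves. Multidegrees of the new half contain \<open>c\<close>,
  which excludes unit entries.\<close>

lemma koszul_strand_res:
  assumes "finite V"
  shows "\<exists>D. strand_res (Pow V) card xmon {} (D :: nat set \<Rightarrow> nat set \<Rightarrow> 'k::field)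
    {\<alpha>. Poly_Mapping.keys \<alpha> \<inter> V \<noteq> {}}"
  using assms
proof (induction V)
  case empty
  show ?case
    by (intro exI[of _ "\<lambda>_ _. 0"]) (auto simp: strand_res_def strand_def xmon_def)
next
  case (insert c V)
  obtain D :: "nat set \<Rightarrow> nat set \<Rightarrow> 'k"
    where D: "strand_res (Pow V) card xmon {} D {\<alpha>. Poly_Mapping.keys \<alpha> \<inter> V \<noteq> {}}"
    using insert.IH by blast
  let ?g = "Poly_Mapping.single c 1 :: monomial" and ?J = "{\<alpha> :: monomial. Poly_Mapping.keys \<alpha> \<inter> V \<noteq> {}}"
  have fin: "finite \<sigma>" "c \<notin> \<sigma>" if "\<sigma> \<in> Pow V" for \<sigma>
    using that insert.hyps finite_subset by auto
  have J: "{\<alpha>. \<alpha> + ?g \<in> ?J} = ?J"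
  proof -
    have "i \<in> Poly_Mapping.keys (\<alpha> + ?g) \<longleftrightarrow> i \<in> Poly_Mapping.keys \<alpha>" if "i \<in> V" for i and \<alpha> :: monomial
      using that insert.hyps(2) by (auto simp: in_keys_iff lookup_add lookup_single when_def)
    then show ?thesis by blast
  qed
  have "\<exists>D''. strand_res (Pow V \<union> insert c ` Pow V) card xmon {} (D'' :: nat set \<Rightarrow> nat set \<Rightarrow> 'k)
    (?J \<union> {\<alpha>. mdvd ?g \<alpha>})"
  proof (rule strand_res_cone[OF D])
    show "strand_res (Pow V) card xmon {} D {\<alpha>. \<alpha> + ?g \<in> ?J}" unfolding J by (rule D)
    show "?g \<notin> ?J" using insert.hyps(2) by auto
    show "inj_on (insert c) (Pow V)" using insert.hyps(2) by (auto simp: inj_on_def)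
    show "insert c ` Pow V \<inter> Pow V = {}" using insert.hyps(2) by auto
    show "card (insert c k) = Suc (card k)" if "k \<in> Pow V" for k
      using fin[OF that] by simp
    show "xmon (insert c k) = xmon k + ?g" if "k \<in> Pow V" for k
      using fin[OF that] by (simp add: xmon_def add.commute)
    show "xmon l \<noteq> xmon k + ?g" if "k \<in> Pow V" "l \<in> Pow V" for k l
    proof
      assume "xmon l = xmon k + ?g"
      then have "Poly_Mapping.lookup (xmon l) c = Poly_Mapping.lookup (xmon k) c + 1" by (simp add: lookup_add)
      then show False using fin[OF that(1)] fin[OF that(2)] by (simp add: lookup_xmon)
    qed
  qed
  moreover have "?J \<union> {\<alpha>. mdvd ?g \<alpha>} = {\<alpha>. Poly_Mapping.keys \<alpha> \<inter> insert c V \<noteq> {}}"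
    by (auto simp: mdvd_single simp del: One_nat_def)
  ultimately show ?case by (simp add: Pow_insert)
qed

text \<open>
  Labels of the Eliahou--Kervaire basis: \<open>Some (\<sigma>, u)\<close> stands for a generator \<open>u\<close> of the ideal
  together with a set \<open>\<sigma>\<close> of variables, and \<open>None\<close> for the generator of the ring.
\<close>

type_synonym ek_label = "(nat set \<times> monomial) option"

fun ek_hdeg :: "ek_label \<Rightarrow> nat" where
  "ek_hdeg None = 0"
| "ek_hdeg (Some (\<sigma>, u)) = Suc (card \<sigma>)"

fun ek_mdeg :: "ek_label \<Rightarrow> monomial" where
  "ek_mdeg None = 0"
| "ek_mdeg (Some (\<sigma>, u)) = xmon \<sigma> + u"

definition ek_basis :: "(monomial \<Rightarrow> nat set) \<Rightarrow> monomial set \<Rightarrow> ek_label set" where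
  "ek_basis V G = insert None {Some (\<sigma>, u) | \<sigma> u. u \<in> G \<and> \<sigma> \<subseteq> V u}"

text \<open>Each generator is added by a cone with the Koszul complex on \<open>V (xs ! k)\<close>,
  as the third assumption says that these variables generate the colon ideal. The fourth gives
  minimality: labels \<open>(\<tau>, u)\<close> and \<open>(\<sigma>, g)\<close> joined by the
  comparison map have \<open>Suc (card \<tau>) = card \<sigma>\<close>, and equal multidegrees would
  give the earlier \<open>u\<close> a larger total degree than \<open>g\<close>.\<close>

theorem linear_quotients_strand_res:
  assumes "distinct xs"
    and "\<And>u. u \<in> set xs \<Longrightarrow> finite (V u)"
    and "\<And>k \<alpha>. k < length xs \<Longrightarrow>
      (\<exists>l<k. mdvd (xs ! l) (\<alpha> + xs ! k)) \<longleftrightarrow> Poly_Mapping.keys \<alpha> \<inter> V (xs ! k) \<noteq> {}"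
    and "\<And>k l. l < k \<Longrightarrow> k < length xs \<Longrightarrow> tdeg (xs ! l) \<le> tdeg (xs ! k)"
  shows "\<exists>D. strand_res (ek_basis V (set xs)) ek_hdeg ek_mdeg None (D :: ek_label \<Rightarrow> ek_label \<Rightarrow> 'k::field)
    {\<alpha>. \<exists>u\<in>set xs. mdvd u \<alpha>}"
  using assms
proof (induction xs rule: rev_induct)
  case Nil
  show ?case
    by (intro exI[of _ "\<lambda>_ _. 0"]) (auto simp: strand_res_def strand_def ek_basis_def)
next
  case (snoc g xs)
  let ?E = "ek_basis V (set xs)" and ?J = "{\<alpha>. \<exists>u\<in>set xs. mdvd u \<alpha>}"
  have "\<exists>D. strand_res ?E ek_hdeg ek_mdeg None (D :: ek_label \<Rightarrow> ek_label \<Rightarrow> 'k) ?J"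
  proof (rule snoc.IH)
    show "distinct xs" using snoc.prems(1) by simp
    show "finite (V u)" if "u \<in> set xs" for u using snoc.prems(2) that by simp
    show "(\<exists>l<k. mdvd (xs ! l) (\<alpha> + xs ! k)) \<longleftrightarrow> Poly_Mapping.keys \<alpha> \<inter> V (xs ! k) \<noteq> {}"
      if "k < length xs" for k \<alpha>
      using snoc.prems(3)[of k \<alpha>] that by (simp add: nth_append cong: conj_cong)
    show "tdeg (xs ! l) \<le> tdeg (xs ! k)" if "l < k" "k < length xs" for k l
      using snoc.prems(4)[of l k] that by (simp add: nth_append)
  qed
  then obtain D :: "ek_label \<Rightarrow> ek_label \<Rightarrow> 'k" where D: "strand_res ?E ek_hdeg ek_mdeg None D ?J" by blast
  have fin: "finite (V g)" using snoc.prems(2) by simp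
  have J: "{\<alpha>. \<alpha> + g \<in> ?J} = {\<alpha>. Poly_Mapping.keys \<alpha> \<inter> V g \<noteq> {}}"
    using snoc.prems(3)[of "length xs"] by (simp add: nth_append in_set_conv_nth Bex_def cong: conj_cong) blast
  obtain D' :: "nat set \<Rightarrow> nat set \<Rightarrow> 'k"
    where D': "strand_res (Pow (V g)) card xmon {} D' {\<alpha>. \<alpha> + g \<in> ?J}"
    using koszul_strand_res[OF fin] unfolding J by blast
  have size: "tdeg u \<le> tdeg g" if "u \<in> set xs" for u
    using that snoc.prems(4)[of _ "length xs"] by (auto simp: in_set_conv_nth nth_append)
  have "\<exists>D''. strand_res (?E \<union> (\<lambda>\<sigma>. Some (\<sigma>, g)) ` Pow (V g)) ek_hdeg ek_mdeg None
    (D'' :: ek_label \<Rightarrow> ek_label \<Rightarrow> 'k) (?J \<union> {\<alpha>. mdvd g \<alpha>})"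
  proof (rule strand_res_cone[OF D D'])
    \<comment> \<open>The new generator is not redundant: the unit monomial has no variable in
      \<open>V g\<close>, so it is not in the colon ideal.\<close>
    have "0 \<notin> {\<alpha> :: monomial. Poly_Mapping.keys \<alpha> \<inter> V g \<noteq> {}}" by simp
    then show "g \<notin> ?J" unfolding J[symmetric] by simp
    show "(\<lambda>\<sigma>. Some (\<sigma>, g)) ` Pow (V g) \<inter> ?E = {}" using snoc.prems(1) by (auto simp: ek_basis_def)
    show "ek_mdeg l \<noteq> xmon \<sigma> + g"
      if l: "l \<in> ?E" "l \<noteq> None" "ek_hdeg l = card \<sigma>" for \<sigma> l
    proof
      assume eq: "ek_mdeg l = xmon \<sigma> + g"
      obtain \<tau> u where u: "l = Some (\<tau>, u)" "u \<in> set xs" using l(1,2) by (auto simp: ek_basis_def)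
      have "card \<tau> + tdeg u = card \<sigma> + tdeg g"
        using arg_cong[OF eq, of "tdeg"] u(1) by (simp add: tdeg_add tdeg_xmon)
      then show False using size[OF u(2)] l(3) u(1) by simp
    qed
  qed (auto simp: inj_on_def)
  moreover have "?E \<union> (\<lambda>\<sigma>. Some (\<sigma>, g)) ` Pow (V g) = ek_basis V (set (xs @ [g]))"
    by (auto simp: ek_basis_def)
  moreover have "?J \<union> {\<alpha>. mdvd g \<alpha>} = {\<alpha>. \<exists>u\<in>set (xs @ [g]). mdvd u \<alpha>}" by auto
  ultimately show ?case by simp
qed

section \<open>From scalars to polynomial matrices\<close>

lemma monomials_mdvd: "t \<in> monomials n \<Longrightarrow> mdvd s t \<Longrightarrow> s \<in> monomials n"
proof -
  assume t: "t \<in> monomials n" and st: "mdvd s t"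
  have "i \<in> Poly_Mapping.keys t" if "i \<in> Poly_Mapping.keys s" for i
    using st[unfolded mdvd_def, rule_format, of i] that by (simp add: in_keys_iff)
  then show "s \<in> monomials n" using t unfolding monomials_def by blast
qed

lemma single_sum: "Poly_Mapping.single t (\<Sum>i\<in>A. f i) = (\<Sum>i\<in>A. Poly_Mapping.single t (f i))"
  by (induction A rule: infinite_finite_induct) (auto simp: single_add)

text \<open>The matrix entry is the scalar \<open>D k l\<close> times the quotient of the two
  multidegrees. The truncated subtraction is harmless, because in a strand resolution a nonzero
  scalar guarantees divisibility.\<close>

definition poly_lin :: "'a set \<Rightarrow> ('a \<Rightarrow> monomial) \<Rightarrow> ('a \<Rightarrow> 'a \<Rightarrow> 'k::field) \<Rightarrow> ('a \<Rightarrow> 'k mpoly) \<Rightarrow> 'a \<Rightarrow> 'k mpoly" where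
  "poly_lin E mdg D V = (\<lambda>l. \<Sum>k\<in>E. Poly_Mapping.single (mdg k - mdg l) (D k l) * V k)"

text \<open>In degree \<open>\<alpha>\<close>, the basis element \<open>k\<close> carries the
  monomial \<open>\<alpha> - mdg k\<close>. With \<open>multi_part\<close> as its inverse, this
  identifies a vector of polynomials with finitely many scalar vectors, one for each element of
  \<open>multi_degrees\<close>.\<close>

definition assemble :: "('a \<Rightarrow> monomial) \<Rightarrow> monomial set \<Rightarrow> (monomial \<Rightarrow> 'a \<Rightarrow> 'k::field) \<Rightarrow> 'a \<Rightarrow> 'k mpoly" where
  "assemble mdg A v = (\<lambda>k. \<Sum>\<alpha>\<in>A. Poly_Mapping.single (\<alpha> - mdg k) (v \<alpha> k))"

definition multi_part :: "'a set \<Rightarrow> ('a \<Rightarrow> monomial) \<Rightarrow> ('a \<Rightarrow> 'k::field mpoly) \<Rightarrow> monomial \<Rightarrow> 'a \<Rightarrow> 'k" where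
  "multi_part E mdg V \<alpha> = (\<lambda>k. if k \<in> strand E mdg \<alpha> then Poly_Mapping.lookup (V k) (\<alpha> - mdg k) else 0)"

definition multi_degrees :: "'a set \<Rightarrow> ('a \<Rightarrow> monomial) \<Rightarrow> ('a \<Rightarrow> 'k::field mpoly) \<Rightarrow> monomial set" where
  "multi_degrees E mdg V = (\<Union>k\<in>E. (\<lambda>t. t + mdg k) ` Poly_Mapping.keys (V k))"

lemma supp_multi_part: "supp (multi_part E mdg V \<alpha>) \<subseteq> strand E mdg \<alpha>"
  by (auto simp: supp_def multi_part_def)

lemma finite_multi_degrees: "finite E \<Longrightarrow> finite (multi_degrees E mdg V)"
  by (simp add: multi_degrees_def)

lemma lookup_assemble:
  assumes "finite A" "\<And>\<alpha>. \<alpha> \<in> A \<Longrightarrow> supp (v \<alpha>) \<subseteq> strand E mdg \<alpha>"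
  shows "Poly_Mapping.lookup (assemble mdg A v k) t = (if t + mdg k \<in> A then v (t + mdg k) k else 0)"
proof -
  have "(v \<alpha> k when \<alpha> - mdg k = t) = (if \<alpha> = t + mdg k then v \<alpha> k else 0)" if "\<alpha> \<in> A" for \<alpha>
  proof (cases "v \<alpha> k = 0")
    case False
    then have "\<alpha> - mdg k + mdg k = \<alpha>" using assms(2)[OF that] by (auto simp: supp_def strand_def mdvd_minus_add)
    then have "\<alpha> - mdg k = t \<longleftrightarrow> \<alpha> = t + mdg k" by auto
    then show ?thesis by simp
  qed auto
  then have "Poly_Mapping.lookup (assemble mdg A v k) t = (\<Sum>\<alpha>\<in>A. if \<alpha> = t + mdg k then v \<alpha> k else 0)"
    by (simp add: assemble_def lookup_sum lookup_single)
  then show ?thesis using assms(1) by simp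
qed

lemma assemble_multi_part:
  assumes "finite E" "supp V \<subseteq> E"
  shows "assemble mdg (multi_degrees E mdg V) (multi_part E mdg V) = V"
proof (intro ext poly_mapping_eqI)
  fix k t
  show "Poly_Mapping.lookup (assemble mdg (multi_degrees E mdg V) (multi_part E mdg V) k) t = Poly_Mapping.lookup (V k) t"
  proof (cases "Poly_Mapping.lookup (V k) t = 0")
    case True
    then show ?thesis
      by (simp add: lookup_assemble[OF finite_multi_degrees[OF assms(1)] supp_multi_part]) (simp add: multi_part_def)
  next
    case False
    then have k: "k \<in> E" using assms(2) by (auto simp: supp_def)
    then have "t + mdg k \<in> multi_degrees E mdg V"
      using False unfolding multi_degrees_def in_keys_iff[symmetric] by blast
    then show ?thesis
      using k by (simp add: lookup_assemble[OF finite_multi_degrees[OF assms(1)] supp_multi_part])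
        (simp add: multi_part_def strand_def)
  qed
qed

text \<open>The monomial in the matrix entry and the one carried by the vector are quotients of
  multidegrees that multiply to \<open>\<alpha> - mdg l\<close>; the polynomial map therefore acts
  in each multidegree by its scalars.\<close>

lemma poly_lin_assemble:
  assumes "\<And>\<alpha>. \<alpha> \<in> A \<Longrightarrow> supp (v \<alpha>) \<subseteq> strand E mdg \<alpha>"
    and "\<And>k l. k \<in> E \<Longrightarrow> D k l \<noteq> 0 \<Longrightarrow> mdvd (mdg l) (mdg k)"
  shows "poly_lin E mdg D (assemble mdg A v) = assemble mdg A (\<lambda>\<alpha>. lin E D (v \<alpha>))"
proof
  fix l
  have eq: "Poly_Mapping.single (mdg k - mdg l) (D k l) * Poly_Mapping.single (\<alpha> - mdg k) (v \<alpha> k) =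
      Poly_Mapping.single (\<alpha> - mdg l) (v \<alpha> k * D k l)" if "k \<in> E" "\<alpha> \<in> A" for k \<alpha>
  proof (cases "D k l = 0 \<or> v \<alpha> k = 0")
    case False
    then have "mdvd (mdg l) (mdg k)" "mdvd (mdg k) \<alpha>"
      using assms(2)[OF that(1)] assms(1)[OF that(2)] by (auto simp: supp_def strand_def)
    then have "(mdg k - mdg l + (\<alpha> - mdg k)) + mdg l = \<alpha> - mdg l + mdg l"
      using mdvd_trans[of "mdg l" "mdg k" \<alpha>]
      by (metis (no_types, lifting) add.assoc add.commute mdvd_minus_add)
    then have exps: "mdg k - mdg l + (\<alpha> - mdg k) = \<alpha> - mdg l" by (rule add_right_imp_eq)
    show ?thesis unfolding mult_single exps by (simp add: mult.commute)
  qed auto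
  have "poly_lin E mdg D (assemble mdg A v) l =
      (\<Sum>k\<in>E. \<Sum>\<alpha>\<in>A. Poly_Mapping.single (\<alpha> - mdg l) (v \<alpha> k * D k l))"
    unfolding poly_lin_def assemble_def sum_distrib_left by (intro sum.cong refl eq)
  also have "\<dots> = (\<Sum>\<alpha>\<in>A. \<Sum>k\<in>E. Poly_Mapping.single (\<alpha> - mdg l) (v \<alpha> k * D k l))"
    by (rule sum.swap)
  finally show "poly_lin E mdg D (assemble mdg A v) l = assemble mdg A (\<lambda>\<alpha>. lin E D (v \<alpha>)) l"
    by (simp add: assemble_def lin_def single_sum)
qed

lemma supp_lin_strand:
  assumes "strand_res E hdg mdg e0 D J" "supp v \<subseteq> strand E mdg \<alpha>"
  shows "supp (lin E D v) \<subseteq> strand E mdg \<alpha>"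
proof
  fix l assume "l \<in> supp (lin E D v)"
  then obtain k where k: "k \<in> E" "v k \<noteq> 0" "D k l \<noteq> 0"
    using lin_nonzeroD[of E D v l] by (auto simp: supp_def)
  then have "mdvd (mdg k) \<alpha>" using assms(2) by (auto simp: supp_def strand_def)
  then show "l \<in> strand E mdg \<alpha>"
    using strand_resD(5,6)[OF assms(1) k(1,3)] by (auto simp: strand_def intro: mdvd_trans)
qed

text \<open>\<open>k\<close> lies in the strand of every multiple of its degree, whereas a degree
  outside \<open>J\<close> admits only \<open>e0\<close>.\<close>

lemma strand_res_upclosed:
  assumes "strand_res E hdg mdg e0 D J" "k \<in> E" "k \<noteq> e0"
  shows "t + mdg k \<in> J"
proof (rule ccontr)
  assume "t + mdg k \<notin> J"
  moreover have "k \<in> strand E mdg (t + mdg k)" using assms(2) by (simp add: strand_def)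
  ultimately show False using strand_resD(11)[OF assms(1)] assms(3) by blast
qed

lemma poly_lin_multi_part:
  assumes "strand_res E hdg mdg e0 (D :: 'a \<Rightarrow> 'a \<Rightarrow> 'k::field) J" "supp V \<subseteq> E"
  shows "poly_lin E mdg D V = assemble mdg (multi_degrees E mdg V) (\<lambda>\<alpha>. lin E D (multi_part E mdg V \<alpha>))"
proof -
  note R = strand_resD[OF assms(1)]
  have "poly_lin E mdg D V = poly_lin E mdg D (assemble mdg (multi_degrees E mdg V) (multi_part E mdg V))"
    by (simp only: assemble_multi_part[OF R(1) assms(2)])
  also have "\<dots> = assemble mdg (multi_degrees E mdg V) (\<lambda>\<alpha>. lin E D (multi_part E mdg V \<alpha>))"
    by (rule poly_lin_assemble, rule supp_multi_part, erule (1) R(6))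
  finally show ?thesis .
qed

lemma poly_lin_poly_lin:
  assumes "strand_res E hdg mdg e0 (D :: 'a \<Rightarrow> 'a \<Rightarrow> 'k::field) J" "supp V \<subseteq> E"
  shows "poly_lin E mdg D (poly_lin E mdg D V) = (\<lambda>_. 0)"
proof -
  note R = strand_resD[OF assms(1)]
  have "poly_lin E mdg D (poly_lin E mdg D V) =
      assemble mdg (multi_degrees E mdg V) (\<lambda>\<alpha>. lin E D (lin E D (multi_part E mdg V \<alpha>)))"
    unfolding poly_lin_multi_part[OF assms]
    by (rule poly_lin_assemble, rule supp_lin_strand[OF assms(1) supp_multi_part], erule (1) R(6))
  also have "\<dots> = (\<lambda>_. 0)" by (simp add: R(14) assemble_def)
  finally show ?thesis .
qed

text \<open>Only the finitely many multidegrees of \<open>V\<close> have to be solved, each by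
  exactness of its strand. The bound on the multidegrees of \<open>U\<close> serves to show that no
  variable outside of \<open>1, ..., n\<close> enters a preimage.\<close>

lemma poly_lin_exact:
  assumes res: "strand_res E hdg mdg e0 (D :: 'a \<Rightarrow> 'a \<Rightarrow> 'k::field) J"
    and V: "supp V \<subseteq> E"
    and J: "\<And>k t. k \<in> E \<Longrightarrow> t \<in> Poly_Mapping.keys (V k) \<Longrightarrow> t + mdg k \<in> J"
    and cyc: "poly_lin E mdg D V = (\<lambda>_. 0)"
  shows "\<exists>U. supp U \<subseteq> E \<and> poly_lin E mdg D U = V \<and>
    (\<forall>k. \<forall>t\<in>Poly_Mapping.keys (U k). t + mdg k \<in> multi_degrees E mdg V)"
proof -
  note R = strand_resD[OF res]
  let ?A = "multi_degrees E mdg V" and ?v = "multi_part E mdg V"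
  have fin: "finite ?A" using R(1) by (rule finite_multi_degrees)
  have lin0: "lin E D (?v \<alpha>) = (\<lambda>_. 0)" if \<alpha>: "\<alpha> \<in> ?A" for \<alpha>
  proof
    fix l
    have S: "supp (lin E D (?v \<alpha>)) \<subseteq> strand E mdg \<alpha>" for \<alpha>
      by (rule supp_lin_strand[OF res supp_multi_part])
    show "lin E D (?v \<alpha>) l = 0"
    proof (cases "l \<in> strand E mdg \<alpha>")
      case True
      then have a: "\<alpha> - mdg l + mdg l = \<alpha>" by (simp add: strand_def mdvd_minus_add)
      have "Poly_Mapping.lookup (poly_lin E mdg D V l) (\<alpha> - mdg l) = lin E D (?v \<alpha>) l"
        unfolding poly_lin_multi_part[OF res V] lookup_assemble[OF fin S] a using \<alpha> by simp
      then show ?thesis using cyc by simp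
    next
      case False
      then show ?thesis using S[of \<alpha>] by (auto simp: supp_def)
    qed
  qed
  have "\<exists>u. supp u \<subseteq> strand E mdg \<alpha> \<and> lin E D u = ?v \<alpha>" if "\<alpha> \<in> ?A" for \<alpha>
  proof (rule R(10)[OF _ supp_multi_part lin0[OF that]])
    show "\<alpha> \<in> J" using that J by (auto simp: multi_degrees_def)
  qed
  then obtain u where u: "\<And>\<alpha>. \<alpha> \<in> ?A \<Longrightarrow> supp (u \<alpha>) \<subseteq> strand E mdg \<alpha>"
    "\<And>\<alpha>. \<alpha> \<in> ?A \<Longrightarrow> lin E D (u \<alpha>) = ?v \<alpha>" by metis
  define U where "U = assemble mdg ?A u"
  have lookup_U: "Poly_Mapping.lookup (U k) t = (if t + mdg k \<in> ?A then u (t + mdg k) k else 0)" for k t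
    unfolding U_def by (rule lookup_assemble[OF fin u(1)])
  have "poly_lin E mdg D U = assemble mdg ?A (\<lambda>\<alpha>. lin E D (u \<alpha>))"
    unfolding U_def by (rule poly_lin_assemble) (use u(1) R(6) in auto)
  also have "\<dots> = assemble mdg ?A ?v"
    unfolding assemble_def by (intro ext sum.cong) (simp_all add: u(2))
  also have "\<dots> = V" by (rule assemble_multi_part[OF R(1) V])
  finally have "poly_lin E mdg D U = V" .
  moreover have "supp U \<subseteq> E"
  proof
    fix k assume "k \<in> supp U"
    then obtain t where "Poly_Mapping.lookup (U k) t \<noteq> 0"
      unfolding supp_def by (metis (mono_tags, lifting) lookup_zero mem_Collect_eq poly_mapping_eqI)
    then have "t + mdg k \<in> ?A" "u (t + mdg k) k \<noteq> 0" by (auto simp: lookup_U split: if_splits)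
    then show "k \<in> E" using u(1)[of "t + mdg k"] by (auto simp: supp_def strand_def)
  qed
  moreover have "t + mdg k \<in> ?A" if "t \<in> Poly_Mapping.keys (U k)" for k t
    using that by (auto simp: in_keys_iff lookup_U split: if_splits)
  ultimately show ?thesis by blast
qed

lemma poly_lin_hdeg_component:
  assumes "strand_res E hdg mdg e0 D J" "poly_lin E mdg D U = V" "\<And>l. V l \<noteq> 0 \<Longrightarrow> hdg l = N"
  shows "poly_lin E mdg D (\<lambda>k. if hdg k = Suc N then U k else 0) = V"
proof
  fix l
  have D: "D k l = 0" if "k \<in> E" "hdg k \<noteq> Suc (hdg l)" for k
    using strand_resD(7)[OF assms(1) that(1)] that(2) by blast
  show "poly_lin E mdg D (\<lambda>k. if hdg k = Suc N then U k else 0) l = V l"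
  proof (cases "hdg l = N")
    case True
    have "poly_lin E mdg D (\<lambda>k. if hdg k = Suc N then U k else 0) l = poly_lin E mdg D U l"
      unfolding poly_lin_def
    proof (intro sum.cong refl)
      fix k assume "k \<in> E"
      then have "D k l = 0" if "hdg k \<noteq> Suc N" using D[of k] that True by simp
      then show "Poly_Mapping.single (mdg k - mdg l) (D k l) * (if hdg k = Suc N then U k else 0) =
          Poly_Mapping.single (mdg k - mdg l) (D k l) * U k" by auto
    qed
    then show ?thesis using assms(2) by simp
  next
    case False
    have "poly_lin E mdg D (\<lambda>k. if hdg k = Suc N then U k else 0) l = 0"
      unfolding poly_lin_def
    proof (intro sum.neutral ballI)
      fix k assume "k \<in> E"
      then have "D k l = 0" if "hdg k = Suc N" using D that False by auto
      then show "Poly_Mapping.single (mdg k - mdg l) (D k l) * (if hdg k = Suc N then U k else 0) = 0" by auto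
    qed
    moreover have "V l = 0" using assms(3) False by blast
    ultimately show ?thesis by simp
  qed
qed

text \<open>The basis elements of each homological degree are numbered and scalars become terms.
  \<open>e0\<close> turns into the target of the augmentation, so position \<open>i\<close> of the
  resolution is spanned by the elements with \<open>hdg\<close> equal to \<open>Suc i\<close>.
  Minimality becomes the vanishing of all constant terms.\<close>

lemma graded_free_resolution_of_strand_res:
  fixes D :: "'a \<Rightarrow> 'a \<Rightarrow> 'k::field"
  assumes res: "strand_res E hdg mdg e0 D J"
    and mon: "\<And>k. k \<in> E \<Longrightarrow> mdg k \<in> monomials n"
  shows "\<exists>F :: 'k mpoly aug_complex.
    graded_free_resolution n w {p \<in> polys n. Poly_Mapping.keys p \<subseteq> J} F \<and>
    (\<forall>i. \<forall>l<rk F i. \<forall>k<rk F (Suc i). Poly_Mapping.lookup (dmat F i l k) 0 = 0) \<and>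
    (\<forall>i j. card {k. k < rk F i \<and> bdeg F i k = j} = card {k \<in> E. hdg k = Suc i \<and> wdeg w (mdg k) = j})"
proof -
  note R = strand_resD[OF res]
  define B where "B i = {k \<in> E. hdg k = i}" for i
  define r where "r i = card (B i)" for i
  have finB: "finite (B i)" for i using R(1) by (simp add: B_def)
  have "\<exists>e. bij_betw e {..<r i} (B i)" for i
    using ex_bij_betw_nat_finite[OF finB[of i]] by (simp add: r_def atLeast0LessThan)
  then obtain e where e: "\<And>i. bij_betw (e i) {..<r i} (B i)" by metis
  have eB: "e i k \<in> E" "hdg (e i k) = i" if "k < r i" for i k
    using bij_betwE[OF e[of i]] that by (auto simp: B_def)
  have B0: "B 0 = {e0}" using R(2,4) by (auto simp: B_def)
  have r0: "r 0 = 1" by (simp add: r_def B0)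
  have e00: "e 0 0 = e0" using bij_betwE[OF e[of 0]] by (simp add: B0 r0)
  define M where "M i l k = Poly_Mapping.single (mdg (e (Suc i) k) - mdg (e i l)) (D (e (Suc i) k) (e i l))" for i l k
  define F :: "'k mpoly aug_complex" where
    "F = \<lparr>rk = (\<lambda>i. r (Suc i)), bdeg = (\<lambda>i k. wdeg w (mdg (e (Suc i) k))), dmat = (\<lambda>i. M (Suc i)), aug = M 0 0\<rparr>"
  define d where "d i = mat_map (r (Suc i)) (r i) (M i)" for i
  \<comment> \<open>Translation between coordinates indexed by numbers and by labels, so that the
    results on \<open>poly_lin\<close> apply to the numbered matrices.\<close>
  define emb where "emb i v = (\<lambda>k. if k \<in> B i then v (the_inv_into {..<r i} (e i) k) else (0 :: 'k mpoly))" for i v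
  define proj where "proj i V = (\<lambda>k. if k < r i then V (e i k) else (0 :: 'k mpoly))" for i and V :: "'a \<Rightarrow> 'k mpoly"
  have inj: "inj_on (e i) {..<r i}" for i using e by (auto simp: bij_betw_def)
  have emb_e: "emb i v (e i k) = v k" if "k < r i" for i v k
    using eB[OF that] the_inv_into_f_f[OF inj] that by (simp add: emb_def B_def)
  have ex_e: "\<exists>l<r i. k = e i l" if "k \<in> B i" for i k
    using bij_betw_imp_surj_on[OF e[of i]] that by force
  have emb_proj: "emb i (proj i V) = V" if "\<And>k. V k \<noteq> 0 \<Longrightarrow> k \<in> B i" for i V
  proof
    fix k
    show "emb i (proj i V) k = V k"
    proof (cases "k \<in> B i")
      case True
      then obtain l where "l < r i" "k = e i l" using ex_e by blast
      then show ?thesis by (simp add: emb_e proj_def)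
    next
      case False
      then show ?thesis using that by (auto simp: emb_def)
    qed
  qed
  have proj_emb: "proj i (emb i v) = v" if "v \<in> free_module n (r i)" for i v
    using that by (auto simp: proj_def emb_e free_module_def)
  have emb_supp: "k \<in> B i" if "emb i v k \<noteq> 0" for i v k using that by (auto simp: emb_def split: if_splits)
  have emb_E: "supp (emb i v) \<subseteq> E" for i v using emb_supp by (auto simp: supp_def B_def)
  have poly_lin_supp: "l \<in> B i" if V: "\<And>k. V k \<noteq> 0 \<Longrightarrow> k \<in> B (Suc i)" and nz: "poly_lin E mdg D V l \<noteq> 0" for V i l
  proof -
    obtain k where k: "k \<in> E" "Poly_Mapping.single (mdg k - mdg l) (D k l) * V k \<noteq> 0"
      using nz unfolding poly_lin_def by (meson sum.neutral)
    then have "D k l \<noteq> 0" "V k \<noteq> 0" by auto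
    then show ?thesis using R(5,7)[OF k(1), of l] V[of k] by (auto simp: B_def)
  qed
  have d_eq: "d i v = proj i (poly_lin E mdg D (emb (Suc i) v))" for i v
  proof
    fix l
    show "d i v l = proj i (poly_lin E mdg D (emb (Suc i) v)) l"
    proof (cases "l < r i")
      case True
      have "poly_lin E mdg D (emb (Suc i) v) (e i l) =
          (\<Sum>k\<in>B (Suc i). Poly_Mapping.single (mdg k - mdg (e i l)) (D k (e i l)) * emb (Suc i) v k)"
        unfolding poly_lin_def using R(1) emb_supp
        by (intro sum.mono_neutral_right) (auto simp: B_def)
      also have "\<dots> = (\<Sum>k<r (Suc i). M i l k * v k)"
        by (subst sum.reindex_bij_betw[OF e, symmetric]) (auto simp: M_def emb_e intro!: sum.cong)
      finally show ?thesis using True by (simp add: d_def mat_map_def proj_def)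
    qed (simp add: d_def mat_map_def proj_def)
  qed
  have emb_d: "emb i (d i v) = poly_lin E mdg D (emb (Suc i) v)" for i v
    unfolding d_eq by (rule emb_proj) (rule poly_lin_supp[OF emb_supp])
  have emb0: "emb i (\<lambda>_. 0) = (\<lambda>_. 0)" for i by (auto simp: emb_def)
  have dd: "d i (d (Suc i) v) = (\<lambda>_. 0)" for i v
    unfolding d_eq[of i] emb_d poly_lin_poly_lin[OF res emb_E] by (auto simp: proj_def)
  have M_polys: "M i l k \<in> polys n" and M_deg: "\<And>t. t \<in> Poly_Mapping.keys (M i l k) \<Longrightarrow>
      wdeg w t + wdeg w (mdg (e i l)) = wdeg w (mdg (e (Suc i) k)) \<and> t + mdg (e i l) = mdg (e (Suc i) k)"
    if "l < r i" "k < r (Suc i)" for i l k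
  proof -
    have *: "t + mdg (e i l) = mdg (e (Suc i) k)" if "t \<in> Poly_Mapping.keys (M i l k)" for t
    proof -
      have "D (e (Suc i) k) (e i l) \<noteq> 0" "t = mdg (e (Suc i) k) - mdg (e i l)"
        using that by (auto simp: M_def split: if_splits)
      then show ?thesis using R(6)[OF eB(1)] \<open>k < r (Suc i)\<close> by (simp add: mdvd_minus_add)
    qed
    then show "wdeg w t + wdeg w (mdg (e i l)) = wdeg w (mdg (e (Suc i) k)) \<and> t + mdg (e i l) = mdg (e (Suc i) k)"
      if "t \<in> Poly_Mapping.keys (M i l k)" for t using that by (metis wdeg_add)
    have "t \<in> monomials n" if "t \<in> Poly_Mapping.keys (M i l k)" for t
      using mon[OF eB(1)[OF \<open>k < r (Suc i)\<close>]] unfolding *[OF that, symmetric]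
      by (rule monomials_mdvd) simp
    then show "M i l k \<in> polys n" by (auto simp: polys_def)
  qed
  have mult_closed: "p * q \<in> polys n" if "p \<in> polys n" "q \<in> polys n" for p q :: "'k mpoly"
    using cring.cring_simprules(5)[OF cring_mpoly_ring, of p n q] that by (simp add: mpoly_ring_def)
  have sum_closed: "(\<Sum>x\<in>A. f x) \<in> polys n" if "\<And>x. x \<in> A \<Longrightarrow> f x \<in> polys n"
    for A :: "nat set" and f :: "nat \<Rightarrow> 'k mpoly"
    using that Poly_Mapping.keys_sum[of f A] by (fastforce simp: polys_def)
  have d_closed: "d i v \<in> free_module n (r i)" if "v \<in> free_module n (r (Suc i))" for i v
    using that by (auto simp: d_def mat_map_def free_module_def intro!: sum_closed mult_closed M_polys)
  \<comment> \<open>The condition on \<open>J\<close> expresses membership in the ideal when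
    \<open>i\<close> is 0; in higher positions it holds because the multiples of every degree other
    than that of \<open>e0\<close> stay in \<open>J\<close>.\<close>
  have lift: "\<exists>u. u \<in> free_module n (r (Suc i)) \<and> d i u = v"
    if v: "v \<in> free_module n (r i)" "poly_lin E mdg D (emb i v) = (\<lambda>_. 0)"
      and J: "\<And>k t. k \<in> E \<Longrightarrow> t \<in> Poly_Mapping.keys (emb i v k) \<Longrightarrow> t + mdg k \<in> J" for i v
  proof -
    obtain U where U: "supp U \<subseteq> E" "poly_lin E mdg D U = emb i v"
      "\<And>k t. t \<in> Poly_Mapping.keys (U k) \<Longrightarrow> t + mdg k \<in> multi_degrees E mdg (emb i v)"
      using poly_lin_exact[OF res emb_E _ v(2)] J by blast
    define U' where "U' = (\<lambda>k. if hdg k = Suc i then U k else 0)"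
    have U': "poly_lin E mdg D U' = emb i v"
      unfolding U'_def using poly_lin_hdeg_component[OF res U(2), of i] emb_supp by (auto simp: B_def)
    have U'_supp: "k \<in> B (Suc i)" if "U' k \<noteq> 0" for k
      using that U(1) by (auto simp: U'_def B_def supp_def split: if_splits)
    have "multi_degrees E mdg (emb i v) \<subseteq> monomials n"
    proof
      fix \<alpha> assume "\<alpha> \<in> multi_degrees E mdg (emb i v)"
      then obtain k t where k: "k \<in> E" "t \<in> Poly_Mapping.keys (emb i v k)" "\<alpha> = t + mdg k"
        by (auto simp: multi_degrees_def)
      then have "k \<in> B i" using emb_supp[of i v k] by fastforce
      then obtain l where "l < r i" "k = e i l" using ex_e by blast
      then have "emb i v k \<in> polys n" using v(1) by (simp add: emb_e free_module_def)
      then have "t \<in> monomials n" using k(2) by (auto simp: polys_def)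
      then show "\<alpha> \<in> monomials n"
        using mon[OF k(1)] k(3) Poly_Mapping.keys_add[of t "mdg k"] by (auto simp: monomials_def)
    qed
    then have "U' k \<in> polys n" for k
      using U(3)[of _ k] by (auto simp: polys_def U'_def intro: monomials_mdvd[OF _ mdvd_add_left(2)])
    then have "proj (Suc i) U' \<in> free_module n (r (Suc i))" by (simp add: free_module_def proj_def)
    moreover have "d i (proj (Suc i) U') = v"
      unfolding d_eq by (subst emb_proj[OF U'_supp]) (simp_all add: U' proj_emb[OF v(1)])
    ultimately show ?thesis by blast
  qed
  have exact: "d (Suc i) ` free_module n (r (Suc (Suc i))) = {v \<in> free_module n (r (Suc i)). d i v = (\<lambda>_. 0)}" for i
  proof (intro equalityI subsetI)
    fix v assume "v \<in> d (Suc i) ` free_module n (r (Suc (Suc i)))"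
    then show "v \<in> {v \<in> free_module n (r (Suc i)). d i v = (\<lambda>_. 0)}" using d_closed dd by blast
  next
    fix v assume "v \<in> {v \<in> free_module n (r (Suc i)). d i v = (\<lambda>_. 0)}"
    then have v: "v \<in> free_module n (r (Suc i))" "d i v = (\<lambda>_. 0)" by auto
    have "poly_lin E mdg D (emb (Suc i) v) = (\<lambda>_. 0)" using emb_d[of i v] v(2) emb0 by simp
    moreover have "t + mdg k \<in> J" if "k \<in> E" "t \<in> Poly_Mapping.keys (emb (Suc i) v k)" for k t
    proof (rule strand_res_upclosed[OF res that(1)])
      have "k \<in> B (Suc i)" using that emb_supp[of "Suc i" v k] by fastforce
      then show "k \<noteq> e0" using R(4)[OF R(2)] by (auto simp: B_def)
    qed
    ultimately show "v \<in> d (Suc i) ` free_module n (r (Suc (Suc i)))" using lift[OF v(1)] by blast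
  qed
  have aug: "aug_map F v = d 0 v 0" for v
    by (simp add: aug_map_def F_def d_def mat_map_def r0)
  have d0: "d 0 v = (\<lambda>_. 0) \<longleftrightarrow> d 0 v 0 = 0" for v
    by (auto simp: d_def mat_map_def r0 fun_eq_iff)
  have image: "aug_map F ` free_module n (r 1) = {p \<in> polys n. Poly_Mapping.keys p \<subseteq> J}"
  proof (intro equalityI subsetI)
    fix p assume "p \<in> aug_map F ` free_module n (r 1)"
    then obtain v where v: "v \<in> free_module n (r 1)" "p = d 0 v 0" by (auto simp: aug)
    have "p \<in> polys n" using d_closed[of v 0] v by (simp add: free_module_def r0)
    moreover have "Poly_Mapping.keys p \<subseteq> J"
    proof
      fix t assume "t \<in> Poly_Mapping.keys p"
      then have "t \<in> Poly_Mapping.keys (\<Sum>k<r 1. M 0 0 k * v k)" by (simp add: v(2) d_def mat_map_def r0)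
      then obtain k where k: "k < r 1" "t \<in> Poly_Mapping.keys (M 0 0 k * v k)"
        using Poly_Mapping.keys_sum[of "\<lambda>k. M 0 0 k * v k" "{..<r 1}"] by blast
      then obtain a b where "t = a + b" "a \<in> Poly_Mapping.keys (M 0 0 k)"
        using Poly_Mapping.keys_mult[of "M 0 0 k" "v k"] by blast
      then have "t = b + mdg (e 1 k)" using M_deg(1)[of 0 0 k] k(1) e00 R(3) by (simp add: r0 add.commute)
      moreover have "e 1 k \<noteq> e0"
      proof
        assume "e 1 k = e0"
        then show False using eB(2)[OF k(1)] R(4)[OF R(2)] by simp
      qed
      ultimately show "t \<in> J" using strand_res_upclosed[OF res eB(1)[OF k(1)]] by simp
    qed
    ultimately show "p \<in> {p \<in> polys n. Poly_Mapping.keys p \<subseteq> J}" by simp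
  next
    fix p :: "'k mpoly" assume p: "p \<in> {p \<in> polys n. Poly_Mapping.keys p \<subseteq> J}"
    \<comment> \<open>To hit \<open>p\<close>, regard it as the multiple \<open>p\<close> of
      \<open>e0\<close>: this is a cycle because \<open>D e0\<close> vanishes, and its multidegrees
      are the exponents of \<open>p\<close>, which lie in \<open>J\<close>.\<close>
    define v where "v k = (if k = 0 then p else 0)" for k :: nat
    have v: "v \<in> free_module n (r 0)" using p by (auto simp: v_def r0 free_module_def)
    have emb_v: "emb 0 v = (\<lambda>k. if k = e0 then p else 0)"
      using emb_e[of 0 0 v] e00 by (auto simp: emb_def B0 r0 v_def fun_eq_iff)
    have "poly_lin E mdg D (emb 0 v) = (\<lambda>_. 0)"
      unfolding poly_lin_def emb_v using R(12) by (intro ext sum.neutral) auto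
    moreover have "t + mdg k \<in> J" if "k \<in> E" "t \<in> Poly_Mapping.keys (emb 0 v k)" for k t
      using that p R(3) by (auto simp: emb_v split: if_splits)
    ultimately obtain u where "u \<in> free_module n (r 1)" "d 0 u = v" using lift[OF v] by auto
    moreover from this have "p = aug_map F u" by (simp add: aug v_def)
    ultimately show "p \<in> aug_map F ` free_module n (r 1)" by blast
  qed
  have "graded_free_resolution n w {p \<in> polys n. Poly_Mapping.keys p \<subseteq> J} F"
    unfolding graded_free_resolution_def
  proof (intro conjI)
    have fr: "rk F i = r (Suc i)" "bdeg F i k = wdeg w (mdg (e (Suc i) k))" "dmat F i = M (Suc i)" "aug F = M 0 0" for i k
      by (simp_all add: F_def)
    have df: "diff_map F i = d (Suc i)" for i by (simp add: diff_map_def d_def fr)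
    show "\<forall>k<rk F 0. aug F k \<in> polys n \<and> (\<forall>t\<in>Poly_Mapping.keys (aug F k). wdeg w t = bdeg F 0 k)"
    proof (intro allI impI conjI ballI)
      fix k t assume k: "k < rk F 0"
      then have k': "0 < r 0" "k < r (Suc 0)" by (simp_all add: fr r0)
      show "aug F k \<in> polys n" using M_polys[OF k'] by (simp add: fr)
      assume "t \<in> Poly_Mapping.keys (aug F k)"
      then have "t \<in> Poly_Mapping.keys (M 0 0 k)" by (simp add: fr)
      from M_deg[OF k' this, THEN conjunct1] show "wdeg w t = bdeg F 0 k" by (simp add: fr e00 R(3))
    qed
    show "\<forall>i. \<forall>l<rk F i. \<forall>k<rk F (Suc i). dmat F i l k \<in> polys n \<and>
        (\<forall>t\<in>Poly_Mapping.keys (dmat F i l k). wdeg w t + bdeg F i l = bdeg F (Suc i) k)"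
      unfolding fr by (intro allI impI conjI ballI) (rule M_polys M_deg[THEN conjunct1]; assumption)+
    show "aug_map F ` free_module n (rk F 0) = {p \<in> polys n. Poly_Mapping.keys p \<subseteq> J}"
      using image by (simp add: fr)
    show "diff_map F 0 ` free_module n (rk F 1) = {v \<in> free_module n (rk F 0). aug_map F v = 0}"
      using exact[of 0] d0 by (simp add: fr df aug)
    show "\<forall>i. diff_map F (Suc i) ` free_module n (rk F (Suc (Suc i))) =
        {v \<in> free_module n (rk F (Suc i)). diff_map F i v = 0}"
      using exact by (simp add: fr df zero_fun_def)
  qed
  moreover have "Poly_Mapping.lookup (dmat F i l k) 0 = 0" if "l < rk F i" "k < rk F (Suc i)" for i l k
  proof (rule ccontr)
    assume nz: "Poly_Mapping.lookup (dmat F i l k) 0 \<noteq> 0"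
    have lk: "l < r (Suc i)" "k < r (Suc (Suc i))" using that by (auto simp: F_def)
    have z: "0 \<in> Poly_Mapping.keys (M (Suc i) l k)" using nz by (simp add: F_def in_keys_iff)
    then have "D (e (Suc (Suc i)) k) (e (Suc i) l) \<noteq> 0" by (auto simp: M_def split: if_splits)
    \<comment> \<open>A constant term forces equal multidegrees of row and column; the row
      \<open>e0\<close>, which minimality exempts, occurs only in the augmentation.\<close>
    moreover have "e (Suc i) l \<noteq> e0" using eB[OF lk(1)] R(4)[OF R(2)] by auto
    ultimately have "mdg (e (Suc i) l) \<noteq> mdg (e (Suc (Suc i)) k)" using R(8) eB(1)[OF lk(2)] by blast
    then show False using M_deg[OF lk z] by simp
  qed
  moreover have "card {k. k < rk F i \<and> bdeg F i k = j} = card {k \<in> E. hdg k = Suc i \<and> wdeg w (mdg k) = j}" for i j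
  proof (rule bij_betw_same_card)
    have "bij_betw (e (Suc i)) {k \<in> {..<r (Suc i)}. wdeg w (mdg (e (Suc i) k)) = j} {k \<in> B (Suc i). wdeg w (mdg k) = j}"
      using e[of "Suc i"] unfolding bij_betw_def inj_on_def by auto
    moreover have "{k \<in> B (Suc i). wdeg w (mdg k) = j} = {k \<in> E. hdg k = Suc i \<and> wdeg w (mdg k) = j}"
      by (auto simp: B_def)
    ultimately show "bij_betw (e (Suc i)) {k. k < rk F i \<and> bdeg F i k = j} {k \<in> E. hdg k = Suc i \<and> wdeg w (mdg k) = j}"
      by (simp add: F_def)
  qed
  ultimately show ?thesis by blast
qed

section \<open>Independence of the resolution\<close>

definition mat_mul :: "nat \<Rightarrow> (nat \<Rightarrow> nat \<Rightarrow> 'a) \<Rightarrow> (nat \<Rightarrow> nat \<Rightarrow> 'a) \<Rightarrow> nat \<Rightarrow> nat \<Rightarrow> 'a::comm_ring_1" where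
  "mat_mul s A B = (\<lambda>i k. \<Sum>l<s. A i l * B l k)"

definition mat_vec :: "nat \<Rightarrow> (nat \<Rightarrow> nat \<Rightarrow> 'a) \<Rightarrow> (nat \<Rightarrow> 'a) \<Rightarrow> nat \<Rightarrow> 'a::comm_ring_1" where
  "mat_vec s A v = (\<lambda>i. \<Sum>l<s. A i l * v l)"

definition id_mat :: "nat \<Rightarrow> nat \<Rightarrow> nat \<Rightarrow> 'a::comm_ring_1" where
  "id_mat r = (\<lambda>i k. if i = k \<and> i < r then 1 else 0)"

text \<open>
  Row degrees are \<open>a\<close> and column degrees \<open>b\<close>. Matrices vanish outside of their range, so that matrix
  identities are equalities of functions.
\<close>

definition hmat :: "nat \<Rightarrow> (nat \<Rightarrow> nat) \<Rightarrow> nat \<Rightarrow> (nat \<Rightarrow> nat) \<Rightarrow> nat \<Rightarrow> (nat \<Rightarrow> nat) \<Rightarrow> (nat \<Rightarrow> nat \<Rightarrow> ('k::field) mpoly) \<Rightarrow> bool" where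
  "hmat n w r a s b A \<longleftrightarrow> (\<forall>i k. A i k \<noteq> 0 \<longrightarrow> i < r \<and> k < s) \<and>
     (\<forall>i k. \<forall>t\<in>Poly_Mapping.keys (A i k). t \<in> monomials n \<and> wdeg w t + a i = b k)"

lemma mat_mul_assoc: "mat_mul s (mat_mul r A B) C = mat_mul r A (mat_mul s B C)"
  unfolding mat_mul_def sum_distrib_left sum_distrib_right mult.assoc
  by (intro ext) (rule sum.swap)

lemma mat_vec_mult: "mat_vec s (mat_mul r A B) v = mat_vec r A (mat_vec s B v)"
  unfolding mat_mul_def mat_vec_def sum_distrib_left sum_distrib_right mult.assoc
  by (intro ext) (rule sum.swap)

lemma mat_vec_column: "mat_vec s A (\<lambda>l. B l k) = (\<lambda>i. mat_mul s A B i k)"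
  by (simp add: mat_vec_def mat_mul_def)

lemma mat_mul_diff_right: "mat_mul s A (B - C) = mat_mul s A B - mat_mul s A C"
  by (intro ext) (simp add: mat_mul_def right_diff_distrib sum_subtractf)

lemma mat_mul_diff_left: "mat_mul s (A - B) C = mat_mul s A C - mat_mul s B C"
  by (intro ext) (simp add: mat_mul_def left_diff_distrib sum_subtractf)

lemma mat_mul_zero [simp]: "mat_mul s 0 B = 0" "mat_mul s A 0 = 0"
  by (simp_all add: mat_mul_def fun_eq_iff)

lemma mat_vec_add_mat: "mat_vec s (A + B) v = mat_vec s A v + mat_vec s B v"
  by (intro ext) (simp add: mat_vec_def distrib_right sum.distrib)

lemma mat_vec_diff_mat: "mat_vec s (A - B) v = mat_vec s A v - mat_vec s B v"
  by (intro ext) (simp add: mat_vec_def left_diff_distrib sum_subtractf)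

lemma mat_vec_add: "mat_vec s A (v + u) = mat_vec s A v + mat_vec s A u"
  by (intro ext) (simp add: mat_vec_def distrib_left sum.distrib)

lemma mat_vec_zero [simp]: "mat_vec s 0 v = 0" "mat_vec s A 0 = 0"
  by (simp_all add: mat_vec_def fun_eq_iff)

lemma sum_id_mat: "(\<Sum>l<r. id_mat r i l * f l) = (if i < r then f i else 0)"
proof -
  have "id_mat r i l * f l = (if l = i then f l else 0)" if "l < r" for l
    using that by (simp add: id_mat_def)
  then show ?thesis by simp
qed

lemma mat_vec_id_mat: "(\<And>k. v k \<noteq> 0 \<Longrightarrow> k < r) \<Longrightarrow> mat_vec r (id_mat r) v = v"
  by (intro ext) (auto simp: mat_vec_def sum_id_mat)

lemma mat_mul_id_mat_left: "(\<And>i k. A i k \<noteq> 0 \<Longrightarrow> i < r) \<Longrightarrow> mat_mul r (id_mat r) A = A"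
  by (intro ext) (auto simp: mat_mul_def sum_id_mat)

lemma mat_mul_id_mat_right: "(\<And>i k. A i k \<noteq> 0 \<Longrightarrow> k < r) \<Longrightarrow> mat_mul r A (id_mat r) = A"
proof (intro ext)
  fix i k
  assume A: "\<And>i k. A i k \<noteq> 0 \<Longrightarrow> k < r"
  have "mat_mul r A (id_mat r) i k = (\<Sum>l<r. id_mat r k l * A i l)"
    unfolding mat_mul_def by (intro sum.cong) (auto simp: id_mat_def)
  then show "mat_mul r A (id_mat r) i k = A i k" using A by (auto simp: sum_id_mat)
qed

lemma hmatD:
  assumes "hmat n w r a s b A"
  shows "A i k \<noteq> 0 \<Longrightarrow> i < r" "A i k \<noteq> 0 \<Longrightarrow> k < s" "A i k \<in> polys n"
    "t \<in> Poly_Mapping.keys (A i k) \<Longrightarrow> t \<in> monomials n"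
    "t \<in> Poly_Mapping.keys (A i k) \<Longrightarrow> wdeg w t + a i = b k"
  using assms by (auto simp: hmat_def polys_def)

lemma monomials_add: "s \<in> monomials n \<Longrightarrow> t \<in> monomials n \<Longrightarrow> s + t \<in> monomials n"
  using Poly_Mapping.keys_add[of s t] by (auto simp: monomials_def)

lemma hmat_mat_mul:
  assumes A: "hmat n w r a s b A" and B: "hmat n w s b q c B"
  shows "hmat n w r a q c (mat_mul s A B)"
  unfolding hmat_def
proof (intro conjI allI impI ballI)
  fix i k
  assume "mat_mul s A B i k \<noteq> 0"
  then obtain l where "A i l * B l k \<noteq> 0" unfolding mat_mul_def by (meson sum.neutral)
  then have "A i l \<noteq> 0" "B l k \<noteq> 0" by auto
  then show "i < r" "k < q" using hmatD(1)[OF A] hmatD(2)[OF B] by auto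
next
  fix i k t assume "t \<in> Poly_Mapping.keys (mat_mul s A B i k)"
  then obtain l where "t \<in> Poly_Mapping.keys (A i l * B l k)"
    using Poly_Mapping.keys_sum[of "\<lambda>l. A i l * B l k" "{..<s}"] unfolding mat_mul_def by blast
  then obtain x y where xy: "t = x + y" "x \<in> Poly_Mapping.keys (A i l)" "y \<in> Poly_Mapping.keys (B l k)"
    using Poly_Mapping.keys_mult[of "A i l" "B l k"] by blast
  then show "t \<in> monomials n" using hmatD(4)[OF A] hmatD(4)[OF B] by (auto intro: monomials_add)
  show "wdeg w t + a i = c k"
    using hmatD(5)[OF A xy(2)] hmatD(5)[OF B xy(3)] by (simp add: xy(1) wdeg_add)
qed

lemma hmat_diff:
  assumes A: "hmat n w r a s b A" and B: "hmat n w r a s b B"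
  shows "hmat n w r a s b (A - B)"
  unfolding hmat_def
proof (intro conjI allI impI ballI)
  fix i k
  assume "(A - B) i k \<noteq> 0"
  then have "A i k \<noteq> 0 \<or> B i k \<noteq> 0" by auto
  then show "i < r" "k < s" using hmatD(1,2)[OF A] hmatD(1,2)[OF B] by auto
next
  fix i k t assume "t \<in> Poly_Mapping.keys ((A - B) i k)"
  then have "t \<in> Poly_Mapping.keys (A i k) \<or> t \<in> Poly_Mapping.keys (B i k)"
    using Poly_Mapping.keys_diff[of "A i k" "B i k"] by auto
  then show "t \<in> monomials n" "wdeg w t + a i = b k" using hmatD(4,5)[OF A] hmatD(4,5)[OF B] by auto
qed

lemma hmat_id_mat: "hmat n w r a r a (id_mat r)"
  by (auto simp: hmat_def id_mat_def monomials_def wdeg_def)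

lemma hmat_zero: "hmat n w r a s b 0"
  by (auto simp: hmat_def)

lemma hmat_column: "hmat n w r a s b A \<Longrightarrow> (\<lambda>i. A i k) \<in> free_module n r"
  using hmatD(1,3) by (fastforce simp: free_module_def)

text \<open>\<open>q\<close> consists of the terms of \<open>p\<close> with exponents in
  \<open>P\<close>; with a degree condition for \<open>P\<close> it is a homogeneous
  component.\<close>

lemma restrict_keys:
  fixes p :: "'a \<Rightarrow>\<^sub>0 'b::ab_group_add"
  shows "\<exists>q. Poly_Mapping.keys q \<subseteq> {t \<in> Poly_Mapping.keys p. P t} \<and>
    Poly_Mapping.keys (p - q) \<subseteq> {t \<in> Poly_Mapping.keys p. \<not> P t}"
proof -
  define f where "f t = (if P t then Poly_Mapping.lookup p t else 0)" for t
  have "finite {t. f t \<noteq> 0}"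
    by (rule finite_subset[of _ "Poly_Mapping.keys p"]) (auto simp: f_def in_keys_iff)
  then have "Poly_Mapping.lookup (Abs_poly_mapping f) = f" by simp
  then show ?thesis
    by (intro exI[of _ "Abs_poly_mapping f"]) (auto simp: in_keys_iff lookup_minus f_def split: if_splits)
qed

text \<open>A column of solutions need not be homogeneous, but its component of the right degrees is
  again a solution: the discarded terms are mapped to degrees other than \<open>c k\<close>, where
  the homogeneous column of \<open>B\<close> has nothing.\<close>

lemma hmat_lift:
  assumes A: "hmat n w r a s b A" and B: "hmat n w r a q c B"
    and ex: "\<And>k. k < q \<Longrightarrow> \<exists>v\<in>free_module n s. mat_vec s A v = (\<lambda>i. B i k)"
  shows "\<exists>C. hmat n w s b q c C \<and> mat_mul s A C = B"
proof -
  have "\<exists>u. u \<in> free_module n s \<and> mat_vec s A u = (\<lambda>i. B i k) \<and>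
      (\<forall>l. \<forall>t\<in>Poly_Mapping.keys (u l). wdeg w t + b l = c k)" if k: "k < q" for k
  proof -
    obtain v where v: "v \<in> free_module n s" "mat_vec s A v = (\<lambda>i. B i k)" using ex[OF k] by blast
    have "\<exists>u. \<forall>l. Poly_Mapping.keys (u l) \<subseteq> {t \<in> Poly_Mapping.keys (v l). wdeg w t + b l = c k} \<and>
        Poly_Mapping.keys (v l - u l) \<subseteq> {t \<in> Poly_Mapping.keys (v l). wdeg w t + b l \<noteq> c k}"
      by (intro choice allI restrict_keys)
    then obtain u where u: "\<And>l. Poly_Mapping.keys (u l) \<subseteq> {t \<in> Poly_Mapping.keys (v l). wdeg w t + b l = c k}"
      "\<And>l. Poly_Mapping.keys (v l - u l) \<subseteq> {t \<in> Poly_Mapping.keys (v l). wdeg w t + b l \<noteq> c k}"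
      by blast
    have "u l = 0" if "v l = 0" for l using u(1)[of l] that by simp
    then have "u \<in> free_module n s" using v(1) u(1) unfolding free_module_def polys_def by blast
    moreover have "mat_vec s A u i = B i k" for i
    proof -
      let ?p = "\<Sum>l<s. A i l * (v l - u l)" and ?q = "\<Sum>l<s. A i l * u l"
      \<comment> \<open>Up to the shift by \<open>a i\<close>, all terms of \<open>?p\<close> lie
        outside of degree \<open>c k\<close> and all terms on the right inside of it, so
        \<open>?p\<close> vanishes.\<close>
      have pq: "?p = B i k - ?q"
        using fun_cong[OF v(2), of i] by (simp add: mat_vec_def right_diff_distrib sum_subtractf)
      have p: "wdeg w t + a i \<noteq> c k" if t: "t \<in> Poly_Mapping.keys ?p" for t
      proof -
        obtain l where "t \<in> Poly_Mapping.keys (A i l * (v l - u l))"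
          using t Poly_Mapping.keys_sum[of "\<lambda>l. A i l * (v l - u l)" "{..<s}"] by blast
        then obtain x y where xy: "t = x + y" "x \<in> Poly_Mapping.keys (A i l)" "y \<in> Poly_Mapping.keys (v l - u l)"
          using Poly_Mapping.keys_mult[of "A i l" "v l - u l"] by blast
        then have "wdeg w x + a i = b l" "wdeg w y + b l \<noteq> c k" using hmatD(5)[OF A] u(2)[of l] by auto
        then show ?thesis by (simp add: xy(1) wdeg_add)
      qed
      have q: "wdeg w t + a i = c k" if t: "t \<in> Poly_Mapping.keys ?q" for t
      proof -
        obtain l where "t \<in> Poly_Mapping.keys (A i l * u l)"
          using t Poly_Mapping.keys_sum[of "\<lambda>l. A i l * u l" "{..<s}"] by blast
        then obtain x y where xy: "t = x + y" "x \<in> Poly_Mapping.keys (A i l)" "y \<in> Poly_Mapping.keys (u l)"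
          using Poly_Mapping.keys_mult[of "A i l" "u l"] by blast
        then have "wdeg w x + a i = b l" "wdeg w y + b l = c k" using hmatD(5)[OF A] u(1)[of l] by auto
        then show ?thesis by (simp add: xy(1) wdeg_add)
      qed
      have "Poly_Mapping.keys ?p = {}"
      proof (rule ccontr)
        assume "Poly_Mapping.keys ?p \<noteq> {}"
        then obtain t where t: "t \<in> Poly_Mapping.keys ?p" by blast
        then have "t \<in> Poly_Mapping.keys (B i k) \<or> t \<in> Poly_Mapping.keys ?q"
          unfolding pq using Poly_Mapping.keys_diff[of "B i k" ?q] by blast
        then show False using p[OF t] q hmatD(5)[OF B] by blast
      qed
      then have "?p = 0" by simp
      then show ?thesis using pq by (simp add: mat_vec_def)
    qed
    ultimately show ?thesis using u(1) by (intro exI[of _ u]) auto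
  qed
  then obtain U where U: "\<And>k. k < q \<Longrightarrow> U k \<in> free_module n s"
    "\<And>k. k < q \<Longrightarrow> mat_vec s A (U k) = (\<lambda>i. B i k)"
    "\<And>k l t. k < q \<Longrightarrow> t \<in> Poly_Mapping.keys (U k l) \<Longrightarrow> wdeg w t + b l = c k" by metis
  define C where "C l k = (if k < q then U k l else 0)" for l k
  have U': "l < s" if "k < q" "U k l \<noteq> 0" for l k
    using U(1)[OF that(1)] that(2) unfolding free_module_def by (auto simp: not_less[symmetric])
  have "t \<in> monomials n" if "k < q" "t \<in> Poly_Mapping.keys (U k l)" for t k l
  proof -
    have "l < s" using U'[OF that(1), of l] that(2) by force
    then have "U k l \<in> polys n" using U(1)[OF that(1)] by (simp add: free_module_def)
    then show ?thesis using that(2) by (auto simp: polys_def)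
  qed
  then have "hmat n w s b q c C"
    unfolding hmat_def using U(3) U' by (auto simp: C_def split: if_splits)
  moreover have "mat_mul s A C i k = B i k" for i k
  proof (cases "k < q")
    case True
    have "mat_mul s A C i k = mat_vec s A (U k) i" using True by (simp add: mat_mul_def mat_vec_def C_def)
    then show ?thesis using U(2)[OF True] by simp
  next
    case False
    then have "B i k = 0" using hmatD(2)[OF B, of i k] by auto
    then show ?thesis using False by (simp add: mat_mul_def C_def)
  qed
  ultimately show ?thesis by blast
qed

text \<open>
  The ring is the module in position \<open>0\<close>, so that the augmentation becomes the first differential and
  all homological degrees are shifted by one against \<open>aug_complex\<close>.
\<close>

definition mat_res :: "nat \<Rightarrow> (nat \<Rightarrow> nat) \<Rightarrow> ('k::field) mpoly set \<Rightarrow>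
    (nat \<Rightarrow> nat) \<Rightarrow> (nat \<Rightarrow> nat \<Rightarrow> nat) \<Rightarrow> (nat \<Rightarrow> nat \<Rightarrow> nat \<Rightarrow> 'k mpoly) \<Rightarrow> bool" where
  "mat_res n w I R a A \<longleftrightarrow> R 0 = 1 \<and> a 0 0 = 0 \<and>
     (\<forall>i. hmat n w (R i) (a i) (R (Suc i)) (a (Suc i)) (A i)) \<and>
     (\<forall>v\<in>free_module n 1. (\<exists>u\<in>free_module n (R 1). mat_vec (R 1) (A 0) u = v) \<longleftrightarrow> v 0 \<in> I) \<and>
     (\<forall>i. \<forall>v\<in>free_module n (R (Suc i)).
        (\<exists>u\<in>free_module n (R (Suc (Suc i))). mat_vec (R (Suc (Suc i))) (A (Suc i)) u = v) \<longleftrightarrow>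
        mat_vec (R (Suc i)) (A i) v = 0)"

lemma mat_resD:
  assumes "mat_res n w I R a A"
  shows "R 0 = 1" "a 0 0 = 0" "hmat n w (R i) (a i) (R (Suc i)) (a (Suc i)) (A i)"
    "v \<in> free_module n 1 \<Longrightarrow> (\<exists>u\<in>free_module n (R 1). mat_vec (R 1) (A 0) u = v) \<longleftrightarrow> v 0 \<in> I"
    "v \<in> free_module n (R (Suc i)) \<Longrightarrow>
        (\<exists>u\<in>free_module n (R (Suc (Suc i))). mat_vec (R (Suc (Suc i))) (A (Suc i)) u = v) \<longleftrightarrow>
        mat_vec (R (Suc i)) (A i) v = 0"
  using assms by (auto simp: mat_res_def)

section \<open>Comparison maps and homotopies between resolutions\<close>

lemma unit_vector_free: "k < r \<Longrightarrow> (\<lambda>l. if l = k then 1 else 0) \<in> free_module n r"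
  by (auto simp: free_module_def polys_def monomials_def)

lemma mat_vec_unit: "k < s \<Longrightarrow> mat_vec s A (\<lambda>l. if l = k then 1 else 0) = (\<lambda>i. A i k)"
  by (auto simp: mat_vec_def if_distrib[of "\<lambda>x. _ * x"] sum.delta cong: if_cong)

lemma mat_res_complex:
  assumes "mat_res n w I R a A"
  shows "mat_mul (R (Suc i)) (A i) (A (Suc i)) = 0"
proof (intro ext)
  fix l k
  note R = mat_resD[OF assms]
  show "mat_mul (R (Suc i)) (A i) (A (Suc i)) l k = 0 l k"
  proof (cases "k < R (Suc (Suc i))")
    case True
    have "mat_vec (R (Suc i)) (A i) (\<lambda>l. A (Suc i) l k) = 0"
      using R(5)[OF hmat_column[OF R(3)], of i k] unit_vector_free[OF True] mat_vec_unit[OF True] by blast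
    then show ?thesis by (simp add: mat_vec_column fun_eq_iff)
  next
    case False
    then have "A (Suc i) j k = 0" for j using hmatD(2)[OF R(3)] by blast
    then show ?thesis by (simp add: mat_mul_def)
  qed
qed

text \<open>Both resolutions end in the same ring in position 0, where the identity starts the
  lifting. The first lift exists because both augmentations have the image \<open>I\<close>, the
  later ones by exactness of the target.\<close>

lemma mat_res_comparison:
  assumes F: "mat_res n w I R a A" and G: "mat_res n w I R' a' A'"
  shows "\<exists>\<phi>. \<phi> 0 = id_mat 1 \<and> (\<forall>i. hmat n w (R' i) (a' i) (R i) (a i) (\<phi> i) \<and>
    mat_mul (R' (Suc i)) (A' i) (\<phi> (Suc i)) = mat_mul (R i) (\<phi> i) (A i))"
proof -
  note F' = mat_resD[OF F] and G' = mat_resD[OF G]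
  \<comment> \<open>In positive positions the invariant says that the next map to be lifted consists
    of cycles of the target.\<close>
  define P where "P i \<phi> \<longleftrightarrow> hmat n w (R' i) (a' i) (R i) (a i) \<phi> \<and>
    (case i of 0 \<Rightarrow> \<phi> = id_mat 1 | Suc j \<Rightarrow> mat_mul (R' i) (A' j) (mat_mul (R i) \<phi> (A i)) = 0)" for i \<phi>
  have "\<exists>\<phi>. \<forall>i. P i (\<phi> i) \<and> mat_mul (R' (Suc i)) (A' i) (\<phi> (Suc i)) = mat_mul (R i) (\<phi> i) (A i)"
  proof (rule dependent_nat_choice)
    have "hmat n w 1 (a' 0) 1 (a 0) (id_mat 1)"
      using F'(2) G'(2) by (auto simp: hmat_def id_mat_def monomials_def wdeg_def split: if_splits)
    then show "\<exists>\<phi>. P 0 \<phi>" using F'(1) G'(1) by (auto simp: P_def)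
  next
    fix \<phi> i assume P: "P i \<phi>"
    then have \<phi>: "hmat n w (R' i) (a' i) (R i) (a i) \<phi>" by (simp add: P_def)
    have B: "hmat n w (R' i) (a' i) (R (Suc i)) (a (Suc i)) (mat_mul (R i) \<phi> (A i))"
      by (rule hmat_mat_mul[OF \<phi> F'(3)])
    have "\<exists>v\<in>free_module n (R' (Suc i)). mat_vec (R' (Suc i)) (A' i) v = (\<lambda>l. mat_mul (R i) \<phi> (A i) l k)"
      if k: "k < R (Suc i)" for k
    proof (cases i)
      case 0
      have "mat_mul (R i) \<phi> (A i) = A 0"
        using P F'(1) hmatD(1)[OF F'(3)[of 0]] 0 by (auto simp: P_def intro!: mat_mul_id_mat_left)
      moreover have "(\<lambda>l. A 0 l k) \<in> free_module n 1" using hmat_column[OF F'(3)[of 0], of k] F'(1) by simp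
      moreover have "A 0 0 k \<in> I"
        using F'(4)[OF calculation(2)] unit_vector_free[of k "R 1"] mat_vec_unit[of k "R 1" "A 0"] k 0 by auto
      ultimately show ?thesis using G'(4) 0 by simp
    next
      case (Suc j)
      then have "mat_vec (R' i) (A' j) (\<lambda>l. mat_mul (R i) \<phi> (A i) l k) = 0"
        using P by (simp add: P_def mat_vec_column fun_eq_iff)
      then show ?thesis using G'(5)[of _ j] hmat_column[OF B, of k] Suc by simp
    qed
    from hmat_lift[OF G'(3) B this] obtain C where C: "hmat n w (R' (Suc i)) (a' (Suc i)) (R (Suc i)) (a (Suc i)) C"
      "mat_mul (R' (Suc i)) (A' i) C = mat_mul (R i) \<phi> (A i)" by blast
    have "mat_mul (R' (Suc i)) (A' i) (mat_mul (R (Suc i)) C (A (Suc i))) = 0"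
      unfolding mat_mul_assoc[symmetric] C(2) unfolding mat_mul_assoc mat_res_complex[OF F] by simp
    then show "\<exists>\<psi>. P (Suc i) \<psi> \<and> mat_mul (R' (Suc i)) (A' i) \<psi> = mat_mul (R i) \<phi> (A i)"
      using C by (auto simp: P_def)
  qed
  then obtain \<phi> where \<phi>: "\<And>i. P i (\<phi> i)"
    "\<And>i. mat_mul (R' (Suc i)) (A' i) (\<phi> (Suc i)) = mat_mul (R i) (\<phi> i) (A i)" by blast
  then show ?thesis using \<phi>(1)[of 0] by (intro exI[of _ \<phi>]) (simp add: P_def)
qed

text \<open>A chain endomorphism that vanishes on the ring is null homotopic; \<open>h i\<close>
  maps position \<open>i\<close> to position \<open>Suc i\<close>. That \<open>h\<close> starts with
  0 is kept in the conclusion, since it removes the augmentation from the lowest formula.\<close>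

lemma mat_res_homotopy:
  assumes F: "mat_res n w I R a A"
    and \<theta>: "\<And>i. hmat n w (R i) (a i) (R i) (a i) (\<theta> i)" "\<theta> 0 = 0"
    and chain: "\<And>i. mat_mul (R (Suc i)) (A i) (\<theta> (Suc i)) = mat_mul (R i) (\<theta> i) (A i)"
  shows "\<exists>h. h 0 = 0 \<and> (\<forall>i. hmat n w (R (Suc i)) (a (Suc i)) (R i) (a i) (h i) \<and>
    \<theta> (Suc i) = mat_mul (R i) (h i) (A i) + mat_mul (R (Suc (Suc i))) (A (Suc i)) (h (Suc i)))"
proof -
  note F' = mat_resD[OF F]
  \<comment> \<open>By the chain condition, the last clause makes the difference of
    \<open>\<theta> (Suc i)\<close> and \<open>mat_mul (R i) h (A i)\<close> a cycle, so that the
    next homotopy map exists as a lift.\<close>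
  define P where "P i h \<longleftrightarrow> hmat n w (R (Suc i)) (a (Suc i)) (R i) (a i) h \<and> (i = 0 \<longrightarrow> h = 0) \<and>
    mat_mul (R i) (mat_mul (R (Suc i)) (A i) h) (A i) = mat_mul (R i) (\<theta> i) (A i)" for i h
  have "\<exists>h. \<forall>i. P i (h i) \<and>
      \<theta> (Suc i) = mat_mul (R i) (h i) (A i) + mat_mul (R (Suc (Suc i))) (A (Suc i)) (h (Suc i))"
  proof (rule dependent_nat_choice)
    show "\<exists>h. P 0 h" using \<theta>(2) by (auto simp: P_def hmat_zero)
  next
    fix h i assume P: "P i h"
    then have h: "hmat n w (R (Suc i)) (a (Suc i)) (R i) (a i) h" by (simp add: P_def)
    let ?B = "\<theta> (Suc i) - mat_mul (R i) h (A i)"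
    have B: "hmat n w (R (Suc i)) (a (Suc i)) (R (Suc i)) (a (Suc i)) ?B"
      by (intro hmat_diff \<theta> hmat_mat_mul[OF h F'(3)])
    have "mat_mul (R (Suc i)) (A i) ?B = 0"
      using P chain[of i] by (simp add: mat_mul_diff_right P_def mat_mul_assoc)
    then have "mat_vec (R (Suc i)) (A i) (\<lambda>l. ?B l k) = 0" for k
      unfolding mat_vec_column by (simp add: fun_eq_iff)
    then have "\<exists>v\<in>free_module n (R (Suc (Suc i))). mat_vec (R (Suc (Suc i))) (A (Suc i)) v = (\<lambda>l. ?B l k)" for k
      using F'(5)[OF hmat_column[OF B]] by blast
    from hmat_lift[OF F'(3) B this] obtain C
      where C: "hmat n w (R (Suc (Suc i))) (a (Suc (Suc i))) (R (Suc i)) (a (Suc i)) C"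
      "mat_mul (R (Suc (Suc i))) (A (Suc i)) C = ?B" by blast
    have "mat_mul (R (Suc i)) ?B (A (Suc i)) = mat_mul (R (Suc i)) (\<theta> (Suc i)) (A (Suc i))"
      by (simp add: mat_mul_diff_left mat_mul_assoc mat_res_complex[OF F])
    then show "\<exists>h'. P (Suc i) h' \<and> \<theta> (Suc i) = mat_mul (R i) h (A i) + mat_mul (R (Suc (Suc i))) (A (Suc i)) h'"
      using C by (intro exI[of _ C]) (simp add: P_def)
  qed
  then show ?thesis unfolding P_def by blast
qed

text \<open>The difference of the identity and a round trip commutes with the differentials and
  vanishes on the ring, because both comparison maps start with the identity there.\<close>

lemma mat_res_homotopy_inverse:
  assumes F: "mat_res n w I R a A"
    and \<phi>: "\<phi> 0 = id_mat 1" "\<And>i. hmat n w (R' i) (a' i) (R i) (a i) (\<phi> i)"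
      "\<And>i. mat_mul (R' (Suc i)) (A' i) (\<phi> (Suc i)) = mat_mul (R i) (\<phi> i) (A i)"
    and \<psi>: "\<psi> 0 = id_mat 1" "\<And>i. hmat n w (R i) (a i) (R' i) (a' i) (\<psi> i)"
      "\<And>i. mat_mul (R (Suc i)) (A i) (\<psi> (Suc i)) = mat_mul (R' i) (\<psi> i) (A' i)"
    and R': "R' 0 = 1"
  shows "\<exists>h. h 0 = 0 \<and> (\<forall>i. hmat n w (R (Suc i)) (a (Suc i)) (R i) (a i) (h i) \<and>
    id_mat (R (Suc i)) - mat_mul (R' (Suc i)) (\<psi> (Suc i)) (\<phi> (Suc i)) =
      mat_mul (R i) (h i) (A i) + mat_mul (R (Suc (Suc i))) (A (Suc i)) (h (Suc i)))"
proof -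
  note F' = mat_resD[OF F]
  define \<theta> where "\<theta> i = id_mat (R i) - mat_mul (R' i) (\<psi> i) (\<phi> i)" for i
  have "\<exists>h. h 0 = 0 \<and> (\<forall>i. hmat n w (R (Suc i)) (a (Suc i)) (R i) (a i) (h i) \<and>
    \<theta> (Suc i) = mat_mul (R i) (h i) (A i) + mat_mul (R (Suc (Suc i))) (A (Suc i)) (h (Suc i)))"
  proof (rule mat_res_homotopy[OF F])
    show "hmat n w (R i) (a i) (R i) (a i) (\<theta> i)" for i
      unfolding \<theta>_def by (intro hmat_diff hmat_id_mat hmat_mat_mul[OF \<psi>(2) \<phi>(2)])
    have "mat_mul 1 (id_mat 1) (id_mat 1) = (id_mat 1 :: nat \<Rightarrow> nat \<Rightarrow> 'a mpoly)"
      by (rule mat_mul_id_mat_left) (auto simp: id_mat_def split: if_splits)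
    then show "\<theta> 0 = 0" by (simp add: \<theta>_def F'(1) R' \<phi>(1) \<psi>(1))
    show "mat_mul (R (Suc i)) (A i) (\<theta> (Suc i)) = mat_mul (R i) (\<theta> i) (A i)" for i
    proof -
      have 1: "mat_mul (R (Suc i)) (A i) (id_mat (R (Suc i))) = A i"
        by (rule mat_mul_id_mat_right) (rule hmatD(2)[OF F'(3)])
      have 2: "mat_mul (R i) (id_mat (R i)) (A i) = A i"
        by (rule mat_mul_id_mat_left) (rule hmatD(1)[OF F'(3)])
      show ?thesis
        unfolding \<theta>_def mat_mul_diff_right mat_mul_diff_left 1 2
        by (simp add: mat_mul_assoc[symmetric] \<psi>(3)) (simp add: mat_mul_assoc \<phi>(3))
    qed
  qed
  then show ?thesis by (simp add: \<theta>_def)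
qed

section \<open>Reduction modulo the variables and the dimension of Tor\<close>

definition const_mat :: "(nat \<Rightarrow> nat \<Rightarrow> 'k::field mpoly) \<Rightarrow> nat \<Rightarrow> nat \<Rightarrow> 'k" where
  "const_mat A = (\<lambda>i k. Poly_Mapping.lookup (A i k) 0)"

text \<open>Exponents are nonnegative, so two of them add up to 0 only if both are 0.\<close>

lemma lookup_mult_zero:
  fixes p q :: "'k::field mpoly"
  shows "Poly_Mapping.lookup (p * q) 0 = Poly_Mapping.lookup p 0 * Poly_Mapping.lookup q 0"
proof -
  have z: "s + t = 0 \<longleftrightarrow> s = 0 \<and> t = 0" for s t :: monomial
    by (auto simp: poly_mapping_eq_iff fun_eq_iff lookup_add)
  have "(Poly_Mapping.lookup q t when 0 = s + t) = ((Poly_Mapping.lookup q t when t = 0) when s = 0)" for s t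
    using z[of s t] by (auto simp: when_def)
  then have "Poly_Mapping.lookup (p * q) 0 =
      (\<Sum>s. Poly_Mapping.lookup p s * ((\<Sum>t. Poly_Mapping.lookup q t when t = 0) when s = 0))"
    by (simp add: lookup_mult Sum_any_when_independent)
  also have "\<dots> = (\<Sum>s. (Poly_Mapping.lookup p s * Poly_Mapping.lookup q 0) when s = 0)"
    by (simp add: mult_when)
  finally show ?thesis by simp
qed

lemma const_mat_mat_mul: "const_mat (mat_mul s A B) = mat_mul s (const_mat A) (const_mat B)"
  by (simp add: const_mat_def mat_mul_def lookup_sum lookup_mult_zero)

lemma const_mat_add: "const_mat (A + B) = const_mat A + const_mat B"
  by (intro ext) (simp add: const_mat_def lookup_add)

lemma const_mat_diff: "const_mat (A - B) = const_mat A - const_mat B"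
  by (intro ext) (simp add: const_mat_def lookup_minus)

lemma const_mat_zero [simp]: "const_mat 0 = 0"
  by (intro ext) (simp add: const_mat_def)

lemma const_mat_id_mat [simp]: "const_mat (id_mat r) = id_mat r"
  by (intro ext) (simp add: const_mat_def id_mat_def)

text \<open>A constant term has degree 0, so it can only join basis elements of equal degree;
  reduction modulo the variables respects the graded pieces.\<close>

lemma const_mat_hmat: "hmat n w r a s b A \<Longrightarrow> const_mat A i k \<noteq> 0 \<Longrightarrow> i < r \<and> k < s \<and> a i = b k"
proof -
  assume A: "hmat n w r a s b A" and nz: "const_mat A i k \<noteq> 0"
  then have "0 \<in> Poly_Mapping.keys (A i k)" "A i k \<noteq> 0" by (auto simp: const_mat_def in_keys_iff)
  then show ?thesis using hmatD(1,2)[OF A] hmatD(5)[OF A, of 0 i k] by (simp add: wdeg_def)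
qed

text \<open>\<open>g\<close> kills \<open>B\<close> and sends the \<open>f k\<close> to independent
  vectors, so the \<open>f k\<close> are independent modulo \<open>B\<close>; by the last assumption
  they span \<open>Z\<close> modulo \<open>B\<close>. \<open>C\<close> ensures that \<open>B\<close>
  has finite dimension.\<close>

lemma (in vector_space) dim_split_section:
  assumes XB: "finite K" "inj_on e K" "independent (e ` K)"
    and B: "subspace B" "B \<subseteq> span C" "finite C" and Z: "subspace Z" "B \<subseteq> Z"
    and fX: "\<And>k. k \<in> K \<Longrightarrow> f k \<in> Z"
    and g: "module_hom scale scale g" "\<And>k. k \<in> K \<Longrightarrow> g (f k) = e k" "\<And>v. v \<in> B \<Longrightarrow> g v = 0"
    and Zs: "\<And>v. v \<in> Z \<Longrightarrow> \<exists>u\<in>span (f ` K). v - u \<in> B"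
  shows "dim Z = card K + dim B"
proof -
  interpret g: module_hom scale scale g by (rule g(1))
  obtain S where S: "S \<subseteq> B" "independent S" "B \<subseteq> span S" "card S = dim B"
    using basis_exists by blast
  have finS: "finite S" using independent_span_bound[OF B(3) S(2)] S(1) B(2) by auto
  have injf: "inj_on f K" using g(2) XB(2) by (metis inj_on_def)
  have disj: "S \<inter> f ` K = {}"
  proof (rule ccontr)
    assume "S \<inter> f ` K \<noteq> {}"
    then obtain k where k: "k \<in> K" "f k \<in> S" by blast
    then have "e k = 0" using g(2,3) S(1) by force
    then show False using XB(3) k(1) dependent_zero by force
  qed
  have ind: "independent (S \<union> f ` K)"
  proof
    assume "dependent (S \<union> f ` K)"
    then obtain u v where u: "v \<in> S \<union> f ` K" "u v \<noteq> 0" "(\<Sum>v\<in>S \<union> f ` K. scale (u v) v) = 0"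
      using dependent_finite[of "S \<union> f ` K"] finS XB(1) by auto
    have sum: "(\<Sum>v\<in>S. scale (u v) v) + (\<Sum>k\<in>K. scale (u (f k)) (f k)) = 0"
      using u(3) by (simp add: sum.union_disjoint[OF finS finite_imageI[OF XB(1)] disj] sum.reindex[OF injf])
    have "g ((\<Sum>v\<in>S. scale (u v) v) + (\<Sum>k\<in>K. scale (u (f k)) (f k))) = 0" by (simp add: sum g.zero)
    moreover have "g (\<Sum>v\<in>S. scale (u v) v) = 0" using g(3) S(1) by (simp add: g.sum g.scale) (auto intro!: sum.neutral)
    ultimately have "(\<Sum>k\<in>K. scale (u (f k)) (e k)) = 0"
      using g(2) by (simp add: g.add g.sum g.scale)
    then have "(\<Sum>x\<in>e ` K. scale (u (f (the_inv_into K e x))) x) = 0"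
      by (simp add: sum.reindex[OF XB(2)] the_inv_into_f_f[OF XB(2)])
    then have "u (f (the_inv_into K e x)) = 0" if "x \<in> e ` K" for x
      using XB(3) dependent_finite[OF finite_imageI[OF XB(1)]] that by force
    then have uf: "u (f k) = 0" if "k \<in> K" for k using that the_inv_into_f_f[OF XB(2) that] by force
    then have "(\<Sum>v\<in>S. scale (u v) v) = 0" using sum by simp
    then have "u v = 0" if "v \<in> S" for v using S(2) dependent_finite[OF finS] that by blast
    then show False using u(1,2) uf by auto
  qed
  have "span (S \<union> f ` K) = span Z"
  proof (rule span_eq[THEN iffD2], intro conjI)
    show "S \<union> f ` K \<subseteq> span Z" using S(1) Z(2) fX span_superset by blast
    show "Z \<subseteq> span (S \<union> f ` K)"
    proof
      fix v assume "v \<in> Z"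
      then obtain u where u: "u \<in> span (f ` K)" "v - u \<in> B" using Zs by blast
      have "v - u \<in> span (S \<union> f ` K)" using u(2) S(3) span_mono[of S "S \<union> f ` K"] by blast
      moreover have "u \<in> span (S \<union> f ` K)" using u(1) span_mono[of "f ` K" "S \<union> f ` K"] by blast
      ultimately have "(v - u) + u \<in> span (S \<union> f ` K)" by (rule span_add)
      then show "v \<in> span (S \<union> f ` K)" by simp
    qed
  qed
  then have "dim Z = card (S \<union> f ` K)" using dim_eq_card ind by blast
  also have "\<dots> = card S + card K"
    using card_Un_disjoint[OF finS finite_imageI[OF XB(1)] disj] card_image[OF injf] by simp
  finally show ?thesis using S(4) by simp
qed

text \<open>This and the next two definitions bring a resolution into the form of
  \<open>mat_res\<close>: the ring, generated in degree 0, becomes position 0, and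
  \<open>res_mat\<close> cuts the matrices off outside of their range, where a resolution leaves
  them arbitrary.\<close>

definition res_rank :: "('k::field) mpoly aug_complex \<Rightarrow> nat \<Rightarrow> nat" where
  "res_rank F i = (case i of 0 \<Rightarrow> 1 | Suc j \<Rightarrow> rk F j)"

definition res_deg :: "('k::field) mpoly aug_complex \<Rightarrow> nat \<Rightarrow> nat \<Rightarrow> nat" where
  "res_deg F i k = (case i of 0 \<Rightarrow> 0 | Suc j \<Rightarrow> bdeg F j k)"

definition res_mat :: "('k::field) mpoly aug_complex \<Rightarrow> nat \<Rightarrow> nat \<Rightarrow> nat \<Rightarrow> 'k mpoly" where
  "res_mat F i l k = (case i of
     0 \<Rightarrow> if l = 0 \<and> k < rk F 0 then aug F k else 0
   | Suc j \<Rightarrow> if l < rk F j \<and> k < rk F (Suc j) then dmat F j l k else 0)"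

lemma mat_vec_res_mat:
  "mat_vec (rk F 0) (res_mat F 0) v = (\<lambda>l. if l = 0 then aug_map F v else 0)"
  "mat_vec (rk F (Suc i)) (res_mat F (Suc i)) v = diff_map F i v"
  by (auto simp: mat_vec_def res_mat_def aug_map_def diff_map_def mat_map_def fun_eq_iff)

lemma mat_res_of_resolution:
  assumes "graded_free_resolution n w I F"
  shows "mat_res n w I (res_rank F) (res_deg F) (res_mat F)"
proof -
  note g = assms[unfolded graded_free_resolution_def]
  note c = g[THEN conjunct1] g[THEN conjunct2, THEN conjunct1] g[THEN conjunct2, THEN conjunct2, THEN conjunct1]
    g[THEN conjunct2, THEN conjunct2, THEN conjunct2, THEN conjunct1]
    g[THEN conjunct2, THEN conjunct2, THEN conjunct2, THEN conjunct2]
  have a: "aug F k \<in> polys n" "t \<in> Poly_Mapping.keys (aug F k) \<Longrightarrow> wdeg w t = bdeg F 0 k"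
    if "k < rk F 0" for k t using c(1) that by blast+
  have d: "dmat F i l k \<in> polys n"
    "t \<in> Poly_Mapping.keys (dmat F i l k) \<Longrightarrow> wdeg w t + bdeg F i l = bdeg F (Suc i) k"
    if "l < rk F i" "k < rk F (Suc i)" for i l k t
    using c(2) that by blast+
  note e = c(3,4) c(5)[rule_format]
  have "hmat n w (res_rank F i) (res_deg F i) (res_rank F (Suc i)) (res_deg F (Suc i)) (res_mat F i)" for i
  proof (cases i)
    case 0
    then show ?thesis
      using a by (auto simp: hmat_def res_rank_def res_deg_def res_mat_def polys_def split: if_splits)
  next
    case (Suc j)
    then show ?thesis
      using d[of _ j] by (auto simp: hmat_def res_rank_def res_deg_def res_mat_def polys_def split: if_splits)
  qed
  moreover have "(\<exists>u\<in>free_module n (rk F 0). mat_vec (rk F 0) (res_mat F 0) u = v) \<longleftrightarrow> v 0 \<in> I"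
    if "v \<in> free_module n 1" for v
  proof -
    have eq: "(\<lambda>l. if l = 0 then p else 0) = v \<longleftrightarrow> p = v 0" for p
      using that by (auto simp: free_module_def fun_eq_iff)
    show ?thesis unfolding mat_vec_res_mat e(1)[symmetric] eq image_iff by (simp only: eq_commute[of "v 0"])
  qed
  moreover have "(\<exists>u\<in>free_module n (rk F (Suc i)). mat_vec (rk F (Suc i)) (res_mat F (Suc i)) u = v) \<longleftrightarrow>
      mat_vec (rk F i) (res_mat F i) v = 0" if v: "v \<in> free_module n (rk F i)" for v i
  proof (cases i)
    case 0
    have "(\<lambda>l. if l = (0::nat) then aug_map F v else 0) = 0 \<longleftrightarrow> aug_map F v = 0"
      by (auto simp: fun_eq_iff)
    moreover have "(\<exists>u\<in>free_module n (rk F 1). diff_map F 0 u = v) \<longleftrightarrow> aug_map F v = 0"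
    proof -
      have "(\<exists>u\<in>free_module n (rk F 1). diff_map F 0 u = v) \<longleftrightarrow> v \<in> diff_map F 0 ` free_module n (rk F 1)"
        by (simp only: image_iff eq_commute[of v])
      then show ?thesis unfolding e(2) using v 0 by simp
    qed
    ultimately show ?thesis unfolding 0 mat_vec_res_mat by simp
  next
    case (Suc j)
    have "(\<exists>u\<in>free_module n (rk F (Suc i)). diff_map F i u = v) \<longleftrightarrow> v \<in> diff_map F i ` free_module n (rk F (Suc i))"
      by (simp only: image_iff eq_commute[of v])
    then show ?thesis using v unfolding Suc mat_vec_res_mat e(3) by simp
  qed
  ultimately show ?thesis by (simp add: mat_res_def res_rank_def res_deg_def)
qed

lemma mat_vec_const_fibre:
  assumes "hmat n w r a s b A" "\<And>k. v k \<noteq> 0 \<Longrightarrow> b k = j" "mat_vec s (const_mat A) v l \<noteq> 0"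
  shows "l < r \<and> a l = j"
proof -
  obtain k where "const_mat A l k * v k \<noteq> 0" using assms(3) unfolding mat_vec_def by (meson sum.neutral)
  then show ?thesis using const_mat_hmat[OF assms(1), of l k] assms(2)[of k] by auto
qed

definition unit_vec :: "nat \<Rightarrow> nat \<Rightarrow> 'k::field" where
  "unit_vec k = (\<lambda>l. if l = k then 1 else 0)"

lemma inj_unit_vec: "inj (unit_vec :: nat \<Rightarrow> nat \<Rightarrow> 'k::field)"
  unfolding inj_def unit_vec_def by (metis zero_neq_one)

lemma sum_fun_apply: "(\<Sum>i\<in>A. f i) x = (\<Sum>i\<in>A. f i x)"
  by (induction A rule: infinite_finite_induct) auto

lemma mat_vec_in_span:
  assumes "finite K" "K \<subseteq> {..<s}" "\<And>k. x k \<noteq> 0 \<Longrightarrow> k \<in> K"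
  shows "mat_vec s M x \<in> coord.span ((\<lambda>k l. M l k) ` K)"
proof -
  have "mat_vec s M x = (\<lambda>l. \<Sum>k\<in>K. M l k * x k)"
    unfolding mat_vec_def using assms by (intro ext sum.mono_neutral_right) auto
  also have "\<dots> = (\<Sum>k\<in>K. (\<lambda>l. x k * M l k))"
    by (intro ext) (simp add: sum_fun_apply mult.commute)
  also have "\<dots> \<in> coord.span ((\<lambda>k l. M l k) ` K)"
    by (intro coord.span_sum coord.span_scale coord.span_base imageI)
  finally show ?thesis .
qed

lemma independent_unit_vecs:
  assumes "finite K"
  shows "coord.independent ((unit_vec :: nat \<Rightarrow> nat \<Rightarrow> 'k::field) ` K)"
proof
  assume "coord.dependent (unit_vec ` K :: (nat \<Rightarrow> 'k) set)"
  then obtain u k where u: "k \<in> K" "u (unit_vec k :: nat \<Rightarrow> 'k) \<noteq> 0"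
    "(\<Sum>v\<in>unit_vec ` K. (\<lambda>l. u v * v l)) = 0"
    using coord.dependent_finite[of "unit_vec ` K :: (nat \<Rightarrow> 'k) set"] assms by auto
  have "0 = (\<Sum>v\<in>unit_vec ` K. (\<lambda>l. u v * v l)) k" using u(3) by simp
  also have "\<dots> = (\<Sum>i\<in>K. u (unit_vec i) * unit_vec i k)"
    using inj_on_subset[OF inj_unit_vec] by (subst sum.reindex) (auto simp: sum_fun_apply)
  also have "\<dots> = u (unit_vec k)"
    using assms u(1) by (simp add: unit_vec_def if_distrib[of "\<lambda>x. _ * x"] cong: if_cong)
  finally show False using u(2) by simp
qed

lemma mat_vec_linear: "module_hom (\<lambda>(c::'k::field) v k. c * v k) (\<lambda>c v k. c * v k) (mat_vec s A)"
  unfolding module_hom_iff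
  using coord.module_axioms by (auto simp: mat_vec_add) (auto simp: mat_vec_def sum_distrib_left algebra_simps)

text \<open>Modulo the variables \<open>G\<close> has zero differentials, so the comparison maps
  \<open>\<Phi>\<close> from \<open>G\<close> and \<open>\<Psi>\<close> back satisfy
  \<open>\<Psi>\<Phi> = 1\<close> exactly, while \<open>\<Phi>\<Psi>\<close> is the identity on
  cycles of \<open>F\<close> up to boundaries. The cycles are thus the direct sum of the boundaries
  and the image of \<open>\<Phi>\<close>, with one dimension for each basis element of
  \<open>G\<close> in degree \<open>j\<close>.\<close>

theorem homology_dim_eq_card:
  fixes F G :: "('k::field) mpoly aug_complex"
  assumes F: "graded_free_resolution n w I F" and G: "graded_free_resolution n w I G"
    and minimal: "\<And>i l k. l < rk G i \<Longrightarrow> k < rk G (Suc i) \<Longrightarrow> Poly_Mapping.lookup (dmat G i l k) 0 = 0"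
  shows "homology_dim F i j = card {k. k < rk G i \<and> bdeg G i k = j}"
proof -
  note F' = mat_res_of_resolution[OF F] and G' = mat_res_of_resolution[OF G]
  let ?A = "res_mat F" and ?B = "res_mat G"
  have rk: "res_rank E (Suc i) = rk E i" "res_rank E 0 = 1" "res_deg E (Suc i) = bdeg E i"
    for E :: "'k mpoly aug_complex" and i by (auto simp: res_rank_def res_deg_def fun_eq_iff)
  obtain \<phi> where \<phi>: "\<phi> 0 = id_mat 1"
    "\<And>i. hmat n w (res_rank F i) (res_deg F i) (res_rank G i) (res_deg G i) (\<phi> i)"
    "\<And>i. mat_mul (res_rank F (Suc i)) (?A i) (\<phi> (Suc i)) = mat_mul (res_rank G i) (\<phi> i) (?B i)"
    using mat_res_comparison[OF G' F'] by blast
  obtain \<psi> where \<psi>: "\<psi> 0 = id_mat 1"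
    "\<And>i. hmat n w (res_rank G i) (res_deg G i) (res_rank F i) (res_deg F i) (\<psi> i)"
    "\<And>i. mat_mul (res_rank G (Suc i)) (?B i) (\<psi> (Suc i)) = mat_mul (res_rank F i) (\<psi> i) (?A i)"
    using mat_res_comparison[OF F' G'] by blast
  obtain h where h: "h 0 = 0" "\<And>i. id_mat (res_rank G (Suc i)) - mat_mul (res_rank F (Suc i)) (\<psi> (Suc i)) (\<phi> (Suc i)) =
      mat_mul (res_rank G i) (h i) (?B i) + mat_mul (res_rank G (Suc (Suc i))) (?B (Suc i)) (h (Suc i))"
    using mat_res_homotopy_inverse[OF G' \<phi> \<psi> rk(2)] by blast
  obtain h' where h': "h' 0 = 0"
    "\<And>i. hmat n w (res_rank F (Suc i)) (res_deg F (Suc i)) (res_rank F i) (res_deg F i) (h' i)"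
    "\<And>i. id_mat (res_rank F (Suc i)) - mat_mul (res_rank G (Suc i)) (\<phi> (Suc i)) (\<psi> (Suc i)) =
      mat_mul (res_rank F i) (h' i) (?A i) + mat_mul (res_rank F (Suc (Suc i))) (?A (Suc i)) (h' (Suc i))"
    using mat_res_homotopy_inverse[OF F' \<psi> \<phi> rk(2)] by blast
  have B0: "const_mat (?B (Suc i)) = 0" for i
    using minimal by (auto simp: const_mat_def res_mat_def fun_eq_iff)
  have fdiff: "fibre_diff F i v = mat_vec (rk F (Suc i)) (const_mat (?A (Suc i))) v" for i v
    by (auto simp: fibre_diff_def mat_map_def mat_vec_def const_mat_def res_mat_def fun_eq_iff)
  let ?\<Phi> = "const_mat (\<phi> (Suc i))" and ?\<Psi> = "const_mat (\<psi> (Suc i))"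
  let ?K = "{k. k < rk G i \<and> bdeg G i k = j}" and ?L = "{k. k < rk F i \<and> bdeg F i k = j}"
  let ?Z = "fibre_cycles F i j" and ?Bd = "fibre_boundaries F i j"
  let ?e = "unit_vec :: nat \<Rightarrow> nat \<Rightarrow> 'k"
  have fib_\<Phi>: "mat_vec (rk G i) ?\<Phi> v \<in> fibre F i j" if "\<And>k. v k \<noteq> 0 \<Longrightarrow> bdeg G i k = j" for v
    using mat_vec_const_fibre[OF \<phi>(2)[of "Suc i"], of v j] that by (auto simp: fibre_def rk)
  have fib_\<Psi>: "mat_vec (rk F i) ?\<Psi> v \<in> fibre G i j" if "v \<in> fibre F i j" for v
    using mat_vec_const_fibre[OF \<psi>(2)[of "Suc i"], of v j] that by (auto simp: fibre_def rk)
  have fib_d: "fibre_diff F i v \<in> fibre F i j" if "v \<in> fibre F (Suc i) j" for i v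
    using mat_vec_const_fibre[OF mat_resD(3)[OF F', of "Suc i"], of v j] that
    by (auto simp: fibre_def rk fdiff)
  have Z_fibre: "v \<in> fibre F i j" if "v \<in> ?Z" for v using that by (auto simp: fibre_cycles_def split: nat.splits)
  have dd: "fibre_diff F i (fibre_diff F (Suc i) v) = 0" for i v
    unfolding fdiff mat_vec_mult[symmetric] const_mat_mat_mul[symmetric]
    using mat_res_complex[OF F', of "Suc i"] by (simp add: rk)
  have fib_sub: "coord.subspace (fibre F i j)" for i
    by (auto simp: coord.subspace_def fibre_def) (metis add_0)+
  have lin: "fibre_diff F i (u + v) = fibre_diff F i u + fibre_diff F i v"
    "fibre_diff F i (\<lambda>k. c * v k) = (\<lambda>k. c * fibre_diff F i v k)" "fibre_diff F i 0 = 0" for i u v c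
    unfolding fdiff by (simp_all add: mat_vec_add) (simp add: mat_vec_def sum_distrib_left algebra_simps)
  have Z_sub: "coord.subspace ?Z"
    using fib_sub[of i] lin by (auto simp: fibre_cycles_def coord.subspace_def fun_eq_iff split: nat.split)
  have Bd_sub: "coord.subspace ?Bd"
    unfolding coord.subspace_def fibre_boundaries_def
  proof (intro conjI ballI allI)
    note s = fib_sub[of "Suc i", unfolded coord.subspace_def]
    show "0 \<in> fibre_diff F i ` fibre F (Suc i) j" using s lin(3)[of i] by force
    fix x y c assume x: "x \<in> fibre_diff F i ` fibre F (Suc i) j"
    then show "(\<lambda>k. c * x k) \<in> fibre_diff F i ` fibre F (Suc i) j" using s lin(2)[of i c, symmetric] by auto
    assume y: "y \<in> fibre_diff F i ` fibre F (Suc i) j"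
    then show "x + y \<in> fibre_diff F i ` fibre F (Suc i) j" using x s lin(1)[of i, symmetric] by auto
  qed
  have Bd_Z: "?Bd \<subseteq> ?Z"
    using fib_d dd by (auto simp: fibre_boundaries_def fibre_cycles_def split: nat.split)
  have Bd_span: "?Bd \<subseteq> coord.span (?e ` ?L)"
  proof
    fix v assume "v \<in> ?Bd"
    then have v: "\<And>k. v k \<noteq> 0 \<Longrightarrow> k \<in> ?L" using Bd_Z Z_fibre by (auto simp: fibre_def)
    then have "mat_vec (rk F i) (id_mat (rk F i)) v = v" by (intro mat_vec_id_mat) auto
    moreover have "mat_vec (rk F i) (id_mat (rk F i)) v \<in> coord.span ((\<lambda>k l. id_mat (rk F i) l k) ` ?L)"
      by (rule mat_vec_in_span) (use v in auto)
    moreover have "(\<lambda>k l. id_mat (rk F i) l k) ` ?L = ?e ` ?L"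
      by (intro image_cong) (auto simp: id_mat_def unit_vec_def fun_eq_iff)
    ultimately show "v \<in> coord.span (?e ` ?L)" by simp
  qed
  have \<Psi>\<Phi>: "mat_mul (rk F i) ?\<Psi> ?\<Phi> = id_mat (rk G i)"
  proof -
    \<comment> \<open>For \<open>i = 0\<close> the matrix \<open>?B 0\<close> is the augmentation,
      which may have constant entries when \<open>I\<close> is the unit ideal; there
      \<open>h 0 = 0\<close> removes the term.\<close>
    have "const_mat (mat_mul (res_rank G i) (h i) (?B i)) = 0"
      using h(1) B0 by (cases i) (simp_all add: const_mat_mat_mul)
    moreover have "const_mat (mat_mul (rk G (Suc i)) (?B (Suc i)) (h (Suc i))) = 0"
      by (simp add: const_mat_mat_mul B0)
    ultimately have "const_mat (id_mat (rk G i) - mat_mul (rk F i) (\<psi> (Suc i)) (\<phi> (Suc i))) = 0"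
      using h(2)[of i] by (simp add: rk const_mat_add)
    then show ?thesis by (simp add: const_mat_diff const_mat_mat_mul)
  qed
  have \<Phi>e: "mat_vec (rk G i) ?\<Phi> (?e k) = (\<lambda>l. ?\<Phi> l k)" if "k \<in> ?K" for k
    using that mat_vec_unit[of k "rk G i" ?\<Phi>] by (simp add: unit_vec_def)
  have "coord.dim ?Z = card ?K + coord.dim ?Bd"
  proof (rule coord.dim_split_section[where e = ?e and f = "\<lambda>k. mat_vec (rk G i) ?\<Phi> (?e k)"
        and g = "mat_vec (rk F i) ?\<Psi>" and C = "?e ` ?L"])
    show "finite ?K" "finite (?e ` ?L)" by auto
    then show "coord.independent (?e ` ?K)" by (intro independent_unit_vecs)
    show "inj_on ?e ?K" using inj_unit_vec by (rule inj_on_subset) auto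
    show "coord.subspace ?Bd" "coord.subspace ?Z" "?Bd \<subseteq> ?Z" "?Bd \<subseteq> coord.span (?e ` ?L)"
      by (fact Bd_sub Z_sub Bd_Z Bd_span)+
    show "module_hom (\<lambda>c v k. c * v k) (\<lambda>c v k. c * v k) (mat_vec (rk F i) ?\<Psi>)" by (rule mat_vec_linear)
    show "mat_vec (rk G i) ?\<Phi> (?e k) \<in> ?Z" if "k \<in> ?K" for k
    proof -
      have "mat_vec (rk G i) ?\<Phi> (?e k) \<in> fibre F i j"
        using that by (intro fib_\<Phi>) (auto simp: unit_vec_def split: if_splits)
      moreover have "fibre_diff F i' (mat_vec (rk G i) ?\<Phi> (?e k)) = 0" if "i = Suc i'" for i'
      proof -
        have "fibre_diff F i' (mat_vec (rk G i) ?\<Phi> (?e k)) =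
            mat_vec (rk G i) (const_mat (mat_mul (rk F i) (?A i) (\<phi> (Suc i)))) (?e k)"
          using that by (simp add: fdiff mat_vec_mult const_mat_mat_mul)
        also have "mat_mul (rk F i) (?A i) (\<phi> (Suc i)) = mat_mul (res_rank G i) (\<phi> i) (?B i)"
          using \<phi>(3)[of i] by (simp add: rk)
        finally show ?thesis using B0[of i'] that by (simp add: const_mat_mat_mul) (simp add: mat_vec_def zero_fun_def)
      qed
      ultimately show ?thesis by (auto simp: fibre_cycles_def split: nat.split)
    qed
    show "mat_vec (rk F i) ?\<Psi> (mat_vec (rk G i) ?\<Phi> (?e k)) = ?e k" if "k \<in> ?K" for k
      unfolding mat_vec_mult[symmetric] \<Psi>\<Phi> using that by (intro mat_vec_id_mat) (auto simp: unit_vec_def split: if_splits)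
    show "mat_vec (rk F i) ?\<Psi> v = 0" if v: "v \<in> ?Bd" for v
    proof -
      obtain u where "v = fibre_diff F i u" using v by (auto simp: fibre_boundaries_def)
      then have "mat_vec (rk F i) ?\<Psi> v = mat_vec (rk F (Suc i)) (const_mat (mat_mul (rk F i) (\<psi> (Suc i)) (?A (Suc i)))) u"
        by (simp add: fdiff mat_vec_mult const_mat_mat_mul)
      also have "mat_mul (rk F i) (\<psi> (Suc i)) (?A (Suc i)) = mat_mul (rk G (Suc i)) (?B (Suc i)) (\<psi> (Suc (Suc i)))"
        using \<psi>(3)[of "Suc i"] by (simp add: rk)
      finally show ?thesis by (simp add: const_mat_mat_mul B0) (simp add: mat_vec_def zero_fun_def)
    qed
    show "\<exists>u\<in>coord.span ((\<lambda>k. mat_vec (rk G i) ?\<Phi> (?e k)) ` ?K). v - u \<in> ?Bd" if v: "v \<in> ?Z" for v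
    proof
      \<comment> \<open>The part of \<open>v\<close> that comes from \<open>G\<close>. By the
        homotopy on \<open>F\<close> the rest is a boundary, as the other homotopy term first
        applies the differential to the cycle \<open>v\<close>.\<close>
      let ?u = "mat_vec (rk G i) ?\<Phi> (mat_vec (rk F i) ?\<Psi> v)"
      have "?u \<in> coord.span ((\<lambda>k l. ?\<Phi> l k) ` ?K)"
        by (rule mat_vec_in_span) (use fib_\<Psi>[OF Z_fibre[OF v]] in \<open>auto simp: fibre_def\<close>)
      moreover have "(\<lambda>k l. ?\<Phi> l k) ` ?K = (\<lambda>k. mat_vec (rk G i) ?\<Phi> (?e k)) ` ?K"
        using \<Phi>e by (intro image_cong) auto
      ultimately show "?u \<in> coord.span ((\<lambda>k. mat_vec (rk G i) ?\<Phi> (?e k)) ` ?K)" by simp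
      have "v - ?u = mat_vec (rk F i) (const_mat (id_mat (rk F i) - mat_mul (rk G i) (\<phi> (Suc i)) (\<psi> (Suc i)))) v"
        using Z_fibre[OF v] mat_vec_id_mat[of v "rk F i"]
        by (simp add: const_mat_diff const_mat_mat_mul mat_vec_diff_mat mat_vec_mult fibre_def)
      also have "\<dots> = mat_vec (rk F i) (mat_mul (res_rank F i) (const_mat (h' i)) (const_mat (?A i))) v +
          mat_vec (rk F i) (mat_mul (rk F (Suc i)) (const_mat (?A (Suc i))) (const_mat (h' (Suc i)))) v"
        using h'(3)[of i] by (simp add: rk const_mat_add const_mat_mat_mul mat_vec_add_mat)
      also have "mat_vec (rk F i) (mat_mul (res_rank F i) (const_mat (h' i)) (const_mat (?A i))) v = 0"
      proof (cases i)
        case (Suc i')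
        then have "mat_vec (rk F i) (const_mat (?A i)) v = 0"
          using v by (simp add: fibre_cycles_def fdiff)
        then show ?thesis by (simp add: mat_vec_mult)
      qed (simp add: h'(1))
      finally have "v - ?u = fibre_diff F i (mat_vec (rk F i) (const_mat (h' (Suc i))) v)"
        by (simp add: fdiff mat_vec_mult fun_diff_def)
      moreover have "mat_vec (rk F i) (const_mat (h' (Suc i))) v \<in> fibre F (Suc i) j"
        using mat_vec_const_fibre[OF h'(2)[of "Suc i"], of v j] Z_fibre[OF v] by (auto simp: fibre_def rk)
      ultimately show "v - ?u \<in> ?Bd" by (auto simp: fibre_boundaries_def)
    qed
  qed
  then show ?thesis by (simp add: homology_dim_def)
qed

section \<open>Generators and linear quotients\<close>

definition wpart :: "(nat \<Rightarrow> nat) \<Rightarrow> nat \<Rightarrow> monomial \<Rightarrow> nat" where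
  "wpart w c t = (\<Sum>i=1..c. w i * Poly_Mapping.lookup t i)"

definition npart :: "nat \<Rightarrow> monomial \<Rightarrow> nat" where
  "npart = wpart (\<lambda>_. 1)"

lemma npart_eq: "npart c t = (\<Sum>i=1..c. Poly_Mapping.lookup t i)"
  by (simp add: npart_def wpart_def)

lemma wpart_add: "wpart w c (s + t) = wpart w c s + wpart w c t"
  by (simp add: wpart_def lookup_add algebra_simps sum.distrib)

lemma npart_add: "npart c (s + t) = npart c s + npart c t"
  by (simp add: npart_def wpart_add)

lemma wpart_single: "wpart w c (Poly_Mapping.single i k) = (if 1 \<le> i \<and> i \<le> c then w i * k else 0)"
proof -
  have "wpart w c (Poly_Mapping.single i k) = (\<Sum>x\<in>{1..c}. if x = i then w i * k else 0)"
    unfolding wpart_def by (intro sum.cong) (auto simp: lookup_single when_def)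
  then show ?thesis by simp
qed

lemma npart_single: "npart c (Poly_Mapping.single i k) = (if 1 \<le> i \<and> i \<le> c then k else 0)"
  by (simp add: npart_def wpart_single)

lemma wpart_zero [simp]: "wpart w c 0 = 0"
  by (simp add: wpart_def)

lemma wpart_mono: "b \<le> c \<Longrightarrow> wpart w b t \<le> wpart w c t"
  unfolding wpart_def by (intro sum_mono2) auto

lemma wpart_eq_wdeg: "Poly_Mapping.keys t \<subseteq> {1..c} \<Longrightarrow> wpart w c t = wdeg w t"
  unfolding wpart_def by (simp add: wdeg_eq_sum[of "{1..c}"])

lemma npart_eq_tdeg: "Poly_Mapping.keys t \<subseteq> {1..c} \<Longrightarrow> npart c t = tdeg t"
  by (simp add: npart_def tdeg_def wpart_eq_wdeg)

lemma wpart_le_wdeg: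
  assumes "t \<in> monomials n"
  shows "wpart w c t \<le> wdeg w t"
proof -
  have "Poly_Mapping.keys t \<subseteq> {1..max c n}" using assms by (force simp: monomials_def)
  then show ?thesis using wpart_mono[of c "max c n" w t] by (simp add: wpart_eq_wdeg)
qed

lemma npart_le_tdeg: "t \<in> monomials n \<Longrightarrow> npart c t \<le> tdeg t"
  by (simp add: npart_def tdeg_def wpart_le_wdeg)

lemma npart_eqI:
  assumes "s \<in> monomials n" "t \<in> monomials n" "\<And>c. c \<in> {1..n} \<Longrightarrow> npart c s = npart c t"
  shows "s = t"
proof (rule poly_mapping_eqI)
  fix i
  show "Poly_Mapping.lookup s i = Poly_Mapping.lookup t i"
  proof (cases "i \<in> {1..n}")
    case True
    then obtain j where j: "i = Suc j" by (cases i) auto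
    have "npart j s = npart j t" using assms(3)[of j] True j by (cases "j = 0") (auto simp: npart_eq)
    then show ?thesis using assms(3)[OF True] by (simp add: j npart_eq)
  next
    case False
    then have "i \<notin> Poly_Mapping.keys s" "i \<notin> Poly_Mapping.keys t" using assms(1,2) by (auto simp: monomials_def)
    then show ?thesis by (simp add: in_keys_iff)
  qed
qed

text \<open>By summation by parts, as the weights decrease.\<close>

lemma wpart_mono_npart:
  assumes w: "weight_vector n w" and le: "\<And>c. c \<le> n \<Longrightarrow> npart c u \<le> npart c t" and c: "c \<le> n"
  shows "wpart w c u \<le> wpart w c t"
proof -
  \<comment> \<open>Strengthened for the induction: the surplus of \<open>t\<close> over
    \<open>u\<close> in the first \<open>c\<close> variables counts with weight at least
    \<open>w c\<close>, and passing to the smaller weight of the next variable weakens this.\<close>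
  have "wpart w c u + w c * npart c t \<le> wpart w c t + w c * npart c u" using c
  proof (induction c)
    case 0
    show ?case by (simp add: wpart_def npart_eq)
  next
    case (Suc c)
    obtain \<delta> where \<delta>: "npart c t = npart c u + \<delta>" using le[of c] Suc.prems by (auto simp: le_iff_add)
    have "wpart w c u + w c * \<delta> \<le> wpart w c t" using Suc by (simp add: \<delta> algebra_simps)
    moreover have "w (Suc c) * \<delta> \<le> w c * \<delta>"
    \<comment> \<open>Nothing relates \<open>w 0\<close> to the weights, but no variable has been
      counted yet and the surplus is 0.\<close>
    proof (cases "c = 0")
      case True
      then have "\<delta> = 0" using \<delta> by (simp add: npart_eq)
      then show ?thesis by simp
    next
      case False
      then have "w (Suc c) \<le> w c" using w Suc.prems by (auto simp: weight_vector_def)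
      then show ?thesis by simp
    qed
    ultimately have "wpart w c u + w (Suc c) * \<delta> \<le> wpart w c t" by linarith
    moreover have "npart (Suc c) v = npart c v + Poly_Mapping.lookup v (Suc c)"
      "wpart w (Suc c) v = wpart w c v + w (Suc c) * Poly_Mapping.lookup v (Suc c)" for v
      by (simp_all add: npart_eq wpart_def)
    ultimately show ?case by (simp add: \<delta> algebra_simps)
  qed
  moreover have "w c * npart c u \<le> w c * npart c t" using le[OF c] by simp
  ultimately show ?thesis by linarith
qed

text \<open>A variable of index \<open>i\<close> is counted by \<open>npart c\<close> for the
  \<open>n + 1 - i\<close> values of \<open>c\<close> from \<open>i\<close> to \<open>n\<close>. At
  fixed total degree a smaller index sum therefore means a larger sum of counts; with the opposite
  inequalities all counts agree.\<close>

lemma npart_eq_of_index_sum: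
  assumes u: "u \<in> monomials n" and t: "t \<in> monomials n"
    and le: "\<And>c. npart c u \<le> npart c t" and deg: "tdeg u = tdeg t"
    and idx: "wdeg (\<lambda>i. i) u \<le> wdeg (\<lambda>i. i) t"
  shows "u = t"
proof -
  have "(\<Sum>c=1..k. \<Sum>i=1..c. f i) + (\<Sum>i=1..k. i * f i) = Suc k * (\<Sum>i=1..k. f i)" for f :: "nat \<Rightarrow> nat" and k
    by (induction k) (simp_all add: algebra_simps)
  from this[of _ n] have id: "(\<Sum>c=1..n. npart c v) + wdeg (\<lambda>i. i) v = Suc n * tdeg v" if "v \<in> monomials n" for v
    using that npart_eq_tdeg[of v n] wdeg_eq_sum[of "{1..n}" v "\<lambda>i. i"]
    by (simp add: npart_eq monomials_def)
  have "(\<Sum>c=1..n. npart c t) \<le> (\<Sum>c=1..n. npart c u)"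
    using id[OF u] id[OF t] deg idx by simp
  then have "npart c u = npart c t" if "c \<in> {1..n}" for c
    using that le sum_strict_mono_ex1[of "{1..n}" "\<lambda>c. npart c u" "\<lambda>c. npart c t"]
    by (metis finite_atLeastAtMost le_neq_implies_less linorder_not_le)
  then show ?thesis by (rule npart_eqI[OF u t])
qed

section \<open>The last variable of a monomial and its removal\<close>

lemma max_var_in_keys: "t \<noteq> 0 \<Longrightarrow> max_var t \<in> Poly_Mapping.keys t"
  by (simp add: max_var_def)

lemma keys_le_max_var: "i \<in> Poly_Mapping.keys t \<Longrightarrow> i \<le> max_var t"
  by (auto simp: max_var_def)

lemma max_var_bounds: "weight_vector n w \<Longrightarrow> t \<in> monomials n \<Longrightarrow> 1 \<le> max_var t \<and> max_var t \<le> n"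
  using max_var_in_keys[of t] unfolding monomials_def weight_vector_def
  by (cases "t = 0") (auto simp: max_var_def[of 0])

lemma keys_max_var: "t \<in> monomials n \<Longrightarrow> Poly_Mapping.keys t \<subseteq> {1..max_var t}"
  using keys_le_max_var by (fastforce simp: monomials_def)

text \<open>Subtraction is truncated, so \<open>dec 0 = 0\<close>; the unit monomial is treated
  separately below.\<close>

definition dec :: "monomial \<Rightarrow> monomial" where
  "dec t = t - Poly_Mapping.single (max_var t) 1"

lemma dec_add: "t \<noteq> 0 \<Longrightarrow> dec t + Poly_Mapping.single (max_var t) 1 = t"
  unfolding dec_def by (rule mdvd_minus_add, subst mdvd_single, erule max_var_in_keys)

lemma wdeg_dec: "t \<noteq> 0 \<Longrightarrow> wdeg w t = wdeg w (dec t) + w (max_var t)"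
  using arg_cong[OF dec_add, of t "wdeg w"] by (simp add: wdeg_add wdeg_single)

lemma tdeg_dec: "t \<noteq> 0 \<Longrightarrow> tdeg t = Suc (tdeg (dec t))"
  using wdeg_dec[of t "\<lambda>_. 1"] by (simp add: tdeg_def)

lemma mdvd_dec: "mdvd (dec t) t"
  by (simp add: dec_def mdvd_def lookup_minus)

lemma keys_mdvd: "mdvd s t \<Longrightarrow> Poly_Mapping.keys s \<subseteq> Poly_Mapping.keys t"
  unfolding mdvd_def in_keys_iff[abs_def] subset_iff in_keys_iff by (metis le_zero_eq)

lemma dec_monomials: "t \<in> monomials n \<Longrightarrow> dec t \<in> monomials n"
  using keys_mdvd[OF mdvd_dec, of t] by (auto simp: monomials_def)

lemma max_var_dec: "max_var (dec t) \<le> max_var t" if "t \<in> monomials n" "weight_vector n w"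
proof (cases "dec t = 0")
  case True
  then show ?thesis using max_var_bounds[OF that(2,1)] by (simp add: max_var_def[of 0])
next
  case False
  then show ?thesis using max_var_in_keys[OF False] keys_mdvd[OF mdvd_dec, of t] keys_le_max_var by blast
qed

lemma wpart_dec:
  assumes "t \<noteq> 0"
  shows "c < max_var t \<Longrightarrow> wpart w c (dec t) = wpart w c t"
    "t \<in> monomials n \<Longrightarrow> max_var t \<le> c \<Longrightarrow> wpart w c (dec t) = wdeg w (dec t)"
proof -
  show "wpart w c (dec t) = wpart w c t" if "c < max_var t"
    using arg_cong[OF dec_add[OF assms], of "wpart w c"] that by (simp add: wpart_add wpart_single)
  show "wpart w c (dec t) = wdeg w (dec t)" if "t \<in> monomials n" "max_var t \<le> c"
  proof (rule wpart_eq_wdeg)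
    have "Poly_Mapping.keys (dec t) \<subseteq> {1..max_var t}"
      using keys_mdvd[OF mdvd_dec, of t] keys_max_var[OF that(1)] by blast
    then show "Poly_Mapping.keys (dec t) \<subseteq> {1..c}" using that(2) by auto
  qed
qed

section \<open>Monomials of the ideal and minimal generators\<close>

definition stable_mons :: "nat \<Rightarrow> (nat \<Rightarrow> nat) \<Rightarrow> monomial \<Rightarrow> monomial set" where
  "stable_mons n w m = {t \<in> monomials n. \<forall>c\<le>n. wpart w c m \<le> wpart w c t}"

text \<open>The last variable is the lightest, so if its removal leads below the degree of
  \<open>m\<close>, the removal of any other variable does so too. The alternative
  \<open>t = 0\<close> serves the case \<open>m = 0\<close>, where the ideal is the whole ring and
  no degree is below that of \<open>m\<close>.\<close>

definition stable_gens :: "nat \<Rightarrow> (nat \<Rightarrow> nat) \<Rightarrow> monomial \<Rightarrow> monomial set" where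
  "stable_gens n w m = {t \<in> stable_mons n w m. t = 0 \<or> wdeg w (dec t) < wdeg w m}"

text \<open>Pairs are compared lexicographically; the index sum breaks ties in total degree in
  favour of earlier variables.\<close>

definition gen_rank :: "monomial \<Rightarrow> nat \<times> nat" where
  "gen_rank t = (tdeg t, wdeg (\<lambda>i. i) t)"

context
  fixes n w m
  assumes w: "weight_vector n w" and m: "m \<in> monomials n"
begin

lemma stable_mons_wdeg: "t \<in> stable_mons n w m \<Longrightarrow> wdeg w m \<le> wdeg w t"
  using m wpart_eq_wdeg[of m n w] wpart_eq_wdeg[of t n w] by (auto simp: stable_mons_def monomials_def)

text \<open>Partial degrees before the last variable do not change, and those from it on become the
  full degree, which suffices by assumption.\<close>

lemma stable_mons_dec:
  assumes t: "t \<in> stable_mons n w m" "t \<noteq> 0" "wdeg w m \<le> wdeg w (dec t)"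
  shows "dec t \<in> stable_mons n w m"
proof -
  have tm: "t \<in> monomials n" using t(1) by (simp add: stable_mons_def)
  have "wpart w c m \<le> wpart w c (dec t)" if "c \<le> n" for c
  proof (cases "c < max_var t")
    case True
    then show ?thesis using wpart_dec(1)[OF t(2)] t(1) that by (simp add: stable_mons_def)
  next
    case False
    then show ?thesis using wpart_dec(2)[OF t(2) tm] t(3) wpart_le_wdeg[OF m, of w c] by simp
  qed
  then show ?thesis using dec_monomials[OF tm] by (simp add: stable_mons_def)
qed

lemma stable_mons_up: "u \<in> stable_mons n w m \<Longrightarrow> t \<in> monomials n \<Longrightarrow> mdvd u t \<Longrightarrow> t \<in> stable_mons n w m"
  unfolding stable_mons_def mdvd_iff_add by (auto simp: wpart_add intro: trans_le_add2)

lemma stable_gens_divide: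
  assumes "t \<in> stable_mons n w m"
  shows "\<exists>u\<in>stable_gens n w m. mdvd u t"
  using assms
proof (induction "tdeg t" arbitrary: t rule: less_induct)
  case less
  show ?case
  proof (cases "t \<in> stable_gens n w m")
    case True
    then show ?thesis by (intro bexI[of _ t]) simp
  next
    case False
    then have t: "t \<noteq> 0" "wdeg w m \<le> wdeg w (dec t)" using less.prems by (auto simp: stable_gens_def)
    obtain u where "u \<in> stable_gens n w m" "mdvd u (dec t)"
      using less.hyps[OF _ stable_mons_dec[OF less.prems t]] tdeg_dec[OF t(1)] by auto
    then show ?thesis using mdvd_trans[OF _ mdvd_dec] by blast
  qed
qed

lemma stable_mons_iff: "t \<in> monomials n \<Longrightarrow> (\<exists>u\<in>stable_gens n w m. mdvd u t) \<longleftrightarrow> t \<in> stable_mons n w m"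
  using stable_gens_divide stable_mons_up by (auto simp: stable_gens_def)

text \<open>Exchange the last variable of \<open>g\<close> for the earlier variable
  \<open>i\<close>. The result \<open>h\<close> stays in the ideal because its degree does not drop,
  and it precedes \<open>g\<close>: same total degree, smaller index sum. A generator dividing
  \<open>h\<close> precedes \<open>g\<close> all the more.\<close>

lemma stable_gens_earlier:
  assumes g: "g \<in> stable_gens n w m" and i: "1 \<le> i" "i < max_var g"
  shows "\<exists>u\<in>stable_gens n w m. mdvd u (Poly_Mapping.single i 1 + g) \<and> gen_rank u < gen_rank g"
proof -
  define b where "b = max_var g"
  define h where "h = Poly_Mapping.single i 1 + dec g"
  have gm: "g \<in> monomials n" "g \<in> stable_mons n w m" using g by (auto simp: stable_gens_def stable_mons_def)
  have g0: "g \<noteq> 0" using i by (auto simp: max_var_def)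
  have b: "b \<le> n" using max_var_bounds[OF w gm(1)] by (simp add: b_def)
  have wi: "w b \<le> w i" using w i b by (auto simp: weight_vector_def b_def)
  have hm: "h \<in> monomials n"
    using dec_monomials[OF gm(1)] i b Poly_Mapping.keys_add[of "Poly_Mapping.single i 1" "dec g"]
    by (auto simp: h_def monomials_def b_def)
  have hd: "mdvd h (Poly_Mapping.single i 1 + g)"
    unfolding h_def using mdvd_dec[of g] by (auto simp: mdvd_def lookup_add)
  have "wpart w c m \<le> wpart w c h" if c: "c \<le> n" for c
  proof (cases "c < b")
    case True
    then show ?thesis
      using wpart_dec(1)[OF g0, of c w] gm(2) c by (auto simp: stable_mons_def h_def wpart_add b_def intro: trans_le_add2)
  next
    case False
    then have "wpart w c h = w i + wdeg w (dec g)"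
      using wpart_dec(2)[OF g0 gm(1), of c w] i by (simp add: h_def wpart_add wpart_single b_def)
    also have "\<dots> \<ge> wdeg w g" using wdeg_dec[OF g0, of w] wi by (simp add: b_def)
    finally show ?thesis using stable_mons_wdeg[OF gm(2)] wpart_le_wdeg[OF m, of w c] by linarith
  qed
  then have "h \<in> stable_mons n w m" using hm by (simp add: stable_mons_def)
  then obtain u where u: "u \<in> stable_gens n w m" "mdvd u h" using stable_gens_divide by blast
  obtain r where r: "h = r + u" using u(2) by (auto simp: mdvd_iff_add)
  have th: "tdeg h = tdeg g" using tdeg_dec[OF g0] by (simp add: h_def tdeg_add)
  have "gen_rank u < gen_rank g"
  proof (cases "r = 0")
    case True
    then have "u = h" using r by simp
    moreover from this have "wdeg (\<lambda>i. i) u = i + wdeg (\<lambda>i. i) (dec g)"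
      by (simp add: h_def wdeg_add wdeg_single)
    ultimately show ?thesis
      using th wdeg_dec[OF g0, of "\<lambda>i. i"] i(2) by (simp add: gen_rank_def)
  next
    case False
    then have "tdeg r > 0" by (simp add: zero_less_iff_neq_zero)
    then show ?thesis using th r by (simp add: gen_rank_def tdeg_add)
  qed
  then show ?thesis using u(1) mdvd_trans[OF u(2) hd] by blast
qed

text \<open>If \<open>\<alpha>\<close> has no variable before the last one of \<open>g\<close>, the
  counts of \<open>u\<close> are bounded by those of \<open>g\<close>: before that variable by
  divisibility, from it on by total degree. At equal total degree the tie break gives
  \<open>u = g\<close>. At smaller total degree \<open>u\<close> is even bounded by
  \<open>dec g\<close>, which would put \<open>dec g\<close> into the ideal although its degree is
  too small.\<close>

lemma stable_gens_colon:
  assumes g: "g \<in> stable_gens n w m" and u: "u \<in> stable_gens n w m"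
    and rank: "gen_rank u \<le> gen_rank g" and ne: "u \<noteq> g" and dvd: "mdvd u (\<alpha> + g)"
  shows "Poly_Mapping.keys \<alpha> \<inter> {1..<max_var g} \<noteq> {}"
proof
  assume \<alpha>: "Poly_Mapping.keys \<alpha> \<inter> {1..<max_var g} = {}"
  have gm: "g \<in> monomials n" "g \<in> stable_mons n w m" and um: "u \<in> monomials n" "u \<in> stable_mons n w m"
    using g u by (auto simp: stable_gens_def stable_mons_def)
  have td: "tdeg u \<le> tdeg g" using rank by (auto simp: gen_rank_def less_eq_prod_def)
  have low: "npart c u \<le> npart c g" if "c < max_var g" for c
  proof -
    have "npart c u \<le> npart c (\<alpha> + g)"
      using dvd by (auto simp: npart_eq mdvd_def intro: sum_mono)
    also have "npart c \<alpha> = 0"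
      unfolding npart_eq using \<alpha> that by (intro sum.neutral) (auto simp: in_keys_iff disjoint_iff)
    then have "npart c (\<alpha> + g) = npart c g" by (simp add: npart_add)
    finally show ?thesis .
  qed
  have high: "npart c g = tdeg g" if "\<not> c < max_var g" for c
    using keys_max_var[OF gm(1)] that by (intro npart_eq_tdeg) auto
  show False
  proof (cases "tdeg u = tdeg g")
    case True
    have "npart c u \<le> npart c g" for c
      using low[of c] high[of c] npart_le_tdeg[OF um(1), of c] td by (cases "c < max_var g") auto
    then have "u = g"
      using rank True by (intro npart_eq_of_index_sum[OF um(1) gm(1)]) (auto simp: gen_rank_def less_eq_prod_def)
    then show False using ne by simp
  next
    case False
    then have lt: "tdeg u < tdeg g" using td by simp
    then have g0: "g \<noteq> 0" by auto
    have "npart c u \<le> npart c (dec g)" for c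
    proof (cases "c < max_var g")
      case True
      then show ?thesis using low[OF True] wpart_dec(1)[OF g0 True] by (simp add: npart_def)
    next
      case False
      then have "npart c (dec g) = tdeg (dec g)"
        using wpart_dec(2)[OF g0 gm(1)] by (simp add: npart_def tdeg_def)
      then show ?thesis using lt tdeg_dec[OF g0] npart_le_tdeg[OF um(1), of c] by simp
    qed
    \<comment> \<open>Counts are converted to weighted degrees here, by means of the decreasing
      weights.\<close>
    then have "wpart w c u \<le> wpart w c (dec g)" if "c \<le> n" for c
      using wpart_mono_npart[OF w _ that] by blast
    then have "dec g \<in> stable_mons n w m"
      using um(2) dec_monomials[OF gm(1)] unfolding stable_mons_def by (auto intro: le_trans)
    then show False using stable_mons_wdeg g g0 by (force simp: stable_gens_def)
  qed
qed

lemma finite_wdeg_le: "finite {t \<in> monomials n. wdeg w t \<le> A}"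
proof -
  let ?S = "{t \<in> monomials n. wdeg w t \<le> A}"
  have "Poly_Mapping.lookup ` ?S \<subseteq> {f. \<forall>i. (i \<in> {1..n} \<longrightarrow> f i \<in> {..A}) \<and> (i \<notin> {1..n} \<longrightarrow> f i = 0)}"
  proof clarify
    fix t i assume t: "t \<in> monomials n" "wdeg w t \<le> A"
    have "Poly_Mapping.lookup t i \<le> A" if i: "i \<in> {1..n}"
    proof -
      have "w i * Poly_Mapping.lookup t i \<le> wdeg w t"
      proof -
        have "w i * Poly_Mapping.lookup t i \<le> (\<Sum>i\<in>{1..n}. w i * Poly_Mapping.lookup t i)"
          using i by (intro member_le_sum) auto
        then show ?thesis using wdeg_eq_sum[of "{1..n}" t w] t(1) by (simp add: monomials_def)
      qed
      moreover have "0 < w i" using w i by (simp add: weight_vector_def)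
      then have "Poly_Mapping.lookup t i \<le> w i * Poly_Mapping.lookup t i" by (cases "w i") auto
      ultimately show ?thesis using t(2) by linarith
    qed
    moreover have "Poly_Mapping.lookup t i = 0" if "i \<notin> {1..n}"
      using t(1) that by (auto simp: monomials_def in_keys_iff)
    ultimately show "(i \<in> {1..n} \<longrightarrow> Poly_Mapping.lookup t i \<in> {..A}) \<and> (i \<notin> {1..n} \<longrightarrow> Poly_Mapping.lookup t i = 0)"
      by simp
  qed
  then have "finite (Poly_Mapping.lookup ` ?S)"
    using finite_set_of_finite_funs[of "{1..n}" "{..A}" 0] finite_subset by blast
  moreover have "inj_on Poly_Mapping.lookup ?S"
    by (rule inj_onI) (simp only: poly_mapping_eq_iff)
  ultimately show ?thesis by (rule finite_imageD)
qed

text \<open>For the upper bound: without its last variable a generator other than 1 has degree at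
  most \<open>wdeg w m - 1\<close>, and that variable weighs at most \<open>w 1\<close>.\<close>

lemma stable_gens_wdeg:
  assumes "t \<in> stable_gens n w m"
  shows "t \<in> monomials n" "wdeg w m \<le> wdeg w t" "wdeg w t \<le> wdeg w m + w 1 - 1"
proof -
  have t: "t \<in> stable_mons n w m" using assms by (simp add: stable_gens_def)
  then show tm: "t \<in> monomials n" "wdeg w m \<le> wdeg w t" using stable_mons_wdeg by (auto simp: stable_mons_def)
  have "w (max_var t) \<le> w 1" "0 < w 1" using w max_var_bounds[OF w tm(1)] by (auto simp: weight_vector_def)
  then show "wdeg w t \<le> wdeg w m + w 1 - 1"
    using assms wdeg_dec[of t w] by (cases "t = 0") (auto simp: stable_gens_def)
qed

lemma finite_stable_gens: "finite (stable_gens n w m)"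
proof (rule finite_subset)
  show "stable_gens n w m \<subseteq> {t \<in> monomials n. wdeg w t \<le> wdeg w m + w 1 - 1}"
    by (intro subsetI CollectI conjI stable_gens_wdeg(1,3))
  show "finite {t \<in> monomials n. wdeg w t \<le> wdeg w m + w 1 - 1}" by (rule finite_wdeg_le)
qed

theorem stable_gens_strand_res:
  "\<exists>D. strand_res (ek_basis (\<lambda>u. {1..<max_var u}) (stable_gens n w m)) ek_hdeg ek_mdeg None
    (D :: ek_label \<Rightarrow> ek_label \<Rightarrow> 'k::field) {\<alpha>. \<exists>u\<in>stable_gens n w m. mdvd u \<alpha>}"
proof -
  obtain ys where ys: "set ys = stable_gens n w m" "distinct ys"
    using finite_distinct_list[OF finite_stable_gens] by blast
  \<comment> \<open>Ties in \<open>gen_rank\<close> may be listed in any order, since the colon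
    argument compares ranks with \<open>\<le>\<close> and the exchange yields a strictly smaller
    one.\<close>
  define xs where "xs = sort_key gen_rank ys"
  have xs: "set xs = stable_gens n w m" "distinct xs" "sorted (map gen_rank xs)"
    using ys by (auto simp: xs_def)
  have rank: "gen_rank (xs ! l) \<le> gen_rank (xs ! k)" if "l \<le> k" "k < length xs" for l k
    using sorted_nth_mono[OF xs(3) that(1)] that by simp
  have mem: "xs ! k \<in> stable_gens n w m" if "k < length xs" for k using xs(1) that by (metis nth_mem)
  show ?thesis unfolding xs(1)[symmetric]
  proof (rule linear_quotients_strand_res[OF xs(2)])
    show "tdeg (xs ! l) \<le> tdeg (xs ! k)" if "l < k" "k < length xs" for k l
      using rank[of l k] that by (auto simp: gen_rank_def less_eq_prod_def)
    show "(\<exists>l<k. mdvd (xs ! l) (\<alpha> + xs ! k)) \<longleftrightarrow> Poly_Mapping.keys \<alpha> \<inter> {1..<max_var (xs ! k)} \<noteq> {}"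
      if k: "k < length xs" for k \<alpha>
    proof
      assume "\<exists>l<k. mdvd (xs ! l) (\<alpha> + xs ! k)"
      then obtain l where l: "l < k" "mdvd (xs ! l) (\<alpha> + xs ! k)" by blast
      moreover have "xs ! l \<noteq> xs ! k" using xs(2) k l(1) by (simp add: nth_eq_iff_index_eq)
      ultimately show "Poly_Mapping.keys \<alpha> \<inter> {1..<max_var (xs ! k)} \<noteq> {}"
        using k by (intro stable_gens_colon[OF mem[OF k] mem[of l] rank]) auto
    next
      assume "Poly_Mapping.keys \<alpha> \<inter> {1..<max_var (xs ! k)} \<noteq> {}"
      then obtain i where i: "i \<in> Poly_Mapping.keys \<alpha>" "1 \<le> i" "i < max_var (xs ! k)" by auto
      obtain u where u: "u \<in> stable_gens n w m" "mdvd u (Poly_Mapping.single i 1 + xs ! k)"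
        "gen_rank u < gen_rank (xs ! k)" using stable_gens_earlier[OF mem[OF k] i(2,3)] by blast
      obtain l where l: "l < length xs" "u = xs ! l" using u(1) xs(1) by (metis in_set_conv_nth)
      have "l < k" using rank[of k l] l u(3) by (meson leD linorder_not_less)
      moreover have "mdvd (Poly_Mapping.single i 1 + xs ! k) (\<alpha> + xs ! k)"
        unfolding mdvd_add_cancel mdvd_single by (rule i(1))
      ultimately show "\<exists>l<k. mdvd (xs ! l) (\<alpha> + xs ! k)" using u(2) l(2) mdvd_trans by blast
    qed
  qed simp
qed

end

section \<open>Monomials counted by the weighted Catalan diagram\<close>

lemma length_filter_concat_replicate:
  "length (filter P (concat (map (\<lambda>i. replicate (f i) i) xs))) = sum_list (map (\<lambda>i. if P i then f i else 0) xs)"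
  by (induction xs) auto

lemma sorted_concat_replicate:
  "sorted xs \<Longrightarrow> sorted (concat (map (\<lambda>i. replicate (f i) (i::nat)) xs))"
  by (induction xs) (auto simp: sorted_append sorted_replicate)

lemma sorted_var_list: "sorted (var_list \<mu>)"
  by (simp add: var_list_def sorted_concat_replicate)

lemma length_filter_var_list:
  "length (filter P (var_list \<mu>)) = (\<Sum>i\<in>Poly_Mapping.keys \<mu>. if P i then Poly_Mapping.lookup \<mu> i else 0)"
  by (simp add: var_list_def length_filter_concat_replicate sum_list_distinct_conv_sum_set)

lemma length_var_list: "length (var_list \<mu>) = tdeg \<mu>"
  using length_filter_var_list[of "\<lambda>_. True" \<mu>] by (simp add: tdeg_def wdeg_def)

lemma length_filter_less_var_list:
  assumes "\<mu> \<in> monomials n" "1 \<le> b"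
  shows "length (filter (\<lambda>x. x < b) (var_list \<mu>)) = npart (b - 1) \<mu>"
proof -
  have "(\<Sum>i\<in>Poly_Mapping.keys \<mu>. if i < b then Poly_Mapping.lookup \<mu> i else 0) =
      (\<Sum>i\<in>Poly_Mapping.keys \<mu> \<inter> {1..b-1}. Poly_Mapping.lookup \<mu> i)"
    using assms by (intro sum.mono_neutral_cong_right) (auto simp: monomials_def)
  also have "\<dots> = npart (b - 1) \<mu>"
    unfolding npart_eq by (intro sum.mono_neutral_left) (auto simp: in_keys_iff)
  finally show ?thesis by (simp add: length_filter_var_list)
qed

text \<open>The entries below \<open>b\<close> form an initial segment of a sorted list; position
  \<open>p\<close>, counted from 0, lies behind it exactly when the segment has at most
  \<open>p\<close> entries.\<close>

lemma sorted_nth_ge_iff: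
  "sorted xs \<Longrightarrow> p < length xs \<Longrightarrow> b \<le> xs ! p \<longleftrightarrow> length (filter (\<lambda>x. x < b) xs) \<le> p" for b :: nat
proof (induction xs arbitrary: p)
  case (Cons x xs)
  show ?case
  proof (cases "x < b")
    case True
    then show ?thesis using Cons by (cases p) auto
  next
    case False
    then have "\<forall>y\<in>set (x # xs). b \<le> y" using Cons.prems(1) by auto
    moreover have "(x # xs) ! p \<in> set (x # xs)" using Cons.prems(2) by (rule nth_mem)
    ultimately have "filter (\<lambda>y. y < b) (x # xs) = []" "b \<le> (x # xs) ! p"
      by (auto simp: filter_empty_conv simp del: nth_Cons_Suc)
    then show ?thesis by simp
  qed
qed simp

lemma keys_sum_list_single: "Poly_Mapping.keys (\<Sum>i\<leftarrow>xs. Poly_Mapping.single i (1::nat)) = set xs"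
proof (induction xs)
  case (Cons x xs)
  have "i \<in> Poly_Mapping.keys (Poly_Mapping.single x (1::nat) + t) \<longleftrightarrow> i = x \<or> i \<in> Poly_Mapping.keys t" for i t
    by (auto simp: in_keys_iff lookup_add lookup_single when_def)
  then show ?case using Cons by auto
qed simp

text \<open>Truncation keeps the first \<open>p + 1\<close> letters; in a sorted word the last of
  them, at position \<open>p\<close> counted from 0, is the largest.\<close>

lemma max_var_trunc:
  assumes "p < tdeg \<mu>"
  shows "max_var (trunc (p + 1) \<mu>) = var_list \<mu> ! p"
proof -
  let ?xs = "var_list \<mu>"
  have p: "p < length ?xs" using assms by (simp add: length_var_list)
  have keys: "Poly_Mapping.keys (trunc (p + 1) \<mu>) = set (take (Suc p) ?xs)"
    unfolding trunc_def keys_sum_list_single by simp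
  have mem: "?xs ! p \<in> set (take (Suc p) ?xs)" using p by (simp add: take_Suc_conv_app_nth)
  have "y \<le> ?xs ! p" if "y \<in> set (take (Suc p) ?xs)" for y
    using that p sorted_nth_mono[OF sorted_var_list] by (auto simp: in_set_conv_nth)
  then have "Max (set (take (Suc p) ?xs)) = ?xs ! p" using mem by (intro Max_eqI) auto
  moreover have "trunc (p + 1) \<mu> \<noteq> 0" using keys mem by fastforce
  ultimately show ?thesis unfolding max_var_def keys by simp
qed

lemma lookup_psi_exp: "Poly_Mapping.lookup (psi_exp w t) i = w i * Poly_Mapping.lookup t i"
  by (auto simp: psi_exp_def lookup_sum lookup_single when_def in_keys_iff)

lemma npart_psi_exp: "npart c (psi_exp w t) = wpart w c t"
  by (simp add: npart_eq wpart_def lookup_psi_exp)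

lemma psi_exp_monomials: "t \<in> monomials n \<Longrightarrow> psi_exp w t \<in> monomials n"
  unfolding monomials_def by (simp add: in_keys_iff lookup_psi_exp subset_iff)

lemma tdeg_psi_exp:
  assumes "t \<in> monomials n"
  shows "tdeg (psi_exp w t) = wdeg w t"
  using npart_psi_exp[of n w t] npart_eq_tdeg[of "psi_exp w t" n] wpart_eq_wdeg[of t n w]
    assms psi_exp_monomials[OF assms, of w] by (simp add: monomials_def)

text \<open>What the entry \<open>(a, b)\<close> counts, also in degrees below that of
  \<open>m\<close>. There domination can be required only up to the degree of \<open>t\<close>
  itself, whence the minimum.\<close>

definition catalan_mons :: "nat \<Rightarrow> (nat \<Rightarrow> nat) \<Rightarrow> monomial \<Rightarrow> nat \<Rightarrow> nat \<Rightarrow> monomial set" where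
  "catalan_mons n w m a b = {t \<in> monomials n. wdeg w t = a \<and> max_var t = b \<and>
     (t = 0 \<or> wdeg w (dec t) < wdeg w m) \<and> (\<forall>c\<le>n. min (wpart w c m) (wdeg w t) \<le> wpart w c t)}"

context
  fixes n w m
  assumes w: "weight_vector n w" and m: "m \<in> monomials n"
begin

text \<open>The letter at position \<open>p\<close> of \<open>\<psi>(m)\<close> has index at least
  \<open>b\<close> iff all letters of smaller index, \<open>wpart w (b - 1) m\<close> in number,
  come before it.\<close>

lemma le_max_var_trunc_iff:
  assumes "p < wdeg w m" "1 \<le> b"
  shows "b \<le> max_var (trunc (p + 1) (psi_exp w m)) \<longleftrightarrow> wpart w (b - 1) m \<le> p"
proof -
  have p: "p < tdeg (psi_exp w m)" using assms(1) by (simp add: tdeg_psi_exp[OF m])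
  show ?thesis
    unfolding max_var_trunc[OF p]
    using sorted_nth_ge_iff[OF sorted_var_list, of p "psi_exp w m" b] p
      length_filter_less_var_list[OF psi_exp_monomials[OF m] assms(2), of w]
    by (simp add: length_var_list npart_psi_exp)
qed

lemma finite_catalan_mons: "finite (catalan_mons n w m a b)"
  by (rule finite_subset[OF _ finite_wdeg_le[OF w m, of a]]) (auto simp: catalan_mons_def)

text \<open>The recursion of the diagram in terms of monomials. From the last variable on, the
  partial degree is the full degree and the condition is void. Before it the two partial degrees
  agree, and the extra inequality makes the caps by \<open>wdeg w t\<close> and
  \<open>wdeg w (dec t)\<close> inactive.\<close>

lemma domination_step:
  assumes t: "t \<in> monomials n" "t \<noteq> 0"
  shows "(\<forall>c\<le>n. min (wpart w c m) (wdeg w t) \<le> wpart w c t) \<longleftrightarrow>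
    (\<forall>c\<le>n. min (wpart w c m) (wdeg w (dec t)) \<le> wpart w c (dec t)) \<and>
    wpart w (max_var t - 1) m \<le> wdeg w (dec t)"
proof -
  let ?b = "max_var t"
  have b: "1 \<le> ?b" "?b \<le> n" using max_var_bounds[OF w t(1)] by auto
  have deg: "wdeg w (dec t) < wdeg w t" using wdeg_dec[OF t(2), of w] w b by (auto simp: weight_vector_def)
  have low: "wpart w c (dec t) = wpart w c t" if "c < ?b" for c by (rule wpart_dec(1)[OF t(2) that])
  have high: "wpart w c (dec t) = wdeg w (dec t)" if "\<not> c < ?b" for c using wpart_dec(2)[OF t(2,1)] that by simp
  have high': "wpart w c t = wdeg w t" if "\<not> c < ?b" for c
    using keys_max_var[OF t(1)] that by (intro wpart_eq_wdeg) auto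
  show ?thesis
  proof (intro iffI conjI allI impI)
    assume A: "\<forall>c\<le>n. min (wpart w c m) (wdeg w t) \<le> wpart w c t"
    show "wpart w (?b - 1) m \<le> wdeg w (dec t)"
    proof -
      have "wpart w (?b - 1) t \<le> wdeg w (dec t)"
        using low[of "?b - 1"] b wpart_le_wdeg[OF dec_monomials[OF t(1)], of w "?b - 1"] by simp
      moreover have "min (wpart w (?b - 1) m) (wdeg w t) \<le> wpart w (?b - 1) t" using A b by simp
      ultimately show ?thesis using deg by simp
    qed
    fix c assume c: "c \<le> n"
    show "min (wpart w c m) (wdeg w (dec t)) \<le> wpart w c (dec t)"
    proof (cases "c < ?b")
      case True
      have "min (wpart w c m) (wdeg w t) \<le> wpart w c t" using A c by blast
      then show ?thesis using low[OF True] deg by simp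
    next
      case False
      then show ?thesis using high by simp
    qed
  next
    assume A: "(\<forall>c\<le>n. min (wpart w c m) (wdeg w (dec t)) \<le> wpart w c (dec t)) \<and>
      wpart w (?b - 1) m \<le> wdeg w (dec t)"
    fix c assume c: "c \<le> n"
    show "min (wpart w c m) (wdeg w t) \<le> wpart w c t"
    proof (cases "c < ?b")
      case True
      have "wpart w c m \<le> wpart w (?b - 1) m" using True by (intro wpart_mono) auto
      moreover have "min (wpart w c m) (wdeg w (dec t)) \<le> wpart w c (dec t)" using A c by blast
      ultimately show ?thesis using A low[OF True] by simp
    next
      case False
      then show ?thesis using high' by simp
    qed
  qed
qed

lemma dec_add_single:
  assumes "s \<in> monomials n" "max_var s \<le> b" "1 \<le> b"
  shows "max_var (s + Poly_Mapping.single b 1) = b" "dec (s + Poly_Mapping.single b 1) = s"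
proof -
  let ?t = "s + Poly_Mapping.single b 1"
  have keys: "Poly_Mapping.keys ?t = insert b (Poly_Mapping.keys s)"
    by (auto simp: in_keys_iff lookup_add lookup_single when_def split: if_splits)
  have "y \<le> b" if "y \<in> insert b (Poly_Mapping.keys s)" for y
    using that keys_le_max_var[of y s] assms(2) by auto
  then have "Max (insert b (Poly_Mapping.keys s)) = b" by (intro Max_eqI) auto
  moreover have "?t \<noteq> 0" using keys by (metis insert_not_empty keys_zero)
  ultimately show "max_var ?t = b" unfolding max_var_def keys by simp
  then show "dec ?t = s" by (simp add: dec_def)
qed

text \<open>Removing the last variable \<open>b\<close> maps the monomials of entry
  \<open>(a, b)\<close> bijectively onto those of the entries \<open>(a - w b, k)\<close> with
  \<open>k \<le> b\<close>, which gives the sum in the recursion; if a side condition of the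
  recursion fails, there is no such monomial.\<close>

theorem catalan_eq_card:
  assumes "1 \<le> b" "b \<le> n"
  shows "catalan w m a b = card (catalan_mons n w m a b)"
  using assms
proof (induction a arbitrary: b rule: less_induct)
  case (less a)
  have wb: "0 < w b" using w less.prems by (auto simp: weight_vector_def)
  have mv0: "max_var 0 = 1" by (simp add: max_var_def)
  show ?case
  proof (cases "a = 0 \<and> b = 1")
    case True
    \<comment> \<open>The initial entry counts the unit monomial, placed in column 1 by the
      convention \<open>max_var 0 = 1\<close>.\<close>
    have "catalan_mons n w m 0 1 = {0}"
    proof (intro equalityI subsetI)
      fix t assume t: "t \<in> catalan_mons n w m 0 1"
      show "t \<in> {0}"
      proof (rule ccontr)
        assume "t \<notin> {0}"
        then have t0: "t \<noteq> 0" by simp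
        have "0 < w (max_var t)"
          using w max_var_bounds[OF w, of t] t by (auto simp: weight_vector_def catalan_mons_def)
        then show False using wdeg_dec[OF t0, of w] t by (simp add: catalan_mons_def)
      qed
    qed (auto simp: catalan_mons_def mv0 monomials_def)
    then show ?thesis using True by (subst catalan.simps) simp
  next
    case False
    have nz: "t \<noteq> 0" if "t \<in> catalan_mons n w m a b" for t
      using that False mv0 by (auto simp: catalan_mons_def)
    have cm: "t \<in> monomials n" "max_var t = b" "a = wdeg w (dec t) + w b" "wdeg w (dec t) < wdeg w m"
      "wpart w (b - 1) m \<le> wdeg w (dec t)"
      "\<forall>c\<le>n. min (wpart w c m) (wdeg w (dec t)) \<le> wpart w c (dec t)"
      if "t \<in> catalan_mons n w m a b" for t
      using that nz[OF that] wdeg_dec[OF nz[OF that], of w] domination_step[of t]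
      by (auto simp: catalan_mons_def)
    let ?c = "w b \<le> a \<and> a - w b < wdeg w m \<and> wpart w (b - 1) m \<le> a - w b"
    have rec: "catalan w m a b = (if ?c then (\<Sum>k=1..b. catalan w m (a - w b) k) else 0)"
      by (subst catalan.simps) (use False wb less.prems le_max_var_trunc_iff in auto)
    show ?thesis
    proof (cases ?c)
      case c: True
      let ?f = "\<lambda>t :: monomial. t + Poly_Mapping.single b 1"
      have "catalan_mons n w m a b = ?f ` (\<Union>k\<in>{1..b}. catalan_mons n w m (a - w b) k)"
      proof (intro equalityI subsetI)
        fix t assume t: "t \<in> catalan_mons n w m a b"
        have "wdeg w (dec t) = 0 \<or> dec t = 0 \<or> wdeg w (dec (dec t)) < wdeg w m"
          using wdeg_dec[of "dec t" w] cm(4)[OF t] by (cases "dec t = 0") auto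
        moreover have "wdeg w (dec t) < wdeg w m" by (rule cm(4)[OF t])
        moreover have "dec t = 0 \<or> wdeg w (dec (dec t)) < wdeg w m"
          using wdeg_dec[of "dec t" w] cm(4)[OF t] by (cases "dec t = 0") auto
        ultimately have "dec t \<in> catalan_mons n w m (a - w b) (max_var (dec t))"
          using cm[OF t] dec_monomials[of t n] by (simp add: catalan_mons_def)
        moreover have "max_var (dec t) \<in> {1..b}"
          using max_var_dec[OF cm(1)[OF t] w] cm(2)[OF t] max_var_bounds[OF w dec_monomials[OF cm(1)[OF t]]] by simp
        moreover have "t = ?f (dec t)" using dec_add[OF nz[OF t]] cm(2)[OF t] by simp
        ultimately show "t \<in> ?f ` (\<Union>k\<in>{1..b}. catalan_mons n w m (a - w b) k)" by blast
      next
        fix t assume "t \<in> ?f ` (\<Union>k\<in>{1..b}. catalan_mons n w m (a - w b) k)"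
        then obtain s k where s: "t = ?f s" "s \<in> catalan_mons n w m (a - w b) k" "k \<in> {1..b}" by blast
        have sm: "s \<in> monomials n" "max_var s \<le> b" "wdeg w s = a - w b"
          "\<forall>c\<le>n. min (wpart w c m) (wdeg w s) \<le> wpart w c s"
          using s by (auto simp: catalan_mons_def)
        have t: "max_var t = b" "dec t = s" using dec_add_single[OF sm(1,2) less.prems(1)] s(1) by auto
        have t0: "t \<noteq> 0" unfolding s(1)
          by (metis add_is_0 lookup_add lookup_single_eq lookup_zero one_neq_zero)
        have tm: "t \<in> monomials n"
          using s(1) sm(1) less.prems Poly_Mapping.keys_add[of s "Poly_Mapping.single b 1"] by (auto simp: monomials_def)
        show "t \<in> catalan_mons n w m a b"
          using domination_step[OF tm t0] t sm c tm wdeg_dec[OF t0, of w] by (simp add: catalan_mons_def)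
      qed
      moreover have "inj_on ?f A" for A by (simp add: inj_on_def)
      ultimately have "card (catalan_mons n w m a b) = card (\<Union>k\<in>{1..b}. catalan_mons n w m (a - w b) k)"
        by (simp add: card_image)
      also have "\<dots> = (\<Sum>k=1..b. card (catalan_mons n w m (a - w b) k))"
        by (rule card_UN_disjoint) (auto simp: finite_catalan_mons, auto simp: catalan_mons_def)
      also have "\<dots> = (\<Sum>k=1..b. catalan w m (a - w b) k)"
        by (intro sum.cong refl less.IH[symmetric]) (use c wb less.prems in auto)
      finally show ?thesis using rec c by simp
    next
      case c: False
      have "catalan_mons n w m a b = {}"
      proof (rule ccontr)
        assume "catalan_mons n w m a b \<noteq> {}"
        then obtain t where "t \<in> catalan_mons n w m a b" by blast
        from cm(3-5)[OF this] show False using c by simp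
      qed
      then show ?thesis unfolding rec if_not_P[OF c] by simp
    qed
  qed
qed

text \<open>Partial degrees of \<open>m\<close> never exceed its degree, so from that degree on the
  minimum is inactive.\<close>

lemma catalan_mons_eq_stable_gens:
  assumes "wdeg w m \<le> a"
  shows "catalan_mons n w m a b = {t \<in> stable_gens n w m. wdeg w t = a \<and> max_var t = b}"
proof -
  have "min (wpart w c m) a = wpart w c m" for c
    using wpart_le_wdeg[OF m, of w c] assms by simp
  then show ?thesis by (auto simp: catalan_mons_def stable_gens_def stable_mons_def)
qed

end

section \<open>Principal stable ideals\<close>

text \<open>For \<open>B\<close> closed under multiplication this is the monomial ideal with the
  monomials of \<open>B\<close>, so that membership is a condition on exponents alone.\<close>

definition mon_polys :: "nat \<Rightarrow> monomial set \<Rightarrow> ('k::field) mpoly set" where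
  "mon_polys n B = {p \<in> polys n. Poly_Mapping.keys p \<subseteq> B}"

lemma mpoly_ring_simps [simp]:
  "carrier (mpoly_ring n) = polys n" "p \<otimes>\<^bsub>mpoly_ring n\<^esub> q = p * q"
  "p \<oplus>\<^bsub>mpoly_ring n\<^esub> q = p + q" "\<zero>\<^bsub>mpoly_ring n\<^esub> = 0"
  by (simp_all add: mpoly_ring_def)

lemma ring_mpoly_ring: "ring (mpoly_ring n)"
  using cring_mpoly_ring by (rule cring.axioms(1))

lemma polys_closed:
  "p \<in> polys n \<Longrightarrow> q \<in> polys n \<Longrightarrow> p * q \<in> polys n"
  "p \<in> polys n \<Longrightarrow> q \<in> polys n \<Longrightarrow> p + q \<in> polys n"
  "p \<in> polys n \<Longrightarrow> - p \<in> polys n"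
  using ring.ring_simprules(1,5)[OF ring_mpoly_ring, of p n q] by (simp_all add: polys_def)

lemma keys_mpol [simp]: "Poly_Mapping.keys (mpol t :: ('k::field) mpoly) = {t}"
  by (simp add: mpol_def)

lemma mpol_in_polys [simp]: "(mpol t :: ('k::field) mpoly) \<in> polys n \<longleftrightarrow> t \<in> monomials n"
  by (simp add: polys_def)

lemma mpol_in_mon_polys [simp]: "(mpol t :: ('k::field) mpoly) \<in> mon_polys n B \<longleftrightarrow> t \<in> monomials n \<and> t \<in> B"
  by (simp add: mon_polys_def)

lemma mpol_mult: "mpol s * mpol t = (mpol (s + t) :: ('k::field) mpoly)"
  by (simp add: mpol_def mult_single)

lemma Const_mult_mpol: "Const c * mpol t = Poly_Mapping.single t c"
  by (simp add: Const_def mpol_def mult_single)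

lemma sum_single_lookup: "(\<Sum>t\<in>Poly_Mapping.keys p. Poly_Mapping.single t (Poly_Mapping.lookup p t)) = p"
proof (rule poly_mapping_eqI)
  fix s
  have "(\<Sum>t\<in>Poly_Mapping.keys p. Poly_Mapping.lookup p t when t = s) =
      (\<Sum>t\<in>Poly_Mapping.keys p. if t = s then Poly_Mapping.lookup p t else 0)"
    by (simp add: when_def)
  then show "Poly_Mapping.lookup (\<Sum>t\<in>Poly_Mapping.keys p. Poly_Mapping.single t (Poly_Mapping.lookup p t)) s = Poly_Mapping.lookup p s"
    by (simp add: lookup_sum lookup_single in_keys_iff)
qed

lemma ideal_mon_polys:
  assumes "\<And>s t. t \<in> B \<Longrightarrow> s \<in> monomials n \<Longrightarrow> s + t \<in> B"
  shows "ideal (mon_polys n B :: ('k::field) mpoly set) (mpoly_ring n)"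
proof -
  have mult: "x * a \<in> mon_polys n B" if a: "a \<in> mon_polys n B" and x: "x \<in> polys n" for a x :: "'k mpoly"
  proof -
    have "t \<in> B" if t: "t \<in> Poly_Mapping.keys (x * a)" for t
    proof -
      obtain r s where "t = r + s" "r \<in> Poly_Mapping.keys x" "s \<in> Poly_Mapping.keys a"
        using Poly_Mapping.keys_mult[of x a] t by blast
      moreover have "r \<in> monomials n" "s \<in> B"
        using calculation a x unfolding mon_polys_def polys_def by blast+
      ultimately show ?thesis using assms by simp
    qed
    then show ?thesis using polys_closed(1)[OF x, of a] a by (auto simp: mon_polys_def)
  qed
  show ?thesis
  proof (rule idealI[OF ring_mpoly_ring])
    show "subgroup (mon_polys n B) (add_monoid (mpoly_ring n :: 'k mpoly ring))"
    proof (rule subgroup.intro)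
      fix x :: "'k mpoly" assume x: "x \<in> mon_polys n B"
      then have "- x \<oplus>\<^bsub>mpoly_ring n\<^esub> x = \<zero>\<^bsub>mpoly_ring n\<^esub>" "x \<in> carrier (mpoly_ring n)" "- x \<in> carrier (mpoly_ring n)"
        by (auto simp: mon_polys_def polys_closed)
      then have "\<ominus>\<^bsub>mpoly_ring n\<^esub> x = - x"
        by (rule abelian_group.minus_equality[OF ring.is_abelian_group[OF ring_mpoly_ring]])
      then show "inv\<^bsub>add_monoid (mpoly_ring n)\<^esub> x \<in> mon_polys n B"
        using x by (simp add: a_inv_def mon_polys_def polys_closed)
    next
      fix x y :: "'k mpoly" assume "x \<in> mon_polys n B" "y \<in> mon_polys n B"
      then show "x \<otimes>\<^bsub>add_monoid (mpoly_ring n)\<^esub> y \<in> mon_polys n B"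
        using Poly_Mapping.keys_add[of x y] by (auto simp: mon_polys_def polys_closed)
    qed (auto simp: mon_polys_def polys_def)
  next
    fix a x :: "'k mpoly" assume a: "a \<in> mon_polys n B" "x \<in> carrier (mpoly_ring n)"
    then show "x \<otimes>\<^bsub>mpoly_ring n\<^esub> a \<in> mon_polys n B" using mult by simp
    then show "a \<otimes>\<^bsub>mpoly_ring n\<^esub> x \<in> mon_polys n B" by (simp add: mult.commute)
  qed
qed

lemma mon_polys_subset_ideal:
  assumes J: "ideal J (mpoly_ring n)" and B: "\<And>t. t \<in> B \<Longrightarrow> t \<in> monomials n \<Longrightarrow> mpol t \<in> J"
  shows "mon_polys n B \<subseteq> (J :: ('k::field) mpoly set)"
proof
  fix p :: "'k mpoly" assume p: "p \<in> mon_polys n B"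
  note J' = ideal.axioms(1)[OF J]
  have "(\<Sum>t\<in>A. Poly_Mapping.single t (Poly_Mapping.lookup p t)) \<in> J" if "finite A" "A \<subseteq> Poly_Mapping.keys p" for A
    using that
  proof (induction A)
    case empty
    then show ?case using additive_subgroup.zero_closed[OF J'] by simp
  next
    case (insert t A)
    have "Const (Poly_Mapping.lookup p t) \<otimes>\<^bsub>mpoly_ring n\<^esub> mpol t \<in> J"
    proof (rule ideal.I_l_closed[OF J])
      show "mpol t \<in> J" using insert.prems p by (intro B) (auto simp: mon_polys_def polys_def)
      show "Const (Poly_Mapping.lookup p t) \<in> carrier (mpoly_ring n)"
        by (auto simp: Const_def polys_def monomials_def)
    qed
    then show ?case
      using insert additive_subgroup.a_closed[OF J', of "Poly_Mapping.single t (Poly_Mapping.lookup p t)"]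
      by (simp add: Const_mult_mpol)
  qed
  from this[OF finite_keys subset_refl] show "p \<in> J" by (simp only: sum_single_lookup)
qed

lemma mon_polys_eq_genideal:
  assumes "B \<subseteq> monomials n" and up: "\<And>s t. t \<in> B \<Longrightarrow> s \<in> monomials n \<Longrightarrow> s + t \<in> B"
  shows "(mon_polys n B :: ('k::field) mpoly set) = Idl\<^bsub>mpoly_ring n\<^esub> (mpol ` B)"
proof
  have sub: "(mpol ` B :: 'k mpoly set) \<subseteq> carrier (mpoly_ring n)" using assms(1) by auto
  show "(mon_polys n B :: 'k mpoly set) \<subseteq> Idl\<^bsub>mpoly_ring n\<^esub> (mpol ` B)"
    using ring.genideal_self[OF ring_mpoly_ring sub]
    by (intro mon_polys_subset_ideal ring.genideal_ideal[OF ring_mpoly_ring sub]) auto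
  show "Idl\<^bsub>mpoly_ring n\<^esub> (mpol ` B) \<subseteq> (mon_polys n B :: 'k mpoly set)"
    using assms(1) by (intro ring.genideal_minimal[OF ring_mpoly_ring] ideal_mon_polys up) auto
qed

text \<open>The explicit form of the monomials in the principal Borel ideal of \<open>\<mu>\<close>.
  Degrees may differ, so multiples are included.\<close>

definition borel_mons :: "nat \<Rightarrow> monomial \<Rightarrow> monomial set" where
  "borel_mons n \<mu> = {\<nu> \<in> monomials n. \<forall>c\<le>n. npart c \<mu> \<le> npart c \<nu>}"

text \<open>Each factor is replaced by one with smaller index, so no count over an initial segment
  of the variables can drop.\<close>

lemma borel_move_npart:
  assumes "borel_move n \<mu> \<mu>'" "\<mu> \<in> monomials n"
  shows "\<mu>' \<in> monomials n" "npart c \<mu> \<le> npart c \<mu>'"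
proof -
  obtain ps \<nu> where ps: "\<forall>(i, j)\<in>set ps. 1 \<le> i \<and> i < j \<and> j \<le> n"
    and \<mu>: "\<mu> = \<nu> + (\<Sum>(i, j)\<leftarrow>ps. Poly_Mapping.single j 1)" "\<mu>' = \<nu> + (\<Sum>(i, j)\<leftarrow>ps. Poly_Mapping.single i 1)"
    using assms(1) by (auto simp: borel_move_def)
  have "npart c (\<Sum>(i, j)\<leftarrow>ps. Poly_Mapping.single j 1) \<le> npart c (\<Sum>(i, j)\<leftarrow>ps. Poly_Mapping.single i 1) \<and>
      (\<Sum>(i, j)\<leftarrow>ps. Poly_Mapping.single i 1) \<in> monomials n"
    using ps
  proof (induction ps)
    case Nil
    then show ?case by (simp add: monomials_def)
  next
    case (Cons x ps)
    obtain i j where x: "x = (i, j)" by (cases x)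
    have ij: "1 \<le> i" "i < j" "j \<le> n" using Cons.prems x by auto
    have "npart c (Poly_Mapping.single j 1) \<le> npart c (Poly_Mapping.single i 1)"
      using ij by (simp add: npart_single)
    moreover have "Poly_Mapping.single i 1 \<in> monomials n" using ij by (simp add: monomials_def)
    moreover have "s + t \<in> monomials n" if "s \<in> monomials n" "t \<in> monomials n" for s t
      using that Poly_Mapping.keys_add[of s t] by (auto simp: monomials_def)
    ultimately show ?case using Cons x by (simp add: npart_add add_mono)
  qed
  moreover have "\<nu> \<in> monomials n"
    using assms(2) keys_mdvd[of \<nu> \<mu>] \<mu>(1) by (auto simp: monomials_def)
  ultimately show "\<mu>' \<in> monomials n" "npart c \<mu> \<le> npart c \<mu>'"
    using Poly_Mapping.keys_add[of \<nu> "\<Sum>(i, j)\<leftarrow>ps. Poly_Mapping.single i 1"]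
    by (auto simp: \<mu> npart_add monomials_def)
qed

lemma strongly_stable_borel_mons: "strongly_stable n (mon_polys n (borel_mons n \<mu>) :: ('k::field) mpoly set)"
proof -
  have "s + t \<in> borel_mons n \<mu>" if "t \<in> borel_mons n \<mu>" "s \<in> monomials n" for s t
    using that Poly_Mapping.keys_add[of s t]
    by (auto simp: borel_mons_def npart_add monomials_def intro: trans_le_add2)
  then have "(mon_polys n (borel_mons n \<mu>) :: 'k mpoly set) = Idl\<^bsub>mpoly_ring n\<^esub> (mpol ` borel_mons n \<mu>)"
    by (intro mon_polys_eq_genideal) (auto simp: borel_mons_def)
  then have "monomial_ideal n (mon_polys n (borel_mons n \<mu>) :: 'k mpoly set)"
    unfolding monomial_ideal_def by (intro exI[of _ "borel_mons n \<mu>"]) (auto simp: borel_mons_def)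
  moreover have "(mpol \<nu>' :: 'k mpoly) \<in> mon_polys n (borel_mons n \<mu>)"
    if \<nu>: "(mpol \<nu> :: 'k mpoly) \<in> mon_polys n (borel_mons n \<mu>)" and move: "borel_move n \<nu> \<nu>'" for \<nu> \<nu>'
  proof -
    have "\<nu> \<in> monomials n" "\<forall>c\<le>n. npart c \<mu> \<le> npart c \<nu>" using \<nu> by (simp_all add: borel_mons_def)
    then show ?thesis
      using borel_move_npart(1)[OF move] le_trans[OF _ borel_move_npart(2)[OF move]] by (simp add: borel_mons_def)
  qed
  ultimately show ?thesis
    unfolding strongly_stable_def by blast
qed

text \<open>\<open>\<nu>\<close> is reached from \<open>\<mu>\<close> by steps that raise some
  counts by one without exceeding those of \<open>\<nu>\<close>; the total deficit decreases. At an
  index \<open>c\<close> with a deficit, a later factor of \<open>\<mu>\<close> is moved to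
  \<open>c\<close>, or, if there is none, \<open>\<mu>\<close> is multiplied by the variable
  \<open>c\<close>.\<close>

lemma strongly_stable_contains_borel_mons:
  assumes J: "strongly_stable n (J :: ('k::field) mpoly set)"
    and \<mu>: "mpol \<mu> \<in> J" "\<mu> \<in> monomials n" and \<nu>: "\<nu> \<in> borel_mons n \<mu>"
  shows "mpol \<nu> \<in> J"
proof -
  obtain M where "M \<subseteq> monomials n" "J = Idl\<^bsub>mpoly_ring n\<^esub> (mpol ` M)"
    using J by (auto simp: strongly_stable_def monomial_ideal_def)
  then have ideal: "ideal J (mpoly_ring n)"
    by (auto intro!: ring.genideal_ideal[OF ring_mpoly_ring])
  have \<nu>m: "\<nu> \<in> monomials n" using \<nu> by (simp add: borel_mons_def)
  show ?thesis using \<mu> \<nu>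
  proof (induction "\<Sum>c\<in>{1..n}. npart c \<nu> - npart c \<mu>" arbitrary: \<mu> rule: less_induct)
    case less
    have le: "npart c \<mu> \<le> npart c \<nu>" if "c \<le> n" for c using less.prems(3) that by (simp add: borel_mons_def)
    show ?case
    proof (cases "\<forall>c\<in>{1..n}. npart c \<mu> = npart c \<nu>")
      case True
      then have "\<mu> = \<nu>" using npart_eqI[OF less.prems(2) \<nu>m] by blast
      then show ?thesis using less.prems by simp
    next
      case False
      then obtain c where c': "c \<in> {1..n}" "npart c \<mu> \<noteq> npart c \<nu>" by blast
      then have c: "1 \<le> c" "c \<le> n" "npart c \<mu> < npart c \<nu>" using le[of c] by auto
      have step: ?thesis if \<mu>': "mpol \<mu>' \<in> J" "\<mu>' \<in> monomials n"
        and b: "\<And>b. b \<le> n \<Longrightarrow> npart b \<mu> \<le> npart b \<mu>' \<and> npart b \<mu>' \<le> npart b \<nu>" "npart c \<mu> < npart c \<mu>'" for \<mu>'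
      proof (rule less.hyps[OF _ \<mu>'])
        show "(\<Sum>b\<in>{1..n}. npart b \<nu> - npart b \<mu>') < (\<Sum>b\<in>{1..n}. npart b \<nu> - npart b \<mu>)"
        proof (rule sum_strict_mono_ex1)
          show "\<forall>b\<in>{1..n}. npart b \<nu> - npart b \<mu>' \<le> npart b \<nu> - npart b \<mu>"
            using b(1) by (auto intro: diff_le_mono2)
          show "\<exists>b\<in>{1..n}. npart b \<nu> - npart b \<mu>' < npart b \<nu> - npart b \<mu>"
            using c b(1)[OF c(2)] b(2) by (intro bexI[of _ c]) auto
        qed simp
        show "\<nu> \<in> borel_mons n \<mu>'" using \<nu>m b(1) by (simp add: borel_mons_def)
      qed
      have cm: "Poly_Mapping.single c 1 \<in> monomials n" using c by (simp add: monomials_def)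
      show ?thesis
      proof (cases "\<exists>j>c. Poly_Mapping.lookup \<mu> j > 0")
        case True
        \<comment> \<open>The nearest factor after \<open>c\<close> keeps the step admissible: only
          the counts at \<open>b\<close> with \<open>c \<le> b\<close> and \<open>b < j\<close>
          rise, and there \<open>\<mu>\<close> has the same count as at \<open>c\<close>, hence a
          deficit.\<close>
        define j where "j = (LEAST j. c < j \<and> Poly_Mapping.lookup \<mu> j > 0)"
        have j: "c < j" "Poly_Mapping.lookup \<mu> j > 0"
          using LeastI_ex[OF True] by (auto simp: j_def)
        have jn: "j \<le> n" using j(2) less.prems(2) by (auto simp: monomials_def in_keys_iff subset_iff)
        have zero: "Poly_Mapping.lookup \<mu> i = 0" if "c < i" "i < j" for i
          using not_less_Least[of i "\<lambda>j. c < j \<and> Poly_Mapping.lookup \<mu> j > 0"] that by (simp add: j_def)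
        define \<rho> where "\<rho> = \<mu> - Poly_Mapping.single j 1"
        have \<rho>: "\<mu> = \<rho> + Poly_Mapping.single j 1"
          unfolding \<rho>_def using j(2) mdvd_minus_add[of "Poly_Mapping.single j 1" \<mu>]
          unfolding mdvd_single by (simp add: in_keys_iff)
        let ?\<mu>' = "\<rho> + Poly_Mapping.single c 1"
        have move: "borel_move n \<mu> ?\<mu>'"
          unfolding borel_move_def using \<rho> c j jn by (intro exI[of _ "[(c, j)]"] exI[of _ \<rho>]) simp
        show ?thesis
        proof (rule step)
          show "mpol ?\<mu>' \<in> J" using J move less.prems(1) by (auto simp: strongly_stable_def)
          show "?\<mu>' \<in> monomials n" by (rule borel_move_npart(1)[OF move less.prems(2)])
          show "npart c \<mu> < npart c ?\<mu>'" using j(1) c by (simp add: \<rho> npart_add npart_single)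
          fix b assume b: "b \<le> n"
          show "npart b \<mu> \<le> npart b ?\<mu>' \<and> npart b ?\<mu>' \<le> npart b \<nu>"
          proof (intro conjI borel_move_npart(2)[OF move less.prems(2)])
            show "npart b ?\<mu>' \<le> npart b \<nu>"
            proof (cases "c \<le> b \<and> b < j")
              case True
              have "npart b \<mu> = npart c \<mu>"
                unfolding npart_eq using True zero by (intro sum.mono_neutral_right) auto
              also have "\<dots> < npart c \<nu>" by (rule c(3))
              also have "\<dots> \<le> npart b \<nu>" unfolding npart_eq using True by (intro sum_mono2) auto
              finally have "npart b \<mu> < npart b \<nu>" .
              then show ?thesis using True c by (simp add: \<rho> npart_add npart_single)
            next
              case False
              then show ?thesis using le[OF b] j c by (auto simp: \<rho> npart_add npart_single)
            qed
          qed
        qed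
      next
        case False
        let ?\<mu>' = "Poly_Mapping.single c 1 + \<mu>"
        show ?thesis
        proof (rule step)
          show "mpol ?\<mu>' \<in> J"
            using ideal.I_l_closed[OF ideal less.prems(1), of "mpol (Poly_Mapping.single c 1)"] cm
            by (simp add: mpol_mult)
          show "?\<mu>' \<in> monomials n"
            using cm less.prems(2) Poly_Mapping.keys_add[of "Poly_Mapping.single c 1" \<mu>] by (auto simp: monomials_def)
          show "npart c \<mu> < npart c ?\<mu>'" using c by (simp add: npart_add npart_single)
          fix b assume b: "b \<le> n"
          have "npart b \<mu> < npart b \<nu>" if "c \<le> b"
          proof -
            have "npart b \<mu> = npart c \<mu>"
              unfolding npart_eq using that False by (intro sum.mono_neutral_right) auto
            also have "\<dots> < npart c \<nu>" by (rule c(3))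
            also have "\<dots> \<le> npart b \<nu>" unfolding npart_eq using that by (intro sum_mono2) auto
            finally show ?thesis .
          qed
          then show "npart b \<mu> \<le> npart b ?\<mu>' \<and> npart b ?\<mu>' \<le> npart b \<nu>"
            using le[OF b] by (auto simp: npart_add npart_single)
        qed
      qed
    qed
  qed
qed

lemma Borel_mpol:
  assumes "\<mu> \<in> monomials n"
  shows "Borel n (mpol \<mu>) = (mon_polys n (borel_mons n \<mu>) :: ('k::field) mpoly set)"
proof
  show "Borel n (mpol \<mu>) \<subseteq> (mon_polys n (borel_mons n \<mu>) :: 'k mpoly set)"
    unfolding Borel_def using strongly_stable_borel_mons assms
    by (intro Inter_lower) (simp add: borel_mons_def)
  show "(mon_polys n (borel_mons n \<mu>) :: 'k mpoly set) \<subseteq> Borel n (mpol \<mu>)"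
    unfolding Borel_def
  proof (rule Inter_greatest)
    fix J :: "'k mpoly set" assume "J \<in> {J. strongly_stable n J \<and> mpol \<mu> \<in> J}"
    then have J: "strongly_stable n J" "mpol \<mu> \<in> J" by auto
    obtain M where "M \<subseteq> monomials n" "J = Idl\<^bsub>mpoly_ring n\<^esub> (mpol ` M)"
      using J by (auto simp: strongly_stable_def monomial_ideal_def)
    then have "ideal J (mpoly_ring n)"
      by (auto intro!: ring.genideal_ideal[OF ring_mpoly_ring])
    then show "mon_polys n (borel_mons n \<mu>) \<subseteq> J"
      using strongly_stable_contains_borel_mons[OF J assms] by (intro mon_polys_subset_ideal) auto
  qed
qed

text \<open>Positive weights make \<open>psi_exp w\<close> injective on the monomials in question,
  so distinct terms do not collide and nothing cancels.\<close>

lemma keys_psi: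
  fixes p :: "('k::field) mpoly"
  assumes w: "weight_vector n w" and p: "p \<in> polys n"
  shows "Poly_Mapping.keys (psi w p) = psi_exp w ` Poly_Mapping.keys p"
proof -
  have inj: "s = t" if "s \<in> monomials n" "t \<in> monomials n" "psi_exp w s = psi_exp w t" for s t
  proof (rule poly_mapping_eqI)
    fix i
    show "Poly_Mapping.lookup s i = Poly_Mapping.lookup t i"
    proof (cases "i \<in> {1..n}")
      case True
      then have "0 < w i" using w by (simp add: weight_vector_def)
      then show ?thesis using arg_cong[OF that(3), of "\<lambda>x. Poly_Mapping.lookup x i"] by (simp add: lookup_psi_exp)
    next
      case False
      then have "i \<notin> Poly_Mapping.keys s" "i \<notin> Poly_Mapping.keys t" using that(1,2) by (auto simp: monomials_def)
      then show ?thesis by (simp add: in_keys_iff)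
    qed
  qed
  have "(\<Prod>i\<in>Poly_Mapping.keys t. (Var i ^ w i) ^ Poly_Mapping.lookup t i) = (mpol (psi_exp w t) :: 'k mpoly)" for t
  proof -
    have "(mpol (psi_exp w t) :: 'k mpoly) = psi w (mpol t)" by (rule psi_mon[symmetric])
    also have "\<dots> = (\<Prod>i\<in>Poly_Mapping.keys t. (Var i ^ w i) ^ Poly_Mapping.lookup t i)"
      by (simp add: psi_def mpol_def Const_def)
    finally show ?thesis by simp
  qed
  then have psi: "psi w p = (\<Sum>t\<in>Poly_Mapping.keys p. Poly_Mapping.single (psi_exp w t) (Poly_Mapping.lookup p t))"
    by (simp add: psi_def Const_mult_mpol)
  have "psi_exp w t \<in> Poly_Mapping.keys (psi w p)" if t: "t \<in> Poly_Mapping.keys p" for t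
  proof -
    have "Poly_Mapping.lookup (psi w p) (psi_exp w t) =
        (\<Sum>s\<in>Poly_Mapping.keys p. if s = t then Poly_Mapping.lookup p s else 0)"
      unfolding psi lookup_sum
    proof (intro sum.cong refl)
      fix s assume s: "s \<in> Poly_Mapping.keys p"
      have "psi_exp w s = psi_exp w t \<longleftrightarrow> s = t" using inj[of s t] s t p by (auto simp: polys_def)
      then show "Poly_Mapping.lookup (Poly_Mapping.single (psi_exp w s) (Poly_Mapping.lookup p s)) (psi_exp w t) =
          (if s = t then Poly_Mapping.lookup p s else 0)" by (simp add: lookup_single)
    qed
    then show ?thesis using t by (simp add: in_keys_iff)
  qed
  moreover have "Poly_Mapping.keys (psi w p) \<subseteq> psi_exp w ` Poly_Mapping.keys p"
    unfolding psi using Poly_Mapping.keys_sum[of "\<lambda>t. Poly_Mapping.single (psi_exp w t) (Poly_Mapping.lookup p t)" "Poly_Mapping.keys p"]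
    by (auto split: if_splits)
  ultimately show ?thesis by blast
qed

text \<open>Both sides are determined by exponents, and the counts of \<open>psi_exp w t\<close> are
  the weighted partial degrees of \<open>t\<close>.\<close>

lemma principal_stable_eq:
  assumes w: "weight_vector n w" and m: "m \<in> monomials n"
  shows "principal_stable n w m = (mon_polys n (stable_mons n w m) :: ('k::field) mpoly set)"
proof -
  have iff: "psi_exp w t \<in> borel_mons n (psi_exp w m) \<longleftrightarrow> t \<in> stable_mons n w m" if "t \<in> monomials n" for t
    using that by (simp add: borel_mons_def stable_mons_def npart_psi_exp psi_exp_monomials)
  have "psi w p \<in> Borel n (psi w (mpol m)) \<longleftrightarrow> Poly_Mapping.keys p \<subseteq> stable_mons n w m"
    if p: "p \<in> polys n" for p :: "'k mpoly"
  proof -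
    have pm: "t \<in> monomials n" if "t \<in> Poly_Mapping.keys p" for t using p that by (auto simp: polys_def)
    have "psi w p \<in> polys n"
      using pm psi_exp_monomials by (auto simp: polys_def keys_psi[OF w p])
    then have "psi w p \<in> Borel n (psi w (mpol m)) \<longleftrightarrow> psi_exp w ` Poly_Mapping.keys p \<subseteq> borel_mons n (psi_exp w m)"
      by (simp add: psi_mon Borel_mpol[OF psi_exp_monomials[OF m]] mon_polys_def keys_psi[OF w p])
    also have "\<dots> \<longleftrightarrow> Poly_Mapping.keys p \<subseteq> stable_mons n w m" using iff pm by blast
    finally show ?thesis .
  qed
  then show ?thesis by (auto simp: principal_stable_def mon_polys_def)
qed

section \<open>The Poincare series\<close>

lemma coeff_u_t: "fps_nth (fps_nth (u_var ^ h * t_var ^ e) i) j = (if h = i \<and> e = j then 1 else 0)"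
  by (simp add: u_var_def t_var_def fps_const_power fps_X_power_nth)

lemma coeff_sum_u_t:
  assumes "finite L"
  shows "fps_nth (fps_nth (\<Sum>x\<in>L. u_var ^ h x * t_var ^ e x) i) j = int (card {x \<in> L. h x = i \<and> e x = j})"
  using assms by (simp add: fps_sum_nth coeff_u_t sum.If_cases Int_def)

text \<open>The expansion has one term for each set of variables, matching the labels over a fixed
  generator.\<close>

lemma prod_one_plus_u_t:
  assumes "finite A"
  shows "(\<Prod>k\<in>A. 1 + u_var * t_var ^ w k) = (\<Sum>\<sigma>\<in>Pow A. u_var ^ card \<sigma> * t_var ^ (\<Sum>k\<in>\<sigma>. w k))"
  using prod_add[OF assms, of "\<lambda>k. u_var * t_var ^ w k" "\<lambda>_. 1"]
  by (simp add: add.commute prod.distrib power_sum)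

theorem corollary13:
  fixes n d :: nat and w :: "nat \<Rightarrow> nat" and m :: monomial and I :: "('k::field) mpoly set"
  assumes "weight_vector n w"
    and "m \<in> monomials n"
    and "d = wdeg w m"
    and "I = principal_stable n w m"
  shows "poincare_series n w I =
    (\<Sum>a=d..d + Max (w ` {1..n}) - 1. \<Sum>b=1..n.
       of_nat (catalan w m a b) * u_var * t_var ^ a * (\<Prod>k=1..b-1. 1 + u_var * t_var ^ w k))"
proof -
  note w = assms(1) and m = assms(2)
  define G where "G = stable_gens n w m"
  define V where "V = (\<lambda>u :: monomial. {1..<max_var u})"
  let ?J = "{\<alpha>. \<exists>u\<in>G. mdvd u \<alpha>}"
  let ?deg = "\<lambda>x. wdeg w (ek_mdeg x)"
  have finG: "finite G" unfolding G_def by (rule finite_stable_gens[OF w m])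
  have G: "u \<in> monomials n" "1 \<le> max_var u" "max_var u \<le> n" "d \<le> wdeg w u" "wdeg w u \<le> d + w 1 - 1"
    if "u \<in> G" for u
    using stable_gens_wdeg[OF w m that[unfolded G_def]] max_var_bounds[OF w] assms(3) by auto
  \<comment> \<open>The basis without \<open>None\<close>, since the ring itself does not contribute
    to the series.\<close>
  define L where "L = (\<lambda>(u, \<sigma>). Some (\<sigma>, u)) ` Sigma G (\<lambda>u. Pow (V u))"
  have E: "ek_basis V G = insert None L" by (auto simp: ek_basis_def L_def)
  have I: "I = {p \<in> polys n. Poly_Mapping.keys p \<subseteq> ?J}"
  proof -
    have "Poly_Mapping.keys p \<subseteq> stable_mons n w m \<longleftrightarrow> Poly_Mapping.keys p \<subseteq> ?J" if "p \<in> polys n" for p :: "'k mpoly"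
      using that stable_mons_iff[OF w m] unfolding G_def polys_def by blast
    then show ?thesis unfolding assms(4) principal_stable_eq[OF w m] mon_polys_def by blast
  qed
  obtain D where D: "strand_res (ek_basis V G) ek_hdeg ek_mdeg None (D :: ek_label \<Rightarrow> ek_label \<Rightarrow> 'k) ?J"
    using stable_gens_strand_res[OF w m] unfolding G_def V_def by blast
  have mon: "ek_mdeg x \<in> monomials n" if mem: "x \<in> ek_basis V G" for x
  proof (cases x)
    case None
    then show ?thesis by (simp add: monomials_def)
  next
    case (Some y)
    then obtain u \<sigma> where x: "x = Some (\<sigma>, u)" "u \<in> G" "\<sigma> \<subseteq> V u" using mem by (auto simp: ek_basis_def)
    then have "finite \<sigma>" using finite_subset by (auto simp: V_def)
    then have "xmon \<sigma> \<in> monomials n" using x G(3)[OF x(2)] by (auto simp: monomials_def keys_xmon V_def)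
    then show ?thesis using monomials_add G(1)[OF x(2)] x(1) by simp
  qed
  obtain F :: "'k mpoly aug_complex" where F: "graded_free_resolution n w I F"
    "\<And>i l k. l < rk F i \<Longrightarrow> k < rk F (Suc i) \<Longrightarrow> Poly_Mapping.lookup (dmat F i l k) 0 = 0"
    "\<And>i j. card {k. k < rk F i \<and> bdeg F i k = j} = card {x \<in> ek_basis V G. ek_hdeg x = Suc i \<and> ?deg x = j}"
    using graded_free_resolution_of_strand_res[OF D mon, of w] unfolding I by blast
  have "graded_free_resolution n w I (SOME F. graded_free_resolution n w I F)" using F(1) by (rule someI)
  then have tor: "tor_dim n w I i j = card {x \<in> ek_basis V G. ek_hdeg x = Suc i \<and> ?deg x = j}" for i j
    unfolding tor_dim_def F(3)[symmetric] by (rule homology_dim_eq_card[OF _ F(1,2)])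
  \<comment> \<open>The index shift in \<open>betti\<close> matches the one between
    \<open>ek_hdeg\<close> and the positions of \<open>F\<close>, so \<open>ek_hdeg\<close> is the
    exponent of \<open>u_var\<close>.\<close>
  have betti: "betti n w I i j = card {x \<in> L. ek_hdeg x = i \<and> ?deg x = j}" for i j
  proof (cases i)
    case 0
    have empty: "{x \<in> L. ek_hdeg x = 0 \<and> ?deg x = j} = {}" by (auto simp: L_def)
    show ?thesis unfolding 0 empty by (simp add: betti_def)
  next
    case (Suc i')
    have "{x \<in> ek_basis V G. ek_hdeg x = Suc i' \<and> ?deg x = j} = {x \<in> L. ek_hdeg x = i \<and> ?deg x = j}"
      unfolding E Suc by auto
    then show ?thesis using Suc by (simp add: betti_def tor)
  qed
  have finL: "finite L" unfolding L_def using finG by (auto simp: V_def)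
  have "poincare_series n w I = (\<Sum>x\<in>L. u_var ^ ek_hdeg x * t_var ^ ?deg x)"
    by (intro fps_ext) (simp add: poincare_series_def betti coeff_sum_u_t[OF finL])
  also have "\<dots> = (\<Sum>(u, \<sigma>)\<in>Sigma G (\<lambda>u. Pow (V u)). u_var ^ Suc (card \<sigma>) * t_var ^ ((\<Sum>k\<in>\<sigma>. w k) + wdeg w u))"
    unfolding L_def by (subst sum.reindex) (auto simp: inj_on_def wdeg_add wdeg_xmon intro!: sum.cong)
  also have "\<dots> = (\<Sum>u\<in>G. \<Sum>\<sigma>\<in>Pow (V u). u_var ^ Suc (card \<sigma>) * t_var ^ ((\<Sum>k\<in>\<sigma>. w k) + wdeg w u))"
    using finG by (subst sum.Sigma) (auto simp: V_def)
  also have "\<dots> = (\<Sum>u\<in>G. u_var * t_var ^ wdeg w u * (\<Prod>k\<in>V u. 1 + u_var * t_var ^ w k))"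
    by (intro sum.cong refl, subst prod_one_plus_u_t)
      (simp_all add: V_def sum_distrib_left power_add algebra_simps)
  finally have lhs: "poincare_series n w I =
      (\<Sum>u\<in>G. u_var * t_var ^ wdeg w u * (\<Prod>k\<in>V u. 1 + u_var * t_var ^ w k))" .
  have Max: "Max (w ` {1..n}) = w 1"
    using w by (intro Max_eqI) (auto simp: weight_vector_def)
  let ?T = "{d..d + w 1 - 1} \<times> {1..n}"
  have "(\<Sum>a=d..d + w 1 - 1. \<Sum>b=1..n.
       of_nat (catalan w m a b) * u_var * t_var ^ a * (\<Prod>k=1..b-1. 1 + u_var * t_var ^ w k)) =
     (\<Sum>(a, b)\<in>?T. of_nat (catalan w m a b) * u_var * t_var ^ a * (\<Prod>k=1..b-1. 1 + u_var * t_var ^ w k))"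
    by (simp add: sum.cartesian_product)
  also have "\<dots> = (\<Sum>y\<in>?T. \<Sum>u\<in>{u \<in> G. (wdeg w u, max_var u) = y}.
      u_var * t_var ^ wdeg w u * (\<Prod>k\<in>V u. 1 + u_var * t_var ^ w k))"
  proof (intro sum.cong refl)
    fix y assume "y \<in> ?T"
    then obtain a b where y: "y = (a, b)" "d \<le> a" "1 \<le> b" "b \<le> n" by auto
    have V: "V u = {1..b-1}" if "max_var u = b" for u using that y(3) by (auto simp: V_def)
    have cat: "catalan w m a b = card {u \<in> G. wdeg w u = a \<and> max_var u = b}"
      using catalan_eq_card[OF w m y(3,4), of a] catalan_mons_eq_stable_gens[OF w m, of a b] y(2) assms(3)
      by (simp add: G_def)
    have "(\<Sum>u\<in>{u \<in> G. (wdeg w u, max_var u) = y}. u_var * t_var ^ wdeg w u * (\<Prod>k\<in>V u. 1 + u_var * t_var ^ w k)) =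
        (\<Sum>u\<in>{u \<in> G. wdeg w u = a \<and> max_var u = b}. u_var * t_var ^ a * (\<Prod>k=1..b-1. 1 + u_var * t_var ^ w k))"
      by (intro sum.cong) (auto simp: y(1) V)
    then show "(case y of (a, b) \<Rightarrow> of_nat (catalan w m a b) * u_var * t_var ^ a * (\<Prod>k=1..b-1. 1 + u_var * t_var ^ w k)) =
        (\<Sum>u\<in>{u \<in> G. (wdeg w u, max_var u) = y}. u_var * t_var ^ wdeg w u * (\<Prod>k\<in>V u. 1 + u_var * t_var ^ w k))"
      by (simp add: y(1) cat mult.assoc)
  qed
  \<comment> \<open>The bounds on the degree and the last variable put every generator into exactly
    one cell of the range.\<close>
  also have "\<dots> = (\<Sum>u\<in>G. u_var * t_var ^ wdeg w u * (\<Prod>k\<in>V u. 1 + u_var * t_var ^ w k))"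
    using finG G by (intro sum.group) auto
  finally show ?thesis unfolding lhs Max by simp
qed

end
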